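(* Let $F$ be a field with $\operatorname{char}(F)\neq 2$, and let $r,s,n$ be positive integers. If a sums-of-squares formula of type $[r,s,n]$ exists over $F$, then $2^{\lfloor \frac{s-1}{2} \rfloor -i+1}$ divides the binomial coefficient $\binom{r+i-1}{i}$ for every integer $i$ with $n-r < i \leq \lfloor \frac{s-1}{2} \rfloor$.
   Context: A sums-of-squares formula of type $[r,s,n]$ over a field $F$ is an identity $$(x_1^2+\cdots+x_r^2)(y_1^2+\cdots+y_s^2)=z_1^2+\cdots+z_n^2$$ in the polynomial ring $F[x_1,\ldots,x_r,y_1,\ldots,y_s]$, where each $z_j$ is a bilinear expression in the $x$'s and $y$'s, i.e. $z_j=\sum_{a,b} c^{(j)}_{ab}\,x_a y_b$ with coefficients $c^{(j)}_{ab}\in F$. *)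

theory Defs
  imports "HOL-Computational_Algebra.Computational_Algebra" "HOL-Library.Poly_Mapping"
begin

text \<open>
  Polynomials are finitely supported maps from monomials to coefficients, and monomials are
  finitely supported maps from variables to exponents.  The ring product is convolution, so
  equality is equality of formal polynomials (not of polynomial functions, which would be weaker
  over a finite field).  The variables are \<open>Inl a\<close> for $x_a$ and \<open>Inr b\<close> for $y_b$, with indices
  starting at 1; only $x_1,\ldots,x_r,y_1,\ldots,y_s$ occur in a formula of type $[r,s,n]$.
\<close>

type_synonym 'a xy_poly = "(nat + nat \<Rightarrow>\<^sub>0 nat) \<Rightarrow>\<^sub>0 'a"

definition x_var :: "nat \<Rightarrow> 'a::comm_ring_1 xy_poly" where
  "x_var a = Poly_Mapping.single (Poly_Mapping.single (Inl a) 1) 1"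

definition y_var :: "nat \<Rightarrow> 'a::comm_ring_1 xy_poly" where
  "y_var b = Poly_Mapping.single (Poly_Mapping.single (Inr b) 1) 1"

definition const_poly :: "'a \<Rightarrow> 'a::comm_ring_1 xy_poly" where
  "const_poly c = Poly_Mapping.single 0 c"

definition is_bilinear :: "nat \<Rightarrow> nat \<Rightarrow> 'a::comm_ring_1 xy_poly \<Rightarrow> bool" where
  "is_bilinear r s z \<longleftrightarrow>
     (\<exists>c :: nat \<Rightarrow> nat \<Rightarrow> 'a. z = (\<Sum>a=1..r. \<Sum>b=1..s. const_poly (c a b) * x_var a * y_var b))"

definition sums_of_squares_formula ::
    "nat \<Rightarrow> nat \<Rightarrow> nat \<Rightarrow> (nat \<Rightarrow> 'a::comm_ring_1 xy_poly) \<Rightarrow> bool" where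
  "sums_of_squares_formula r s n z \<longleftrightarrow>
     (\<forall>j\<in>{1..n}. is_bilinear r s (z j)) \<and>
     (\<Sum>a=1..r. (x_var a)\<^sup>2) * (\<Sum>b=1..s. (y_var b)\<^sup>2) = (\<Sum>j=1..n. (z j)\<^sup>2)"

text \<open>
  The library's integer-valued binomial coefficient takes natural numbers.  Here $m \ge 0$ is
  intended, and the value is 0 for a lower argument outside $0,\ldots,m$.
\<close>

definition binom_int :: "int \<Rightarrow> int \<Rightarrow> int" where
  "binom_int m k = (if 0 \<le> k \<and> k \<le> m then int (nat m choose nat k) else 0)"

end

theory Submission
  imports Defs "HOL-Library.Product_Lexorder" "HOL-Library.Function_Algebras"
    "HOL-Algebra.Algebraic_Closure_Type"
begin

text \<open>
  Write $R = K[y_0,\ldots,y_{s-1}]$ for $K$ the algebraic closure of the field, and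
  $q = y_0^2 + \cdots + y_{s-1}^2$.  Sorting a formula by the $x$-variables gives vectors
  $m_0,\ldots,m_{r-1} \in R^n$ of linear forms with $m_c \cdot m_d = \delta_{cd}\, q$
  (\<open>orthogonal_frame_of_formula\<close>).  After inverting $q$ they span a summand of $R^n$
  isomorphic to $r$ copies of $R(-1)$, and the orthogonal complement $P$ of this summand has
  rank $n - r$.  So $\Lambda^k P = 0$ for $k > n - r$, while in a Grothendieck group
  $\sum_k [\Lambda^k P]\, t^k = (1 + t)^n (1 + [R(-1)]\, t)^{-r}$.  The theorem is what this says
  after $[R(-1)]$ has been sent to $-1$ in a suitable cyclic group.

  The cyclic group comes from Hilbert series.  A finitely generated graded $R$-module has Hilbert
  series $p(t)/(1-t)^s$ with an integral Laurent polynomial $p$; the number $p(-1)$ is additive on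
  exact sequences, and a shift of the grading by one changes its sign.  Modulo $2^e$ with
  $e = s - \lfloor s/2 \rfloor = \lfloor (s-1)/2 \rfloor + 1$ it does not see modules killed by
  $q$ (\<open>quadric_torsion_congruence\<close>), so it is a substitute for $K_0$ of $R[1/q]$.

  That congruence is the main point.  The Clifford algebra of $q$ has a module $S$ of dimension
  $2^{\lfloor s/2 \rfloor}$.  If $q$ kills $N$, then $D = \sum_a y_a \gamma_a$ is a differential on
  $N \otimes S$, because $D^2 = q$.  Since $\gamma_a D + D \gamma_a = 2 y_a$, every variable acts
  as zero on its homology, which is therefore finite-dimensional.  As $D$ raises degrees by one,
  the Hilbert series of $N \otimes S$ differs from that of the homology by $1 + t$ times a series with
  no pole at $-1$.
  Setting $t = -1$ gives $2^{\lfloor s/2 \rfloor} p(-1) = 2^s x$ with an integer $x$.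

  In place of $\Lambda^k P$ stands the common kernel of the contractions with the $m_c$ on
  $\Lambda^k R^n$, taken one $c$ at a time.  Contraction with $m_c$ relates consecutive kernels by
  a short exact sequence up to $q$-torsion (\<open>\<kappa>_recurrence\<close>), and wedging with the $m_c$ shows
  that the last kernel vanishes in degrees above $n - r$ (\<open>K_trivial\<close>).  Solving the recurrence
  gives $2^e \mid 2^i \binom{r+i-1}{i}$ for $i > n - r$
  (\<open>binomial_divisibility_from_recurrence\<close>).

  The submodules involved have rational Hilbert series because passing to leading monomials
  reduces this to monomial ideals, where ascending chains stabilize
  (\<open>upset_chain_stabilizes\<close>).
\<close>

abbreviation (input) lookup :: "('a \<Rightarrow>\<^sub>0 'b::zero) \<Rightarrow> 'a \<Rightarrow> 'b" where
  "lookup \<equiv> Poly_Mapping.lookup"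

abbreviation (input) keys :: "('a \<Rightarrow>\<^sub>0 'b::zero) \<Rightarrow> 'a set" where
  "keys \<equiv> Poly_Mapping.keys"

section \<open>Dimensions\<close>

text \<open>
  Rank-nullity for the map that \<open>f\<close> induces from \<open>V\<close> to the target space modulo \<open>U\<close>, stated without
  quotients.
  A basis of \<open>U\<close> together with the images of the vectors that extend a basis of the preimage of
  \<open>U\<close> to a basis of \<open>V\<close> is a basis of \<open>f V + U\<close>.
\<close>

lemma (in vector_space_pair) dim_preimage_plus_dim_sum_image:
  assumes f: "Vector_Spaces.linear s1 s2 f"
    and V: "vs1.subspace V" and U: "vs2.subspace U"
    and finV: "finite S" "V \<subseteq> vs1.span S" and finU: "finite S'" "U \<subseteq> vs2.span S'"
  shows "vs1.dim V + vs2.dim U = vs1.dim {v \<in> V. f v \<in> U} + vs2.dim {f v + u |v u. v \<in> V \<and> u \<in> U}"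
proof -
  interpret f: Vector_Spaces.linear s1 s2 f by (fact f)
  define W where "W = {v \<in> V. f v \<in> U}"
  obtain A where A: "A \<subseteq> W" "vs1.independent A" "W \<subseteq> vs1.span A" "card A = vs1.dim W"
    using vs1.basis_exists by blast
  have "A \<subseteq> V" using A(1) by (auto simp: W_def)
  then obtain B where B: "A \<subseteq> B" "B \<subseteq> V" "vs1.independent B" "V \<subseteq> vs1.span B"
    using vs1.maximal_independent_subset_extend A(2) by metis
  obtain C where C: "C \<subseteq> U" "vs2.independent C" "U \<subseteq> vs2.span C" "card C = vs2.dim U"
    using vs2.basis_exists by blast
  have finB: "finite B" using vs1.independent_span_bound[OF finV(1) B(3)] B(2) finV(2) by blast
  have finC: "finite C" using vs2.independent_span_bound[OF finU(1) C(2)] C(1) finU(2) by blast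
  have finA: "finite A" using finB B(1) finite_subset by blast
  have sum_in: "(\<Sum>b\<in>B-A. s1 (d b) b) \<in> V" for d
    by (intro vs1.subspace_sum[OF V] vs1.subspace_scale[OF V]) (use B in auto)
  \<comment> \<open>A combination of the complementary basis vectors that \<open>f\<close> maps into \<open>U\<close> lies in the span of \<open>A\<close>,
     so it is zero.\<close>
  have key: "d b = 0" if "(\<Sum>b\<in>B-A. s2 (d b) (f b)) \<in> U" "b \<in> B - A" for d b
  proof -
    let ?v = "\<Sum>b\<in>B-A. s1 (d b) b"
    have "f ?v = (\<Sum>b\<in>B-A. s2 (d b) (f b))" by (simp add: f.sum f.scale)
    then have "?v \<in> W" using that sum_in by (simp add: W_def)
    then have "?v \<in> vs1.span A" using A(3) by blast
    then obtain g where g: "?v = (\<Sum>a\<in>A. s1 (g a) a)" using vs1.span_finite[OF finA] by auto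
    have "(\<Sum>b\<in>B. s1 (if b \<in> A then - g b else d b) b)
        = (\<Sum>b\<in>B-A. s1 (if b \<in> A then - g b else d b) b) + (\<Sum>b\<in>A. s1 (if b \<in> A then - g b else d b) b)"
      by (rule sum.subset_diff[OF B(1) finB])
    also have "\<dots> = ?v + (\<Sum>a\<in>A. s1 (- g a) a)" by simp
    also have "(\<Sum>a\<in>A. s1 (- g a) a) = - ?v" unfolding g by (simp add: sum_negf)
    finally have "(\<Sum>b\<in>B. s1 (if b \<in> A then - g b else d b) b) = 0" by simp
    then have "(if b \<in> A then - g b else d b) = 0"
      using vs1.independentD[OF B(3) finB order.refl, of "\<lambda>b. if b \<in> A then - g b else d b" b] that(2)
      by blast
    then show ?thesis using that(2) by simp
  qed
  have notU: "f b \<notin> U" if "b \<in> B - A" for b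
  proof
    assume "f b \<in> U"
    have "(\<Sum>c\<in>B-A. s2 (if c = b then 1 else 0) (f c)) = (\<Sum>c\<in>B-A. if c = b then f c else 0)"
      by (rule sum.cong) auto
    also have "\<dots> = f b" using that finB by simp
    finally show False using key[of "\<lambda>c. if c = b then 1 else 0" b] that \<open>f b \<in> U\<close> by auto
  qed
  have inj: "inj_on f (B - A)"
  proof (rule inj_onI, rule ccontr)
    fix b b' assume b: "b \<in> B - A" "b' \<in> B - A" "f b = f b'" "b \<noteq> b'"
    have "(\<Sum>c\<in>B-A. s2 (if c = b then 1 else if c = b' then -1 else 0) (f c))
        = (\<Sum>c\<in>B-A. (if c = b then f c else 0) + (if c = b' then - f c else 0))"
      using b(4) by (intro sum.cong) auto
    also have "\<dots> = 0" using b finB by (simp add: sum.distrib)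
    finally show False
      using key[of "\<lambda>c. if c = b then 1 else if c = b' then -1 else 0" b] b vs2.subspace_0[OF U] by auto
  qed
  have disj: "f ` (B - A) \<inter> C = {}" using notU C(1) by blast
  let ?E = "f ` (B - A) \<union> C"
  have finE: "finite ?E" using finB finC by simp
  have indep: "vs2.independent ?E"
  proof (rule vs2.independent_if_scalars_zero[OF finE])
    fix h x assume h: "(\<Sum>x\<in>?E. s2 (h x) x) = 0" and x: "x \<in> ?E"
    have "(\<Sum>x\<in>?E. s2 (h x) x) = (\<Sum>x\<in>f ` (B - A). s2 (h x) x) + (\<Sum>x\<in>C. s2 (h x) x)"
      using finB finC disj by (intro sum.union_disjoint) auto
    also have "(\<Sum>x\<in>f ` (B - A). s2 (h x) x) = (\<Sum>b\<in>B - A. s2 (h (f b)) (f b))"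
      using inj by (simp add: sum.reindex)
    finally have *: "(\<Sum>b\<in>B - A. s2 (h (f b)) (f b)) = - (\<Sum>x\<in>C. s2 (h x) x)"
      using h by (simp add: eq_neg_iff_add_eq_0)
    have "(\<Sum>x\<in>C. s2 (h x) x) \<in> U"
      by (intro vs2.subspace_sum[OF U] vs2.subspace_scale[OF U]) (use C in auto)
    then have "- (\<Sum>x\<in>C. s2 (h x) x) \<in> U" by (rule vs2.subspace_neg[OF U])
    then have zero: "h (f b) = 0" if "b \<in> B - A" for b using key[of "h \<circ> f" b] * that by simp
    then have "(\<Sum>b\<in>B - A. s2 (h (f b)) (f b)) = 0" by (intro sum.neutral) simp
    then have "(\<Sum>x\<in>C. s2 (h x) x) = 0" using * by simp
    then have "x \<in> C \<Longrightarrow> h x = 0" using vs2.independentD[OF C(2) finC order.refl, of h x] by blast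
    then show "h x = 0" using zero x by blast
  qed
  have spanning: "{f v + u |v u. v \<in> V \<and> u \<in> U} \<subseteq> vs2.span ?E"
  proof clarify
    fix v u assume vu: "v \<in> V" "u \<in> U"
    have fB: "f b \<in> vs2.span ?E" if "b \<in> B" for b
    proof (cases "b \<in> A")
      case True
      then have "f b \<in> vs2.span C" using A(1) C(3) by (auto simp: W_def)
      then show ?thesis using vs2.span_mono[of C ?E] by auto
    qed (use that in \<open>auto intro: vs2.span_base\<close>)
    obtain d where "v = (\<Sum>b\<in>B. s1 (d b) b)" using vu B(4) vs1.span_finite[OF finB] by auto
    then have "f v = (\<Sum>b\<in>B. s2 (d b) (f b))" by (simp add: f.sum f.scale)
    also have "\<dots> \<in> vs2.span ?E" by (intro vs2.span_sum vs2.span_scale fB)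
    finally have "f v \<in> vs2.span ?E" .
    moreover have "u \<in> vs2.span ?E" using vu C(3) vs2.span_mono[of C ?E] by auto
    ultimately show "f v + u \<in> vs2.span ?E" by (rule vs2.span_add)
  qed
  have "?E \<subseteq> {f v + u |v u. v \<in> V \<and> u \<in> U}"
  proof
    fix x assume "x \<in> ?E"
    then consider b where "b \<in> B" "x = f b" | "x \<in> C" by auto
    then show "x \<in> {f v + u |v u. v \<in> V \<and> u \<in> U}"
    proof cases
      case 1
      then have "x = f b + 0" "b \<in> V" "0 \<in> U" using B(2) vs2.subspace_0[OF U] by auto
      then show ?thesis by blast
    next
      case 2
      then have "x = f 0 + x" "0 \<in> V" "x \<in> U" using C(1) vs1.subspace_0[OF V] by (auto simp: f.zero)
      then show ?thesis by blast
    qed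
  qed
  then have "vs2.dim {f v + u |v u. v \<in> V \<and> u \<in> U} = card ?E"
    using vs2.basis_card_eq_dim[OF _ spanning indep] by simp
  also have "\<dots> = card (B - A) + card C"
    using finB finC disj inj by (simp add: card_Un_disjoint card_image)
  also have "card (B - A) = card B - card A" using finA B(1) by (simp add: card_Diff_subset)
  finally have "vs2.dim {f v + u |v u. v \<in> V \<and> u \<in> U} = card B - card A + card C" .
  moreover have "card A \<le> card B" using finB B(1) by (rule card_mono)
  moreover have "card B = vs1.dim V" using B vs1.basis_card_eq_dim by blast
  ultimately show ?thesis using A(4) C(4) by (simp add: W_def)
qed

text \<open>
  Echelon form: vectors with distinct leading positions are independent, and subtracting multiples
  of them clears coordinates from the top.  The induction removes the largest position \<open>x\<close>, at the
  cost of one dimension exactly when some vector has a nonzero coordinate there.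
\<close>

lemma (in vector_space) dim_eq_card_leading_positions:
  fixes coef :: "'b \<Rightarrow> 'i::linorder \<Rightarrow> 'a"
  assumes "finite I" and "subspace N" and "finite S" "N \<subseteq> span S"
    and add: "\<And>x v w. coef (v + w) x = coef v x + coef w x"
    and scale: "\<And>x c v. coef (scale c v) x = c * coef v x"
    and "\<And>v. v \<in> N \<Longrightarrow> (\<And>x. x \<in> I \<Longrightarrow> coef v x = 0) \<Longrightarrow> v = 0"
  shows "dim N = card {x \<in> I. \<exists>v\<in>N. coef v x \<noteq> 0 \<and> (\<forall>y\<in>I. x < y \<longrightarrow> coef v y = 0)}"
  using assms(1,2,4,7)
proof (induction I arbitrary: N rule: finite_linorder_max_induct)
  case empty
  then have "N \<subseteq> {0}" by auto
  then have "dim N \<le> card ({}::'b set)" by (intro dim_le_card) auto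
  then show ?case by simp
next
  case (insert x I)
  define N' where "N' = {v \<in> N. coef v x = 0}"
  have sub': "subspace N'"
    using insert.prems(1) unfolding N'_def subspace_def
    by (auto simp: add scale) (metis scale[of 0] mult_zero_left scale_zero_left)
  have spn': "N' \<subseteq> span S" using insert.prems(2) by (auto simp: N'_def)
  have IH: "dim N' = card {y \<in> I. \<exists>v\<in>N'. coef v y \<noteq> 0 \<and> (\<forall>z\<in>I. y < z \<longrightarrow> coef v z = 0)}"
    by (rule insert.IH[OF sub' spn']) (use insert.prems(3) in \<open>auto simp: N'_def\<close>)
  define L where "L = {y \<in> insert x I. \<exists>v\<in>N. coef v y \<noteq> 0 \<and> (\<forall>z\<in>insert x I. y < z \<longrightarrow> coef v z = 0)}"
  define L' where "L' = {y \<in> I. \<exists>v\<in>N'. coef v y \<noteq> 0 \<and> (\<forall>z\<in>I. y < z \<longrightarrow> coef v z = 0)}"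
  have xX: "x \<notin> I" using insert.hyps(2) by auto
  have low: "y \<in> L \<longleftrightarrow> y \<in> L'" if "y \<in> I" for y
  proof -
    have "y < x" using insert.hyps(2) that by blast
    then have "(\<forall>z\<in>insert x I. y < z \<longrightarrow> coef v z = 0) \<longleftrightarrow> coef v x = 0 \<and> (\<forall>z\<in>I. y < z \<longrightarrow> coef v z = 0)" for v
      by blast
    then show ?thesis using that unfolding L_def L'_def N'_def by blast
  qed
  have top: "x \<in> L \<longleftrightarrow> (\<exists>v\<in>N. coef v x \<noteq> 0)"
    using insert.hyps(2) unfolding L_def by (auto dest: less_asym)
  have sub: "L \<subseteq> insert x I" "L' \<subseteq> I" unfolding L_def L'_def by blast+
  show ?case
  proof (cases "\<exists>v\<in>N. coef v x \<noteq> 0")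
    case False
    then have "N' = N" by (auto simp: N'_def)
    moreover have "L = L'"
      using low sub top False by blast
    ultimately show ?thesis using IH unfolding L_def L'_def by simp
  next
    case True
    then obtain g where g: "g \<in> N" "coef g x \<noteq> 0" by blast
    obtain A where A: "A \<subseteq> N'" "independent A" "N' \<subseteq> span A" "card A = dim N'"
      using basis_exists by blast
    have finA: "finite A" using independent_span_bound[OF assms(3) A(2)] A(1) spn' by blast
    have "span A \<subseteq> N'" using A(1) sub' by (metis span_minimal)
    then have gA: "g \<notin> span A" using g by (auto simp: N'_def)
    have ind: "independent (insert g A)" using gA A(2) by (rule independent_insertI)
    have "N \<subseteq> span (insert g A)"
    proof
      fix v assume v: "v \<in> N"
      define c where "c = coef v x / coef g x"
      have "v - scale c g \<in> N" using v g insert.prems(1) by (intro subspace_diff subspace_scale)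
      moreover have "coef (v - scale c g) x = 0"
      proof -
        have "coef v x = coef (v - scale c g) x + coef (scale c g) x" by (simp flip: add)
        then show ?thesis using g by (simp add: scale c_def)
      qed
      ultimately have "v - scale c g \<in> span A" using A(3) by (auto simp: N'_def)
      then show "v \<in> span (insert g A)" by (auto simp: span_insert)
    qed
    moreover have "insert g A \<subseteq> N" using g A(1) by (auto simp: N'_def)
    ultimately have "dim N = card (insert g A)" using basis_card_eq_dim[OF _ _ ind] by simp
    also have "\<dots> = Suc (card A)" using gA finA span_base[of g A] by (metis card_insert_disjoint)
    finally have "dim N = Suc (card L')" using IH A(4) unfolding L'_def by simp
    moreover have "L = insert x L'"
      using low sub top True by blast
    moreover have "x \<notin> L'" using xX sub by blast
    moreover have "finite L'" using sub(2) insert.hyps(1) by (rule finite_subset)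
    ultimately have "dim N = card L" by simp
    then show ?thesis unfolding L_def .
  qed
qed

section \<open>Rational Hilbert series\<close>

text \<open>
  For a graded module with Hilbert series \<open>F\<close> over a polynomial ring in \<open>s\<close> variables, \<open>k\<close> is the
  numerator over \<open>(1 - t) ^ s\<close>, evaluated at \<open>t = -1\<close>.
\<close>

definition value_at_minus_one :: "nat \<Rightarrow> int fps \<Rightarrow> int \<Rightarrow> bool" where
  "value_at_minus_one s F k \<longleftrightarrow> (\<exists>P. fps_of_poly P = (1 - fps_X) ^ s * F \<and> poly P (-1) = k)"

lemma value_at_minus_one_unique:
  "value_at_minus_one s F k \<Longrightarrow> value_at_minus_one s F k' \<Longrightarrow> k = k'"
  unfolding value_at_minus_one_def by (metis fps_of_poly_eq_iff)

lemma value_at_minus_one_add: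
  "value_at_minus_one s F k \<Longrightarrow> value_at_minus_one s G l \<Longrightarrow> value_at_minus_one s (F + G) (k + l)"
  unfolding value_at_minus_one_def by (metis fps_of_poly_add poly_add distrib_left)

lemma value_at_minus_one_diff:
  "value_at_minus_one s F k \<Longrightarrow> value_at_minus_one s G l \<Longrightarrow> value_at_minus_one s (F - G) (k - l)"
  unfolding value_at_minus_one_def by (metis fps_of_poly_diff poly_diff right_diff_distrib)

lemma value_at_minus_one_mult_poly:
  assumes "value_at_minus_one s F k"
  shows "value_at_minus_one s (fps_of_poly Q * F) (poly Q (-1) * k)"
proof -
  obtain P where "fps_of_poly P = (1 - fps_X) ^ s * F" "poly P (-1) = k"
    using assms by (auto simp: value_at_minus_one_def)
  then have "fps_of_poly (Q * P) = (1 - fps_X) ^ s * (fps_of_poly Q * F)" "poly (Q * P) (-1) = poly Q (-1) * k"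
    by (simp_all add: fps_of_poly_mult mult.left_commute)
  then show ?thesis unfolding value_at_minus_one_def by blast
qed

lemma value_at_minus_one_shift:
  assumes "value_at_minus_one s F k"
  shows "value_at_minus_one s (fps_X * F) (- k)"
  using value_at_minus_one_mult_poly[OF assms, of "[:0, 1:]"] by (simp add: fps_of_poly_pCons)

lemma value_at_minus_one_of_nat_mult:
  assumes "value_at_minus_one s F k"
  shows "value_at_minus_one s (of_nat m * F) (of_nat m * k)"
  using value_at_minus_one_mult_poly[OF assms, of "of_nat m"] by (simp add: of_nat_poly fps_of_poly_const fps_of_nat)

lemma value_at_minus_one_sum:
  assumes "\<And>i. i \<in> I \<Longrightarrow> value_at_minus_one s (F i) (k i)"
  shows "value_at_minus_one s (\<Sum>i\<in>I. F i) (\<Sum>i\<in>I. k i)"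
  using assms
proof (induction I rule: infinite_finite_induct)
  case (insert i I)
  then show ?case by (auto intro: value_at_minus_one_add)
qed (auto simp: value_at_minus_one_def intro: exI[of _ 0])

text \<open>
  The value of a finite-dimensional module: its Hilbert series is itself a polynomial, so the
  numerator contains all of \<open>(1 - t) ^ s\<close>, which is \<open>2 ^ s\<close> at \<open>-1\<close>.
\<close>

lemma value_at_minus_one_finite_support:
  assumes "\<And>w. w \<ge> m \<Longrightarrow> fps_nth F w = 0"
  shows "\<exists>x. value_at_minus_one s F (2 ^ s * x)"
proof -
  define Q where "Q = (\<Sum>w<m. Polynomial.monom (fps_nth F w) w)"
  have "fps_of_poly Q = F"
    by (rule fps_ext) (use assms in \<open>auto simp: Q_def coeff_sum not_le[symmetric]\<close>)
  then have "fps_of_poly ([:1, -1:] ^ s * Q) = (1 - fps_X) ^ s * F"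
    by (simp add: fps_of_poly_mult fps_of_poly_power fps_of_poly_pCons)
  moreover have "poly ([:1, -1:] ^ s * Q) (-1) = 2 ^ s * poly Q (-1)" by (simp add: poly_power)
  ultimately have "value_at_minus_one s F (2 ^ s * poly Q (-1))"
    unfolding value_at_minus_one_def by (intro exI[of _ "[:1, -1:] ^ s * Q"] conjI)
  then show ?thesis by (rule exI)
qed

section \<open>Monomial ideals\<close>

definition monomials :: "nat \<Rightarrow> nat \<Rightarrow> (nat \<Rightarrow>\<^sub>0 nat) set" where
  "monomials s w = {\<alpha>. keys \<alpha> \<subseteq> {..<s} \<and> (\<Sum>a<s. lookup \<alpha> a) = w}"

text \<open>
  The monomials of a monomial ideal.
\<close>

definition upset :: "nat \<Rightarrow> (nat \<Rightarrow>\<^sub>0 nat) set \<Rightarrow> bool" where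
  "upset s U \<longleftrightarrow> (\<forall>\<alpha>\<in>U. keys \<alpha> \<subseteq> {..<s}) \<and> (\<forall>\<alpha>\<in>U. \<forall>a<s. \<alpha> + Poly_Mapping.single a 1 \<in> U)"

text \<open>
  The coefficient of the \<open>d\<close>-th power of the last variable in the ideal \<open>U\<close>, as an ideal in one
  variable fewer.
\<close>

definition slice :: "nat \<Rightarrow> (nat \<Rightarrow>\<^sub>0 nat) set \<Rightarrow> nat \<Rightarrow> (nat \<Rightarrow>\<^sub>0 nat) set" where
  "slice s U d = {\<alpha>. keys \<alpha> \<subseteq> {..<s} \<and> \<alpha> + Poly_Mapping.single s d \<in> U}"

definition count_fps :: "nat \<Rightarrow> (nat \<Rightarrow>\<^sub>0 nat) set \<Rightarrow> int fps" where
  "count_fps s U = Abs_fps (\<lambda>w. int (card (U \<inter> monomials s w)))"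

lemma keys_add_nat: "keys (\<alpha> + \<beta> :: 'x \<Rightarrow>\<^sub>0 nat) = keys \<alpha> \<union> keys \<beta>"
  by (intro Set.set_eqI) (simp add: in_keys_iff lookup_add)

lemma monomials_add_var:
  assumes "a < s"
  shows "\<alpha> + Poly_Mapping.single a 1 \<in> monomials s (Suc w) \<longleftrightarrow> \<alpha> \<in> monomials s w"
proof -
  have "(\<Sum>b<s. lookup (Poly_Mapping.single a (1::nat)) b) = (\<Sum>b<s. if b = a then 1 else 0)"
    by (rule sum.cong) (auto simp: lookup_single when_def)
  also have "\<dots> = 1" using assms by simp
  finally have "(\<Sum>b<s. lookup (\<alpha> + Poly_Mapping.single a 1) b) = Suc (\<Sum>b<s. lookup \<alpha> b)"
    by (simp add: lookup_add sum.distrib)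
  moreover have "keys (\<alpha> + Poly_Mapping.single a 1) = insert a (keys \<alpha>)"
    by (simp add: keys_add_nat)
  ultimately show ?thesis using assms by (simp add: monomials_def)
qed

lemma monomial_split:
  fixes \<alpha> :: "nat \<Rightarrow>\<^sub>0 nat"
  assumes "keys \<alpha> \<subseteq> {..<Suc s}"
  obtains \<beta> where "keys \<beta> \<subseteq> {..<s}" "\<alpha> = \<beta> + Poly_Mapping.single s (lookup \<alpha> s)"
proof
  let ?\<beta> = "Poly_Mapping.update s 0 \<alpha>"
  show "keys ?\<beta> \<subseteq> {..<s}" using assms by (auto simp: keys_update less_Suc_eq)
  show "\<alpha> = ?\<beta> + Poly_Mapping.single s (lookup \<alpha> s)"
    by (rule poly_mapping_eqI) (simp add: lookup_add lookup_update lookup_single when_def)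
qed

lemma keys_less_lookup_zero: "keys (\<beta> :: nat \<Rightarrow>\<^sub>0 nat) \<subseteq> {..<s} \<Longrightarrow> lookup \<beta> s = 0"
proof -
  assume "keys \<beta> \<subseteq> {..<s}"
  then have "s \<notin> keys \<beta>" by auto
  then show "lookup \<beta> s = 0" by (simp add: in_keys_iff)
qed

lemma add_single_eq_iff:
  fixes \<alpha> \<beta> :: "nat \<Rightarrow>\<^sub>0 nat"
  assumes "keys \<alpha> \<subseteq> {..<s}" "keys \<beta> \<subseteq> {..<s}"
  shows "\<alpha> + Poly_Mapping.single s d = \<beta> + Poly_Mapping.single s d' \<longleftrightarrow> \<alpha> = \<beta> \<and> d = d'"
proof
  assume eq: "\<alpha> + Poly_Mapping.single s d = \<beta> + Poly_Mapping.single s d'"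
  then have "lookup (\<alpha> + Poly_Mapping.single s d) s = lookup (\<beta> + Poly_Mapping.single s d') s" by simp
  then have "d = d'" using assms by (simp add: lookup_add keys_less_lookup_zero)
  then show "\<alpha> = \<beta> \<and> d = d'" using eq by simp
qed auto

lemma monomials_Suc_iff:
  assumes "keys \<beta> \<subseteq> {..<s}"
  shows "\<beta> + Poly_Mapping.single s d \<in> monomials (Suc s) w \<longleftrightarrow> d \<le> w \<and> \<beta> \<in> monomials s (w - d)"
proof -
  have "(\<Sum>a<s. lookup (Poly_Mapping.single s d) a) = 0"
    by (rule sum.neutral) (auto simp: lookup_single when_def)
  then have "(\<Sum>a<Suc s. lookup (\<beta> + Poly_Mapping.single s d) a) = (\<Sum>a<s. lookup \<beta> a) + d"
    using assms by (simp add: lookup_add sum.distrib keys_less_lookup_zero)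
  moreover have "keys (\<beta> + Poly_Mapping.single s d) \<subseteq> {..<Suc s}" using assms
    by (auto simp: keys_add_nat)
  ultimately show ?thesis using assms by (auto simp: monomials_def)
qed

lemma monomials_Suc_eq:
  "U \<inter> monomials (Suc s) w
    = (\<Union>d\<le>w. (\<lambda>\<beta>. \<beta> + Poly_Mapping.single s d) ` (slice s U d \<inter> monomials s (w - d)))" (is "?L = ?R")
proof (intro subset_antisym subsetI)
  fix \<alpha> assume \<alpha>: "\<alpha> \<in> ?L"
  then have "keys \<alpha> \<subseteq> {..<Suc s}" by (auto simp: monomials_def)
  then obtain \<beta> where \<beta>: "keys \<beta> \<subseteq> {..<s}" "\<alpha> = \<beta> + Poly_Mapping.single s (lookup \<alpha> s)"
    using monomial_split by blast
  then have "\<beta> + Poly_Mapping.single s (lookup \<alpha> s) \<in> U \<inter> monomials (Suc s) w" using \<alpha> by metis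
  then have "\<beta> \<in> slice s U (lookup \<alpha> s)" "lookup \<alpha> s \<le> w \<and> \<beta> \<in> monomials s (w - lookup \<alpha> s)"
    using monomials_Suc_iff[OF \<beta>(1)] \<beta>(1) by (simp_all add: slice_def)
  then show "\<alpha> \<in> ?R" using \<beta>(2) by blast
next
  fix \<alpha> assume "\<alpha> \<in> ?R"
  then show "\<alpha> \<in> ?L" using monomials_Suc_iff by (auto simp: slice_def)
qed

lemma finite_monomials: "finite (monomials s w)"
proof (induction s arbitrary: w)
  case 0
  have "monomials 0 w \<subseteq> {0}" by (auto simp: monomials_def)
  then show ?case using finite_subset by blast
next
  case (Suc s)
  show ?case using monomials_Suc_eq[of UNIV s w] Suc.IH by simp
qed

lemma card_monomials_Suc:
  "card (U \<inter> monomials (Suc s) w) = (\<Sum>d\<le>w. card (slice s U d \<inter> monomials s (w - d)))"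
proof -
  have "card (U \<inter> monomials (Suc s) w)
      = (\<Sum>d\<le>w. card ((\<lambda>\<beta>. \<beta> + Poly_Mapping.single s d) ` (slice s U d \<inter> monomials s (w - d))))"
    unfolding monomials_Suc_eq
    by (intro card_UN_disjoint) (auto simp: finite_monomials slice_def add_single_eq_iff)
  also have "\<dots> = (\<Sum>d\<le>w. card (slice s U d \<inter> monomials s (w - d)))"
    by (intro sum.cong refl card_image) (auto simp: inj_on_def)
  finally show ?thesis .
qed

text \<open>
  Multiplication by \<open>1 - t\<close> turns the sum over all slices into a sum of differences of consecutive
  slices, and this is finite once the slices are constant.
\<close>

lemma count_fps_slices:
  assumes "\<And>d. d \<ge> d0 \<Longrightarrow> slice s U d = slice s U d0"
  shows "(1 - fps_X) * count_fps (Suc s) U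
    = (\<Sum>d\<le>d0. fps_X ^ d * (count_fps s (slice s U d) - (if d = 0 then 0 else count_fps s (slice s U (d - 1)))))"
proof (rule fps_ext)
  fix w
  define g where "g d v = int (card (slice s U d \<inter> monomials s v))" for d v
  define h where "h d v = g d v - (if d = 0 then 0 else g (d - 1) v)" for d v
  have h0: "h d v = 0" if "d > d0" for d v
  proof -
    have "slice s U d = slice s U d0" "slice s U (d - 1) = slice s U d0"
      by (rule assms; use that in simp)+
    then show ?thesis using that by (simp add: h_def g_def)
  qed
  have cf: "fps_nth (count_fps (Suc s) U) v = (\<Sum>d\<le>v. g d (v - d))" for v
    by (simp add: count_fps_def card_monomials_Suc g_def)
  have "fps_nth ((1 - fps_X) * count_fps (Suc s) U) w = (\<Sum>d\<le>w. h d (w - d))"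
  proof (cases w)
    case 0
    then show ?thesis by (simp add: cf h_def left_diff_distrib)
  next
    case (Suc v)
    have "(\<Sum>d\<le>Suc v. if d = 0 then 0 else g (d - 1) (Suc v - d)) = (\<Sum>d\<le>v. g d (v - d))"
      by (subst sum.atMost_Suc_shift) simp
    then show ?thesis using Suc by (simp add: cf h_def left_diff_distrib sum_subtractf)
  qed
  also have "\<dots> = (\<Sum>d\<in>{..w} \<inter> {..d0}. h d (w - d))"
    by (rule sum.mono_neutral_right) (auto intro!: h0)
  also have "\<dots> = (\<Sum>d\<le>d0. if d \<le> w then h d (w - d) else 0)"
    by (rule sum.mono_neutral_cong_left) auto
  also have "\<dots> = fps_nth (\<Sum>d\<le>d0. fps_X ^ d * (count_fps s (slice s U d) - (if d = 0 then 0 else count_fps s (slice s U (d - 1))))) w"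
    unfolding fps_sum_nth
    by (rule sum.cong) (auto simp: fps_X_power_mult_nth h_def g_def count_fps_def)
  finally show "fps_nth ((1 - fps_X) * count_fps (Suc s) U) w = \<dots>" .
qed

lemma upset_slice: "upset (Suc s) U \<Longrightarrow> upset s (slice s U d)"
  unfolding upset_def
proof (intro conjI ballI allI impI)
  assume U: "(\<forall>\<alpha>\<in>U. keys \<alpha> \<subseteq> {..<Suc s}) \<and> (\<forall>\<alpha>\<in>U. \<forall>a<Suc s. \<alpha> + Poly_Mapping.single a 1 \<in> U)"
  fix \<alpha> assume \<alpha>: "\<alpha> \<in> slice s U d"
  then show *: "keys \<alpha> \<subseteq> {..<s}" by (simp add: slice_def)
  fix a assume a: "a < s"
  have "\<alpha> + Poly_Mapping.single s d + Poly_Mapping.single a 1 \<in> U" using U \<alpha> a by (simp add: slice_def)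
  moreover have "\<alpha> + Poly_Mapping.single s d + Poly_Mapping.single a 1
      = \<alpha> + Poly_Mapping.single a 1 + Poly_Mapping.single s d" by (simp only: ac_simps)
  ultimately show "\<alpha> + Poly_Mapping.single a 1 \<in> slice s U d"
    using * a by (simp add: slice_def keys_add_nat)
qed

lemma slice_mono: "U \<subseteq> U' \<Longrightarrow> slice s U d \<subseteq> slice s U' d"
  by (auto simp: slice_def)

lemma slice_Suc: "upset (Suc s) U \<Longrightarrow> slice s U d \<subseteq> slice s U (Suc d)"
proof
  fix \<alpha> assume U: "upset (Suc s) U" and \<alpha>: "\<alpha> \<in> slice s U d"
  then have "\<alpha> + Poly_Mapping.single s d + Poly_Mapping.single s 1 \<in> U"
    by (auto simp: slice_def upset_def)
  then show "\<alpha> \<in> slice s U (Suc d)" using \<alpha> by (simp add: slice_def add.assoc flip: single_add)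
qed

lemma slices_determine:
  assumes "upset (Suc s) U" "upset (Suc s) U'" "\<And>d. slice s U d = slice s U' d"
  shows "U = U'"
proof -
  have "U \<subseteq> U'" if "upset (Suc s) U" "\<And>d. slice s U d = slice s U' d" for U U'
  proof
    fix \<alpha> assume \<alpha>: "\<alpha> \<in> U"
    then have "keys \<alpha> \<subseteq> {..<Suc s}" using that by (auto simp: upset_def)
    then obtain \<beta> where \<beta>: "keys \<beta> \<subseteq> {..<s}" "\<alpha> = \<beta> + Poly_Mapping.single s (lookup \<alpha> s)"
      using monomial_split by blast
    then have "\<beta> \<in> slice s U (lookup \<alpha> s)" using \<alpha> by (simp add: slice_def)
    then have "\<beta> \<in> slice s U' (lookup \<alpha> s)" using that by simp
    then show "\<alpha> \<in> U'" using \<beta>(2) by (simp add: slice_def)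
  qed
  then show ?thesis using assms by blast
qed

text \<open>
  The ascending chain condition for monomial ideals.  The slices of a chain form an array that
  increases in both directions.  Its diagonal stabilizes at some \<open>c0\<close>, hence so do all entries beyond
  \<open>c0\<close>; the finitely many slices of index at most \<open>c0\<close> are treated one by one.
\<close>

lemma upset_chain_stabilizes:
  assumes "\<And>c. upset s (U c)" "\<And>c. U c \<subseteq> U (Suc c)"
  shows "\<exists>c0. \<forall>c\<ge>c0. U c = U c0"
  using assms
proof (induction s arbitrary: U)
  case 0
  have sub: "U c \<subseteq> {0}" for c using 0(1)[of c] by (auto simp: upset_def)
  have mono: "U c \<subseteq> U c'" if "c \<le> c'" for c c' using lift_Suc_mono_le[of U] 0(2) that by blast
  show ?case
  proof (cases "\<exists>c0. U c0 = {0}")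
    case True
    then show ?thesis using sub mono by blast
  next
    case False
    then have "U c = {}" for c using sub by blast
    then show ?thesis by auto
  qed
next
  case (Suc s)
  have mono: "U c \<subseteq> U c'" if "c \<le> c'" for c c' using lift_Suc_mono_le[of U] Suc.prems(2) that by blast
  have smono: "slice s (U c) d \<subseteq> slice s (U c') d'" if "c \<le> c'" "d \<le> d'" for c c' d d'
  proof -
    have "slice s (U c) d \<subseteq> slice s (U c) d'"
      using lift_Suc_mono_le[of "slice s (U c)"] slice_Suc[OF Suc.prems(1)] that by blast
    then show ?thesis using slice_mono[OF mono[OF that(1)]] by blast
  qed
  have "\<exists>c0. \<forall>c\<ge>c0. slice s (U c) c = slice s (U c0) c0"
    by (rule Suc.IH[of "\<lambda>c. slice s (U c) c"], rule upset_slice, rule Suc.prems(1), rule smono) simp_all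
  then obtain c0 where c0: "slice s (U c) c = slice s (U c0) c0" if "c \<ge> c0" for c by blast
  have "\<exists>c1. \<forall>c\<ge>c1. slice s (U c) d = slice s (U c1) d" for d
    by (rule Suc.IH[of "\<lambda>c. slice s (U c) d"], rule upset_slice, rule Suc.prems(1), rule smono) simp_all
  then obtain c1 where c1: "slice s (U c) d = slice s (U (c1 d)) d" if "c \<ge> c1 d" for c d by metis
  define C where "C = Max (insert c0 (c1 ` {..c0}))"
  have C: "c0 \<le> C" "\<And>d. d \<le> c0 \<Longrightarrow> c1 d \<le> C" unfolding C_def by (rule Max_ge; simp)+
  have "U c = U C" if "c \<ge> C" for c
  proof (rule slices_determine[OF Suc.prems(1) Suc.prems(1)])
    fix d show "slice s (U c) d = slice s (U C) d"
    proof (cases "d \<le> c0")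
      case True
      then show ?thesis using c1[of d c] c1[of d C] C(2)[of d] that by simp
    next
      case False
      have "slice s (U c') d = slice s (U c0) c0" if "c' \<ge> C" for c'
      proof
        have "slice s (U c') d \<subseteq> slice s (U (max c' d)) (max c' d)" by (rule smono) auto
        also have "\<dots> = slice s (U c0) c0" using False by (intro c0) auto
        finally show "slice s (U c') d \<subseteq> slice s (U c0) c0" .
        show "slice s (U c0) c0 \<subseteq> slice s (U c') d" using False C that by (intro smono) auto
      qed
      then show ?thesis using that by simp
    qed
  qed
  then show ?case by blast
qed

text \<open>
  Beyond the degrees of the generators every element is a multiple, by a variable, of another
  element.
\<close>

lemma upset_finitely_generated:
  assumes U: "upset s U"
  shows "\<exists>w0. \<forall>w>w0. \<forall>\<alpha>\<in>U \<inter> monomials s w. \<exists>a<s. \<exists>\<beta>\<in>U. \<alpha> = \<beta> + Poly_Mapping.single a 1"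
proof -
  define deg where "deg \<alpha> = (\<Sum>a<s. lookup \<alpha> a)" for \<alpha> :: "nat \<Rightarrow>\<^sub>0 nat"
  define W where "W c = {\<alpha> + \<gamma> |\<alpha> \<gamma>. \<alpha> \<in> U \<and> deg \<alpha> \<le> c \<and> keys \<gamma> \<subseteq> {..<s}}" for c
  have "upset s (W c)" for c
    unfolding upset_def
  proof (intro conjI ballI allI impI)
    fix \<beta> assume "\<beta> \<in> W c"
    then obtain \<alpha> \<gamma> where \<beta>: "\<beta> = \<alpha> + \<gamma>" "\<alpha> \<in> U" "deg \<alpha> \<le> c" "keys \<gamma> \<subseteq> {..<s}"
      unfolding W_def by blast
    then show "keys \<beta> \<subseteq> {..<s}" using U by (auto simp: keys_add_nat upset_def)
    fix a assume "a < s"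
    then have "keys (\<gamma> + Poly_Mapping.single a 1) \<subseteq> {..<s}" using \<beta> by (auto simp: keys_add_nat)
    then show "\<beta> + Poly_Mapping.single a 1 \<in> W c" using \<beta>
      unfolding W_def \<beta>(1) add.assoc by blast
  qed
  moreover have "W c \<subseteq> W (Suc c)" for c by (auto simp: W_def intro: le_SucI)
  ultimately obtain c0 where c0: "W c = W c0" if "c \<ge> c0" for c
    using upset_chain_stabilizes[of s W] by blast
  have inU: "\<alpha> + \<gamma> \<in> U" if "\<alpha> \<in> U" "keys \<gamma> \<subseteq> {..<s}" for \<alpha> \<gamma>
    using that(2)
  proof (induction "deg \<gamma>" arbitrary: \<gamma>)
    case 0
    then have "\<gamma> = 0" unfolding deg_def
      by (intro poly_mapping_eqI) (metis (no_types, lifting) finite_lessThan in_keys_iff lookup_zero subsetD sum_eq_0_iff)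
    then show ?case using that by simp
  next
    case (Suc m)
    then obtain a where a: "a < s" "lookup \<gamma> a \<noteq> 0" unfolding deg_def
      by (metis lessThan_iff nat.distinct(1) sum.neutral)
    define \<gamma>' where "\<gamma>' = \<gamma> - Poly_Mapping.single a 1"
    have \<gamma>: "\<gamma> = \<gamma>' + Poly_Mapping.single a 1"
      using a by (intro poly_mapping_eqI) (auto simp: \<gamma>'_def lookup_add lookup_minus lookup_single when_def)
    have \<gamma>': "keys \<gamma>' \<subseteq> {..<s}" using Suc.prems \<gamma> by (simp add: keys_add_nat)
    have "deg \<gamma> = Suc (deg \<gamma>')"
      using monomials_add_var[OF a(1), of \<gamma>' "deg \<gamma>'"] \<gamma> \<gamma>' by (simp add: monomials_def deg_def)
    then have "\<alpha> + \<gamma>' \<in> U" using Suc \<gamma>' by simp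
    then show ?case using U a \<gamma> by (auto simp: upset_def add.assoc[symmetric])
  qed
  have "\<exists>a<s. \<exists>\<beta>\<in>U. \<alpha> = \<beta> + Poly_Mapping.single a 1" if \<alpha>: "w > c0" "\<alpha> \<in> U \<inter> monomials s w" for w \<alpha>
  proof -
    have "\<alpha> = \<alpha> + 0" "\<alpha> \<in> U" "deg \<alpha> \<le> w" "keys (0 :: nat \<Rightarrow>\<^sub>0 nat) \<subseteq> {..<s}"
      using \<alpha> by (auto simp: monomials_def deg_def)
    then have "\<alpha> \<in> W w" unfolding W_def by blast
    then have "\<alpha> \<in> W c0" using c0[of w] \<alpha> by simp
    then obtain \<beta> \<gamma> where \<beta>: "\<alpha> = \<beta> + \<gamma>" "\<beta> \<in> U" "deg \<beta> \<le> c0" "keys \<gamma> \<subseteq> {..<s}"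
      unfolding W_def by blast
    have "deg \<alpha> = w" using \<alpha> by (auto simp: deg_def monomials_def)
    moreover have "deg \<alpha> = deg \<beta> + deg \<gamma>" unfolding \<beta>(1) by (simp add: deg_def lookup_add sum.distrib)
    ultimately have "deg \<gamma> \<noteq> 0" using \<beta>(3) \<alpha>(1) by linarith
    then obtain a where a: "a < s" "lookup \<gamma> a \<noteq> 0" unfolding deg_def
      by (metis lessThan_iff sum.neutral)
    define \<gamma>' where "\<gamma>' = \<gamma> - Poly_Mapping.single a 1"
    have \<gamma>: "\<gamma> = \<gamma>' + Poly_Mapping.single a 1"
      using a by (intro poly_mapping_eqI) (auto simp: \<gamma>'_def lookup_add lookup_minus lookup_single when_def)
    have "keys \<gamma>' \<subseteq> {..<s}" using \<beta>(4) \<gamma> by (simp add: keys_add_nat)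
    then have "\<beta> + \<gamma>' \<in> U" using inU \<beta> by blast
    moreover have "\<alpha> = (\<beta> + \<gamma>') + Poly_Mapping.single a 1" using \<beta>(1) \<gamma> by (simp add: add.assoc)
    ultimately show ?thesis using a(1) by blast
  qed
  then show ?thesis by blast
qed

text \<open>
  Induction on the number of variables through \<open>count_fps_slices\<close>.
\<close>

lemma count_fps_rational:
  assumes "upset s U"
  shows "\<exists>k. value_at_minus_one s (count_fps s U) k"
  using assms
proof (induction s arbitrary: U)
  case 0
  have "fps_nth (count_fps 0 U) w = 0" if "w \<ge> 1" for w
    using that by (simp add: count_fps_def monomials_def)
  then show ?case using value_at_minus_one_finite_support by blast
next
  case (Suc s)
  have "\<exists>d0. \<forall>d\<ge>d0. slice s U d = slice s U d0"
    by (intro upset_chain_stabilizes[of s] upset_slice slice_Suc Suc.prems)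
  then obtain d0 where d0: "slice s U d = slice s U d0" if "d \<ge> d0" for d by blast
  obtain k where k: "value_at_minus_one s (count_fps s (slice s U d)) (k d)" for d
    using Suc.IH[OF upset_slice[OF Suc.prems]] by metis
  have zero: "value_at_minus_one s 0 0" using value_at_minus_one_diff[OF k[of 0] k[of 0]] by simp
  have "value_at_minus_one s (fps_of_poly (Polynomial.monom 1 d) * (count_fps s (slice s U d) - (if d = 0 then 0 else count_fps s (slice s U (d - 1)))))
      (poly (Polynomial.monom 1 d) (-1) * (k d - (if d = 0 then 0 else k (d - 1))))" for d
    by (rule value_at_minus_one_mult_poly) (use k zero in \<open>auto intro: value_at_minus_one_diff\<close>)
  then have "value_at_minus_one s (\<Sum>d\<le>d0. fps_of_poly (Polynomial.monom 1 d) * (count_fps s (slice s U d) - (if d = 0 then 0 else count_fps s (slice s U (d - 1)))))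
      (\<Sum>d\<le>d0. poly (Polynomial.monom 1 d) (-1) * (k d - (if d = 0 then 0 else k (d - 1))))"
    by (rule value_at_minus_one_sum)
  then have "value_at_minus_one s ((1 - fps_X) * count_fps (Suc s) U)
      (\<Sum>d\<le>d0. poly (Polynomial.monom 1 d) (-1) * (k d - (if d = 0 then 0 else k (d - 1))))"
    using count_fps_slices[of d0 s U, OF d0] by (simp add: fps_of_poly_monom')
  moreover have "(1 - fps_X) ^ s * ((1 - fps_X) * count_fps (Suc s) U) = (1 - fps_X) ^ Suc s * count_fps (Suc s) U"
    by (simp only: power_Suc mult_ac)
  ultimately show ?case unfolding value_at_minus_one_def by auto
qed

lemma value_at_minus_one_all_monomials:
  "value_at_minus_one s (count_fps s {\<alpha>. keys \<alpha> \<subseteq> {..<s}}) 1"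
proof -
  have "(1 - fps_X) ^ s * count_fps s {\<alpha>. keys \<alpha> \<subseteq> {..<s}} = 1"
  proof (induction s)
    case 0
    have "{0} \<inter> monomials 0 w = (if w = 0 then {0} else {})" for w by (auto simp: monomials_def)
    then show ?case by (intro fps_ext) (simp add: count_fps_def)
  next
    case (Suc s)
    let ?U = "{\<alpha>::nat \<Rightarrow>\<^sub>0 nat. keys \<alpha> \<subseteq> {..<Suc s}}"
    have "slice s ?U d = {\<alpha>. keys \<alpha> \<subseteq> {..<s}}" for d
      by (auto simp: slice_def keys_add_nat split: if_splits)
    then have "(1 - fps_X) * count_fps (Suc s) ?U = count_fps s {\<alpha>. keys \<alpha> \<subseteq> {..<s}}"
      using count_fps_slices[of 0 s ?U] by simp
    moreover have "(1 - fps_X) ^ Suc s * count_fps (Suc s) ?U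
        = (1 - fps_X) ^ s * ((1 - fps_X) * count_fps (Suc s) ?U)" by (simp only: power_Suc mult_ac)
    ultimately show ?case using Suc.IH by simp
  qed
  then have "fps_of_poly 1 = (1 - fps_X) ^ s * count_fps s {\<alpha>. keys \<alpha> \<subseteq> {..<s}}" by simp
  then show ?thesis unfolding value_at_minus_one_def by (intro exI[of _ 1]) auto
qed

section \<open>Graded submodules of free modules\<close>

type_synonym 'a mpol = "(nat \<Rightarrow>\<^sub>0 nat) \<Rightarrow>\<^sub>0 'a"

definition cst :: "'a::comm_ring_1 \<Rightarrow> 'a mpol" where
  "cst c = Poly_Mapping.single 0 c"

definition indet :: "nat \<Rightarrow> 'a::comm_ring_1 mpol" where
  "indet a = Poly_Mapping.single (Poly_Mapping.single a 1) 1"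

lemma cst_simps [simp]:
  "cst 0 = 0" "cst 1 = 1" "cst (a + b) = cst a + cst b" "cst (a * b) = cst a * cst b" "cst (- a) = - cst a"
  by (simp_all add: cst_def single_add mult_single single_uminus flip: single_one)

lemma cst_sum: "cst (\<Sum>i\<in>I. f i) = (\<Sum>i\<in>I. cst (f i))"
  by (induction I rule: infinite_finite_induct) simp_all

lemma lookup_cst_mult [simp]: "lookup (cst c * p) \<alpha> = c * lookup p \<alpha>"
  unfolding cst_def mult_map_scale_conv_mult[symmetric] by (simp add: Poly_Mapping.map.rep_eq when_def)

lemma lookup_indet_mult_add: "lookup (indet a * p) (\<alpha> + Poly_Mapping.single a 1) = lookup p \<alpha>"
proof -
  have "lookup (indet a * p) (\<alpha> + Poly_Mapping.single a 1)
      = (\<Sum>q. lookup p q when \<alpha> + Poly_Mapping.single a 1 = Poly_Mapping.single a 1 + q)"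
    by (simp add: indet_def lookup_mult lookup_single when_mult)
  also have "\<dots> = (\<Sum>q. lookup p q when q = \<alpha>)"
    by (rule Sum_any.cong) (simp add: add.commute[of \<alpha>] eq_commute)
  finally show ?thesis by simp
qed

lemma keys_indet_mult: "\<beta> \<in> keys (indet a * p :: 'a::comm_ring_1 mpol) \<Longrightarrow> \<exists>\<alpha>\<in>keys p. \<beta> = \<alpha> + Poly_Mapping.single a 1"
proof -
  assume "\<beta> \<in> keys (indet a * p)"
  then obtain \<gamma> \<alpha> where "\<beta> = \<gamma> + \<alpha>" "\<gamma> \<in> keys (indet a :: 'a mpol)" "\<alpha> \<in> keys p"
    using keys_mult[of "indet a" p] by blast
  moreover then have "\<gamma> = Poly_Mapping.single a 1" by (simp add: indet_def)
  ultimately show ?thesis by (auto simp: add.commute)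
qed

definition smul :: "'a::field \<Rightarrow> ('b \<Rightarrow> 'a mpol) \<Rightarrow> 'b \<Rightarrow> 'a mpol" where
  "smul c f = (\<lambda>b. cst c * f b)"

lemma smul_apply [simp]: "smul c f b = cst c * f b"
  by (simp add: smul_def)

interpretation fv: vector_space "smul :: 'a::field \<Rightarrow> ('b \<Rightarrow> 'a mpol) \<Rightarrow> 'b \<Rightarrow> 'a mpol"
  by unfold_locales (auto simp: fun_eq_iff algebra_simps)

interpretation fvp: vector_space_pair "smul :: 'a::field \<Rightarrow> ('b \<Rightarrow> 'a mpol) \<Rightarrow> 'b \<Rightarrow> 'a mpol"
    "smul :: 'a::field \<Rightarrow> ('c \<Rightarrow> 'a mpol) \<Rightarrow> 'c \<Rightarrow> 'a mpol"
  by unfold_locales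

definition homogeneous :: "nat \<Rightarrow> 'b set \<Rightarrow> nat \<Rightarrow> ('b \<Rightarrow> 'a::field mpol) set" where
  "homogeneous s B w = {f. \<forall>b. \<forall>\<alpha>\<in>keys (f b). b \<in> B \<and> \<alpha> \<in> monomials s w}"

lemma homogeneousD: "f \<in> homogeneous s B w \<Longrightarrow> lookup (f b) \<alpha> \<noteq> 0 \<Longrightarrow> b \<in> B \<and> \<alpha> \<in> monomials s w"
  by (auto simp: homogeneous_def in_keys_iff)

lemma homogeneousI: "(\<And>b \<alpha>. lookup (f b) \<alpha> \<noteq> 0 \<Longrightarrow> b \<in> B \<and> \<alpha> \<in> monomials s w) \<Longrightarrow> f \<in> homogeneous s B w"
  by (auto simp: homogeneous_def in_keys_iff)

lemma homogeneous_outside: "f \<in> homogeneous s B w \<Longrightarrow> b \<notin> B \<Longrightarrow> f b = 0"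
proof (rule poly_mapping_eqI, rule ccontr)
  fix \<alpha> assume "f \<in> homogeneous s B w" "b \<notin> B" "lookup (f b) \<alpha> \<noteq> lookup 0 \<alpha>"
  then show False using homogeneousD[of f s B w b \<alpha>] by simp
qed

lemma subspace_homogeneous: "fv.subspace (homogeneous s (B :: 'b set) w :: ('b \<Rightarrow> 'a::field mpol) set)"
proof (rule fv.subspaceI)
  fix f g :: "'b \<Rightarrow> 'a mpol" assume "f \<in> homogeneous s B w" "g \<in> homogeneous s B w"
  then show "f + g \<in> homogeneous s B w"
    using keys_add unfolding homogeneous_def by fastforce
next
  fix c :: 'a and f :: "'b \<Rightarrow> 'a mpol" assume "f \<in> homogeneous s B w"
  then show "smul c f \<in> homogeneous s B w"
    by (auto simp: homogeneous_def in_keys_iff)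
qed (auto simp: homogeneous_def)

lemma homogeneous_indet:
  assumes "f \<in> homogeneous s B w" "a < s"
  shows "(\<lambda>b. indet a * f b) \<in> homogeneous s B (Suc w)"
proof -
  have "b \<in> B \<and> \<beta> \<in> monomials s (Suc w)" if \<beta>: "\<beta> \<in> keys (indet a * f b)" for b \<beta>
  proof -
    obtain \<alpha> where "\<alpha> \<in> keys (f b)" "\<beta> = \<alpha> + Poly_Mapping.single a 1"
      using keys_indet_mult[OF \<beta>] by blast
    then show ?thesis using assms monomials_add_var[OF assms(2)] by (auto simp: homogeneous_def)
  qed
  then show ?thesis by (auto simp: homogeneous_def)
qed

definition unit_monomial :: "'b \<times> (nat \<Rightarrow>\<^sub>0 nat) \<Rightarrow> 'b \<Rightarrow> 'a::field mpol" where
  "unit_monomial x = (\<lambda>b. if b = fst x then Poly_Mapping.single (snd x) 1 else 0)"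

lemma homogeneous_span:
  fixes B :: "'b set"
  assumes "finite B"
  shows "(homogeneous s B w :: ('b \<Rightarrow> 'a::field mpol) set) \<subseteq> fv.span (unit_monomial ` (B \<times> monomials s w))"
proof
  fix f :: "'b \<Rightarrow> 'a mpol" assume f: "f \<in> homogeneous s B w"
  have fin: "finite (B \<times> monomials s w)" using assms finite_monomials by blast
  have "f = (\<Sum>x\<in>B \<times> monomials s w. smul (lookup (f (fst x)) (snd x)) (unit_monomial x))"
  proof (intro ext poly_mapping_eqI)
    fix b \<alpha>
    have ap: "(\<Sum>x\<in>A. g x) b = (\<Sum>x\<in>A. g x b)" for A and g :: "_ \<Rightarrow> 'b \<Rightarrow> 'a mpol"
      by (induction A rule: infinite_finite_induct) auto
    have "lookup ((\<Sum>x\<in>B \<times> monomials s w. smul (lookup (f (fst x)) (snd x)) (unit_monomial x)) b) \<alpha>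
        = (\<Sum>x\<in>B \<times> monomials s w. if x = (b, \<alpha>) then lookup (f b) \<alpha> else 0)"
      unfolding ap lookup_sum
      by (rule sum.cong) (auto simp: unit_monomial_def lookup_single when_def)
    also have "\<dots> = (if (b, \<alpha>) \<in> B \<times> monomials s w then lookup (f b) \<alpha> else 0)"
      using fin by (simp add: sum.delta')
    also have "\<dots> = lookup (f b) \<alpha>" using homogeneousD[OF f, of b \<alpha>] by auto
    finally show "lookup (f b) \<alpha>
        = lookup ((\<Sum>x\<in>B \<times> monomials s w. smul (lookup (f (fst x)) (snd x)) (unit_monomial x)) b) \<alpha>" ..
  qed
  also have "\<dots> \<in> fv.span (unit_monomial ` (B \<times> monomials s w))"
    by (intro fv.span_sum fv.span_scale fv.span_base) auto
  finally show "f \<in> fv.span (unit_monomial ` (B \<times> monomials s w))" .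
qed

text \<open>
  A graded submodule of the free module with basis \<open>B\<close>, given by its homogeneous parts, so that no
  decomposition into components is ever needed.  Elements are coordinate functions on the basis, and
  all basis elements have degree zero.
\<close>

definition graded_submodule :: "nat \<Rightarrow> 'b set \<Rightarrow> (nat \<Rightarrow> ('b \<Rightarrow> 'a::field mpol) set) \<Rightarrow> bool" where
  "graded_submodule s B N \<longleftrightarrow> (\<forall>w. fv.subspace (N w) \<and> N w \<subseteq> homogeneous s B w)
     \<and> (\<forall>w. \<forall>f\<in>N w. \<forall>a<s. (\<lambda>b. indet a * f b) \<in> N (Suc w))"

lemma graded_submoduleD:
  assumes "graded_submodule s B N"
  shows "fv.subspace (N w)" "N w \<subseteq> homogeneous s B w" "f \<in> N w \<Longrightarrow> a < s \<Longrightarrow> (\<lambda>b. indet a * f b) \<in> N (Suc w)"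
  using assms by (auto simp: graded_submodule_def)

lemma dim_preimage_plus_dim_sum_image_homogeneous:
  assumes "finite B" "finite B'"
    and "\<And>g h. f (g + h) = f g + f h" "\<And>c g. f (smul c g) = smul c (f g)"
    and "fv.subspace V" "V \<subseteq> homogeneous s B w" "fv.subspace U" "U \<subseteq> homogeneous s' B' w'"
  shows "fv.dim V + fv.dim U = fv.dim {v \<in> V. f v \<in> U} + fv.dim {f v + u |v u. v \<in> V \<and> u \<in> U}"
proof (rule fvp.dim_preimage_plus_dim_sum_image)
  show "Vector_Spaces.linear smul smul f"
    using assms(3,4) unfolding Vector_Spaces.linear_iff by (auto intro: fv.vector_space_axioms)
  show "finite (unit_monomial ` (B \<times> monomials s w))" "finite (unit_monomial ` (B' \<times> monomials s' w'))"
    using assms(1,2) finite_monomials by auto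
  show "V \<subseteq> fv.span (unit_monomial ` (B \<times> monomials s w))" "U \<subseteq> fv.span (unit_monomial ` (B' \<times> monomials s' w'))"
    using homogeneous_span[OF assms(1)] homogeneous_span[OF assms(2)] assms(6,8) by blast+
qed (use assms in auto)

definition hilbert_series :: "(nat \<Rightarrow> ('b \<Rightarrow> 'a::field mpol) set) \<Rightarrow> int fps" where
  "hilbert_series N = Abs_fps (\<lambda>w. int (fv.dim (N w)))"

section \<open>Leading monomials\<close>

text \<open>
  Leading positions with respect to the lexicographic order on pairs of a basis index and a
  monomial; \<open>e\<close> enumerates the basis.
\<close>

definition leading :: "(nat \<Rightarrow> 'b) \<Rightarrow> nat \<Rightarrow> nat \<Rightarrow> nat \<Rightarrow> ('b \<Rightarrow> 'a::field mpol) set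
    \<Rightarrow> (nat \<times> (nat \<Rightarrow>\<^sub>0 nat)) set" where
  "leading e m s w N = {x \<in> {..<m} \<times> monomials s w. \<exists>f\<in>N. lookup (f (e (fst x))) (snd x) \<noteq> 0
     \<and> (\<forall>y\<in>{..<m} \<times> monomials s w. x < y \<longrightarrow> lookup (f (e (fst y))) (snd y) = 0)}"

lemma dim_eq_card_leading:
  fixes B :: "'b set" and N :: "('b \<Rightarrow> 'a::field mpol) set"
  assumes "bij_betw e {..<m} B" "fv.subspace N" "N \<subseteq> homogeneous s B w"
  shows "fv.dim N = card (leading e m s w N)"
  unfolding leading_def
proof (rule fv.dim_eq_card_leading_positions[where S = "unit_monomial ` (B \<times> monomials s w)"])
  have B: "finite B" using assms(1) bij_betw_finite by blast
  show "finite ({..<m} \<times> monomials s w)" "finite (unit_monomial ` (B \<times> monomials s w))"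
    using B finite_monomials by auto
  show "N \<subseteq> fv.span (unit_monomial ` (B \<times> monomials s w))" using assms(3) homogeneous_span[OF B] by blast
  fix f assume f: "f \<in> N" "\<And>x. x \<in> {..<m} \<times> monomials s w \<Longrightarrow> lookup (f (e (fst x))) (snd x) = 0"
  show "f = 0"
  proof (rule ext, rule poly_mapping_eqI, rule ccontr)
    fix b \<alpha> assume "lookup (f b) \<alpha> \<noteq> lookup ((0 :: 'b \<Rightarrow> 'a mpol) b) \<alpha>"
    then have nz: "lookup (f b) \<alpha> \<noteq> 0" by simp
    then have "b \<in> B" "\<alpha> \<in> monomials s w" using homogeneousD[OF subsetD[OF assms(3) f(1)] nz] by simp_all
    moreover then obtain i where "i < m" "b = e i" using assms(1) by (auto simp: bij_betw_def)
    ultimately show False using nz f(2)[of "(i, \<alpha>)"] by auto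
  qed
qed (use assms in \<open>auto simp: lookup_add\<close>)

text \<open>
  The order on monomials is compatible with addition, so multiplication by a variable shifts the
  leading monomial.  Allowing two different submodules \<open>N\<close> and \<open>N'\<close> makes the lemma serve both for
  submodules and for pairs of submodules whose quotient is killed by the variables.
\<close>

lemma leading_times_indet:
  assumes "\<And>f. f \<in> N \<Longrightarrow> (\<lambda>b. indet a * f b) \<in> N'" and "a < s" and "(i, \<alpha>) \<in> leading e m s w N"
  shows "(i, \<alpha> + Poly_Mapping.single a 1) \<in> leading e m s (Suc w) N'"
proof -
  have i: "i < m" "\<alpha> \<in> monomials s w" using assms(3) by (simp_all add: leading_def)
  obtain f where f0: "f \<in> N" "lookup (f (e (fst (i, \<alpha>)))) (snd (i, \<alpha>)) \<noteq> 0"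
    "\<forall>y\<in>{..<m} \<times> monomials s w. (i, \<alpha>) < y \<longrightarrow> lookup (f (e (fst y))) (snd y) = 0"
    using assms(3) unfolding leading_def mem_Collect_eq by blast
  have f: "f \<in> N" "lookup (f (e i)) \<alpha> \<noteq> 0" using f0 by simp_all
  have f3: "lookup (f (e j)) \<beta> = 0" if "j < m" "\<beta> \<in> monomials s w" "(i, \<alpha>) < (j, \<beta>)" for j \<beta>
    using f0(3)[rule_format, of "(j, \<beta>)"] that by simp
  have "lookup (indet a * f (e j)) \<beta> = 0"
    if "j < m" "\<beta> \<in> monomials s (Suc w)" "(i, \<alpha> + Poly_Mapping.single a 1) < (j, \<beta>)" for j \<beta>
  proof (rule ccontr)
    assume "lookup (indet a * f (e j)) \<beta> \<noteq> 0"
    then obtain \<gamma> where \<gamma>: "\<gamma> \<in> keys (f (e j))" "\<beta> = \<gamma> + Poly_Mapping.single a 1"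
      using keys_indet_mult[of \<beta> a "f (e j)"] by (auto simp: in_keys_iff)
    have "\<gamma> \<in> monomials s w" using that(2) \<gamma>(2) monomials_add_var[OF assms(2)] by simp
    moreover have "(i, \<alpha>) < (j, \<gamma>)" using that(3) \<gamma>(2) by auto
    ultimately show False using f3[OF that(1)] \<gamma>(1) by (simp add: in_keys_iff)
  qed
  moreover have "lookup (indet a * f (e i)) (\<alpha> + Poly_Mapping.single a 1) \<noteq> 0"
    using f(2) by (simp only: lookup_indet_mult_add not_False_eq_True)
  moreover have "\<alpha> + Poly_Mapping.single a 1 \<in> monomials s (Suc w)"
    using i(2) monomials_add_var[OF assms(2)] by simp
  moreover have "\<forall>y\<in>{..<m} \<times> monomials s (Suc w). (i, \<alpha> + Poly_Mapping.single a 1) < y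
      \<longrightarrow> lookup (indet a * f (e (fst y))) (snd y) = 0" using calculation(1) by (auto simp del: less_prod_simp)
  ultimately show ?thesis unfolding leading_def mem_Collect_eq using i(1) assms(1)[OF f(1)]
    by (intro conjI bexI[of _ "\<lambda>b. indet a * f b"]) simp_all
qed

definition leading_monomials ::
    "(nat \<Rightarrow> 'b) \<Rightarrow> nat \<Rightarrow> nat \<Rightarrow> (nat \<Rightarrow> ('b \<Rightarrow> 'a::field mpol) set) \<Rightarrow> nat \<Rightarrow> (nat \<Rightarrow>\<^sub>0 nat) set" where
  "leading_monomials e m s N i = {\<alpha>. \<exists>w. (i, \<alpha>) \<in> leading e m s w (N w)}"

lemma leading_monomials_Int:
  "\<alpha> \<in> leading_monomials e m s N i \<inter> monomials s w \<longleftrightarrow> (i, \<alpha>) \<in> leading e m s w (N w)"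
proof
  assume "\<alpha> \<in> leading_monomials e m s N i \<inter> monomials s w"
  then obtain v where v: "(i, \<alpha>) \<in> leading e m s v (N v)" "\<alpha> \<in> monomials s w"
    unfolding leading_monomials_def by blast
  then have "\<alpha> \<in> monomials s v" by (simp add: leading_def)
  then have "v = w" using v(2) by (simp add: monomials_def)
  then show "(i, \<alpha>) \<in> leading e m s w (N w)" using v(1) by simp
next
  assume l: "(i, \<alpha>) \<in> leading e m s w (N w)"
  then have "\<alpha> \<in> monomials s w" by (simp add: leading_def)
  then show "\<alpha> \<in> leading_monomials e m s N i \<inter> monomials s w"
    using l unfolding leading_monomials_def by blast
qed

lemma upset_leading_monomials:
  assumes "graded_submodule s B N"
  shows "upset s (leading_monomials e m s N i)"
  unfolding upset_def
proof (intro conjI ballI allI impI)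
  fix \<alpha> assume "\<alpha> \<in> leading_monomials e m s N i"
  then obtain w where w: "(i, \<alpha>) \<in> leading e m s w (N w)" by (auto simp: leading_monomials_def)
  then show "keys \<alpha> \<subseteq> {..<s}" by (auto simp: leading_def monomials_def)
  fix a assume "a < s"
  then have "(i, \<alpha> + Poly_Mapping.single a 1) \<in> leading e m s (Suc w) (N (Suc w))"
    using leading_times_indet[of "N w" a "N (Suc w)"] graded_submoduleD(3)[OF assms] w by blast
  then show "\<alpha> + Poly_Mapping.single a 1 \<in> leading_monomials e m s N i"
    unfolding leading_monomials_def by blast
qed

lemma hilbert_series_eq_count_leading:
  assumes "bij_betw e {..<m} B" "graded_submodule s B N"
  shows "hilbert_series N = (\<Sum>i<m. count_fps s (leading_monomials e m s N i))"
proof (rule fps_ext)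
  fix w
  have "leading e m s w (N w) = (SIGMA i:{..<m}. leading_monomials e m s N i \<inter> monomials s w)"
  proof (rule Set.set_eqI, clarify)
    fix i \<alpha>
    have "(i, \<alpha>) \<in> leading e m s w (N w) \<Longrightarrow> i < m" by (simp add: leading_def)
    then show "(i, \<alpha>) \<in> leading e m s w (N w)
        \<longleftrightarrow> (i, \<alpha>) \<in> (SIGMA i:{..<m}. leading_monomials e m s N i \<inter> monomials s w)"
      using leading_monomials_Int[of \<alpha> e m s N i w] by blast
  qed
  then have "fv.dim (N w) = (\<Sum>i<m. card (leading_monomials e m s N i \<inter> monomials s w))"
    using dim_eq_card_leading[OF assms(1) graded_submoduleD(1,2)[OF assms(2)]] by (simp add: finite_monomials)
  then show "fps_nth (hilbert_series N) w = fps_nth (\<Sum>i<m. count_fps s (leading_monomials e m s N i)) w"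
    by (simp add: hilbert_series_def count_fps_def fps_sum_nth)
qed

lemma hilbert_series_rational:
  assumes "finite B" "graded_submodule s B N"
  shows "\<exists>k. value_at_minus_one s (hilbert_series N) k"
proof -
  obtain e where e: "bij_betw e {..<card B} B"
    using ex_bij_betw_nat_finite[OF assms(1)] by (auto simp: atLeast0LessThan)
  obtain k where k: "value_at_minus_one s (count_fps s (leading_monomials e (card B) s N i)) (k i)" for i
    using count_fps_rational[OF upset_leading_monomials[OF assms(2)]] by metis
  show ?thesis unfolding hilbert_series_eq_count_leading[OF e assms(2)]
    by (rule exI, rule value_at_minus_one_sum, rule k)
qed

text \<open>
  A finitely generated graded module that is killed by all variables is finite-dimensional.  Here the
  module is \<open>N / N'\<close>: in high degrees a leading monomial of \<open>N\<close> is a variable times another one, so it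
  is a leading monomial of \<open>N'\<close>.
\<close>

lemma dim_eventually_eq:
  assumes "finite B" "graded_submodule s B N" "graded_submodule s B N'" "\<And>w. N' w \<subseteq> N w"
    and "\<And>w f a. f \<in> N w \<Longrightarrow> a < s \<Longrightarrow> (\<lambda>b. indet a * f b) \<in> N' (Suc w)"
  shows "\<exists>w0. \<forall>w>w0. fv.dim (N w) = fv.dim (N' w)"
proof -
  define m where "m = card B"
  obtain e where e: "bij_betw e {..<m} B" unfolding m_def
    using ex_bij_betw_nat_finite[OF assms(1)] by (auto simp: atLeast0LessThan)
  let ?U = "leading_monomials e m s N"
  have "\<forall>i. \<exists>w0. \<forall>w>w0. \<forall>\<alpha>\<in>?U i \<inter> monomials s w. \<exists>a<s. \<exists>\<beta>\<in>?U i. \<alpha> = \<beta> + Poly_Mapping.single a 1"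
    by (intro allI upset_finitely_generated[OF upset_leading_monomials[OF assms(2)]])
  from choice[OF this] obtain g where g: "\<forall>i. \<forall>w>g i. \<forall>\<alpha>\<in>?U i \<inter> monomials s w.
      \<exists>a<s. \<exists>\<beta>\<in>?U i. \<alpha> = \<beta> + Poly_Mapping.single a 1"
    by blast
  define w0 where "w0 = Max (insert 0 (g ` {..<m}))"
  have "fv.dim (N w) = fv.dim (N' w)" if w: "w > w0" for w
  proof -
    have "leading e m s w (N w) \<subseteq> leading e m s w (N' w)"
    proof (rule subrelI)
      fix i \<alpha> assume l: "(i, \<alpha>) \<in> leading e m s w (N w)"
      then have "i < m" by (simp add: leading_def)
      then have "g i \<le> w0" unfolding w0_def by (intro Max_ge) auto
      then obtain a \<beta> where a: "a < s" "\<beta> \<in> ?U i" "\<alpha> = \<beta> + Poly_Mapping.single a 1"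
        using g[rule_format, of i w \<alpha>] w l leading_monomials_Int[of \<alpha> e m s N i w] by auto
      obtain v where v: "w = Suc v" using w by (cases w) auto
      have "\<alpha> \<in> monomials s w" using l by (simp add: leading_def)
      then have "\<beta> \<in> monomials s v" using a monomials_add_var[OF a(1)] v by simp
      then have "(i, \<beta>) \<in> leading e m s v (N v)" using a(2) leading_monomials_Int[of \<beta> e m s N i v] by blast
      then show "(i, \<alpha>) \<in> leading e m s w (N' w)" unfolding a(3) v
        by (rule leading_times_indet[rotated 2]) (use assms(5) a(1) in auto)
    qed
    moreover have "leading e m s w (N' w) \<subseteq> leading e m s w (N w)"
      unfolding leading_def using assms(4)[of w] by blast
    ultimately show ?thesis
      using dim_eq_card_leading[OF e graded_submoduleD(1,2)[OF assms(2)]]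
        dim_eq_card_leading[OF e graded_submoduleD(1,2)[OF assms(3)]] by simp
  qed
  then show ?thesis by blast
qed

section \<open>Clifford matrices\<close>

definition words :: "nat \<Rightarrow> bool list set" where
  "words p = {l. length l = p}"

lemma finite_words: "finite (words p)" and card_words: "card (words p) = 2 ^ p"
  using finite_lists_length_eq[of "UNIV :: bool set" p] card_lists_length_eq[of "UNIV :: bool set" p]
  by (simp_all add: words_def)

lemma sum_words_Suc: "(\<Sum>l\<in>words (Suc p). f l) = (\<Sum>l\<in>words p. f (True # l) + f (False # l))"
proof -
  have "words (Suc p) = Cons True ` words p \<union> Cons False ` words p"
    by (auto simp: words_def length_Suc_conv image_iff)
  moreover have "(\<Sum>l\<in>Cons True ` words p \<union> Cons False ` words p. f l)
      = (\<Sum>l\<in>Cons True ` words p. f l) + (\<Sum>l\<in>Cons False ` words p. f l)"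
    by (rule sum.union_disjoint) (auto simp: finite_words)
  ultimately show ?thesis by (simp add: sum.reindex sum.distrib)
qed

text \<open>
  Matrices with \<open>\<gamma>\<^sub>a \<gamma>\<^sub>b + \<gamma>\<^sub>b \<gamma>\<^sub>a = 2 \<delta>\<^sub>a\<^sub>b\<close>, with rows and columns indexed by bit strings of length
  \<open>p\<close>.
\<close>

definition clifford_family :: "nat \<Rightarrow> nat \<Rightarrow> (nat \<Rightarrow> bool list \<Rightarrow> bool list \<Rightarrow> 'a::field) \<Rightarrow> bool" where
  "clifford_family s p g \<longleftrightarrow> (\<forall>a<s. \<forall>b<s. \<forall>\<tau>\<in>words p. \<forall>\<sigma>\<in>words p.
     (\<Sum>\<rho>\<in>words p. g a \<tau> \<rho> * g b \<rho> \<sigma> + g b \<tau> \<rho> * g a \<rho> \<sigma>) = (if a = b \<and> \<tau> = \<sigma> then 2 else 0))"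

text \<open>
  Two further generators at the price of one more bit: the new matrices are \<open>\<sigma>\<^sub>x \<otimes> \<gamma>\<^sub>a\<close>, \<open>\<sigma>\<^sub>y \<otimes> 1\<close> and
  \<open>\<sigma>\<^sub>z \<otimes> 1\<close> up to sign, with Pauli matrices \<open>\<sigma>\<close>; the square root \<open>j\<close> of \<open>-1\<close> enters \<open>\<sigma>\<^sub>y\<close>.
\<close>

fun clifford_step :: "'a::field \<Rightarrow> nat \<Rightarrow> (nat \<Rightarrow> bool list \<Rightarrow> bool list \<Rightarrow> 'a)
    \<Rightarrow> nat \<Rightarrow> bool list \<Rightarrow> bool list \<Rightarrow> 'a" where
  "clifford_step j m g a (x # \<tau>) (y # \<sigma>) =
     (if a < m then (if x \<noteq> y then g a \<tau> \<sigma> else 0)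
      else if \<tau> \<noteq> \<sigma> then 0
      else if a = m then (if x = y then 0 else if x then j else - j)
      else (if x \<noteq> y then 0 else if x then 1 else -1))"
| "clifford_step j m g a _ _ = 0"

lemma clifford_family_step:
  assumes "j * j = -1" and "clifford_family m p g"
  shows "clifford_family (m + 2) (Suc p) (clifford_step j m g)"
  unfolding clifford_family_def
proof (intro allI impI ballI)
  fix a b and \<tau>' \<sigma>' :: "bool list"
  assume ab: "a < m + 2" "b < m + 2" and "\<tau>' \<in> words (Suc p)" "\<sigma>' \<in> words (Suc p)"
  then obtain x \<tau> y \<sigma> where l: "\<tau>' = x # \<tau>" "\<sigma>' = y # \<sigma>" "\<tau> \<in> words p" "\<sigma> \<in> words p"
    by (auto simp: words_def length_Suc_conv)
  let ?h = "clifford_step j m g"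
  have old: "(\<Sum>\<rho>\<in>words p. g a \<tau> \<rho> * g b \<rho> \<sigma> + g b \<tau> \<rho> * g a \<rho> \<sigma>) = (if a = b \<and> \<tau> = \<sigma> then 2 else 0)"
    if "a < m" "b < m"
    using assms(2) that l unfolding clifford_family_def by blast
  have delta: "(\<Sum>\<rho>\<in>words p. if \<rho> = \<sigma> then F \<rho> else 0) = F \<sigma>" "(\<Sum>\<rho>\<in>words p. if \<tau> = \<rho> then F \<rho> else 0) = F \<tau>"
    for F :: "bool list \<Rightarrow> 'a"
    using l finite_words by (simp_all add: sum.delta sum.delta')
  have split: "(\<Sum>\<rho>\<in>words (Suc p). ?h a \<tau>' \<rho> * ?h b \<rho> \<sigma>' + ?h b \<tau>' \<rho> * ?h a \<rho> \<sigma>')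
     = (\<Sum>\<rho>\<in>words p. (?h a (x # \<tau>) (True # \<rho>) * ?h b (True # \<rho>) (y # \<sigma>) + ?h b (x # \<tau>) (True # \<rho>) * ?h a (True # \<rho>) (y # \<sigma>))
         + (?h a (x # \<tau>) (False # \<rho>) * ?h b (False # \<rho>) (y # \<sigma>) + ?h b (x # \<tau>) (False # \<rho>) * ?h a (False # \<rho>) (y # \<sigma>)))"
    (is "_ = (\<Sum>\<rho>\<in>words p. ?S \<rho>)")
    unfolding l(1,2) by (rule sum_words_Suc)
  have "(\<Sum>\<rho>\<in>words p. ?S \<rho>) = (if a = b \<and> x = y \<and> \<tau> = \<sigma> then 2 else 0)"
  proof -
    consider "a < m" "b < m" | "a < m" "b \<ge> m" | "a \<ge> m" "b < m" | "a \<ge> m" "b \<ge> m" by linarith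
    then show ?thesis
    proof cases
      case 1
      then have "?S \<rho> = (if x = y then g a \<tau> \<rho> * g b \<rho> \<sigma> + g b \<tau> \<rho> * g a \<rho> \<sigma> else 0)" for \<rho>
        by (cases x; cases y) auto
      then have "(\<Sum>\<rho>\<in>words p. ?S \<rho>) = (if x = y then \<Sum>\<rho>\<in>words p. g a \<tau> \<rho> * g b \<rho> \<sigma> + g b \<tau> \<rho> * g a \<rho> \<sigma> else 0)"
        by simp
      then show ?thesis using old 1 by auto
    next
      case 2
      \<comment> \<open>\<open>c (\<not> x)\<close> and \<open>c x\<close> are the entries of the Pauli matrix of \<open>b\<close> that occur in its two products
         with \<open>\<sigma>\<^sub>x\<close>; they are opposite because the two matrices anticommute\<close>
      define c where "c z = (if b = m then (if x \<noteq> y then 0 else if z then j else - j) else (if x = y then 0 else if z then 1 else -1))" for z :: bool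
      have "?S \<rho> = (if \<rho> = \<sigma> then c (\<not> x) * g a \<tau> \<sigma> else 0) + (if \<tau> = \<rho> then c x * g a \<tau> \<sigma> else 0)" for \<rho>
        using 2 by (cases x; cases y) (auto simp: c_def)
      then have "(\<Sum>\<rho>\<in>words p. ?S \<rho>) = c (\<not> x) * g a \<tau> \<sigma> + c x * g a \<tau> \<sigma>"
        by (simp only: sum.distrib delta)
      also have "\<dots> = 0" by (auto simp: c_def)
      finally show ?thesis using 2 by simp
    next
      case 3
      define c where "c z = (if a = m then (if x \<noteq> y then 0 else if z then j else - j) else (if x = y then 0 else if z then 1 else -1))" for z :: bool
      have "?S \<rho> = (if \<rho> = \<sigma> then c (\<not> x) * g b \<tau> \<sigma> else 0) + (if \<tau> = \<rho> then c x * g b \<tau> \<sigma> else 0)" for \<rho>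
        using 3 by (cases x; cases y) (auto simp: c_def)
      then have "(\<Sum>\<rho>\<in>words p. ?S \<rho>) = c (\<not> x) * g b \<tau> \<sigma> + c x * g b \<tau> \<sigma>"
        by (simp only: sum.distrib delta)
      also have "\<dots> = 0" by (auto simp: c_def)
      finally show ?thesis using 3 by simp
    next
      case 4
      have "?S \<rho> = (if \<tau> = \<rho> then if a = b \<and> x = y \<and> \<rho> = \<sigma> then 2 else 0 else 0)" for \<rho>
        using 4 ab assms(1) by (cases x; cases y) auto
      then show ?thesis by (simp only: delta)
    qed
  qed
  then show "(\<Sum>\<rho>\<in>words (Suc p). ?h a \<tau>' \<rho> * ?h b \<rho> \<sigma>' + ?h b \<tau>' \<rho> * ?h a \<rho> \<sigma>') = (if a = b \<and> \<tau>' = \<sigma>' then 2 else 0)"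
    unfolding split using l by simp
qed

text \<open>
  Starting from the single \<open>1 \<times> 1\<close> matrix \<open>1\<close>, bit strings of length \<open>p\<close> carry \<open>2 p + 1\<close> generators.
  That the odd generator is free of charge gives the exact power of two for odd \<open>s\<close>.
\<close>

lemma clifford_family_exists:
  assumes "j * j = (-1 :: 'a::field)"
  shows "\<exists>g :: nat \<Rightarrow> bool list \<Rightarrow> bool list \<Rightarrow> 'a. clifford_family s (s div 2) g"
proof -
  have "\<exists>g :: nat \<Rightarrow> bool list \<Rightarrow> bool list \<Rightarrow> 'a. clifford_family (2 * p + 1) p g" for p
  proof (induction p)
    case 0
    have "clifford_family 1 0 (\<lambda>_ _ _. 1 :: 'a)" by (simp add: clifford_family_def words_def)
    then show ?case by auto
  next
    case (Suc p)
    then obtain g :: "nat \<Rightarrow> bool list \<Rightarrow> bool list \<Rightarrow> 'a" where "clifford_family (2 * p + 1) p g" by blast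
    from clifford_family_step[OF assms this] show ?case by (auto simp: add.commute)
  qed
  then obtain g :: "nat \<Rightarrow> bool list \<Rightarrow> bool list \<Rightarrow> 'a" where "clifford_family (2 * (s div 2) + 1) (s div 2) g"
    by blast
  moreover have "s \<le> 2 * (s div 2) + 1" by simp
  ultimately have "clifford_family s (s div 2) g" unfolding clifford_family_def
    by (meson less_le_trans)
  then show ?thesis by blast
qed

section \<open>Tensoring with spinors\<close>

text \<open>
  The tensor product of \<open>N\<close> with a vector space with basis \<open>T\<close>.
\<close>

definition spinors :: "bool list set \<Rightarrow> ('b \<Rightarrow> 'a::field mpol) set \<Rightarrow> ('b \<times> bool list \<Rightarrow> 'a mpol) set" where
  "spinors T N = {F. (\<forall>\<tau>\<in>T. (\<lambda>b. F (b, \<tau>)) \<in> N) \<and> (\<forall>b. \<forall>\<tau>. \<tau> \<notin> T \<longrightarrow> F (b, \<tau>) = 0)}"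

lemma spinorsI:
  "(\<And>\<tau>. \<tau> \<in> T \<Longrightarrow> (\<lambda>b. F (b, \<tau>)) \<in> N) \<Longrightarrow> (\<And>b \<tau>. \<tau> \<notin> T \<Longrightarrow> F (b, \<tau>) = 0) \<Longrightarrow> F \<in> spinors T N"
  by (simp add: spinors_def)

lemma spinorsD: "F \<in> spinors T N \<Longrightarrow> \<tau> \<in> T \<Longrightarrow> (\<lambda>b. F (b, \<tau>)) \<in> N"
  by (simp add: spinors_def)

lemma spinors_outside: "F \<in> spinors T N \<Longrightarrow> \<tau> \<notin> T \<Longrightarrow> F (b, \<tau>) = 0"
  by (simp add: spinors_def)

lemma subspace_spinors:
  assumes "fv.subspace N"
  shows "fv.subspace (spinors T N)"
proof (rule fv.subspaceI)
  show "0 \<in> spinors T N" using fv.subspace_0[OF assms] by (intro spinorsI) (simp_all add: zero_fun_def)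
next
  fix F G assume "F \<in> spinors T N" "G \<in> spinors T N"
  then show "F + G \<in> spinors T N"
    using fv.subspace_add[OF assms] by (auto simp: spinors_def plus_fun_def)
next
  fix c F assume "F \<in> spinors T N"
  then show "smul c F \<in> spinors T N"
    using fv.subspace_scale[OF assms] by (auto simp: spinors_def smul_def)
qed

lemma spinors_homogeneous:
  assumes "N \<subseteq> homogeneous s B w"
  shows "spinors T N \<subseteq> homogeneous s (B \<times> T) w"
proof
  fix F assume F: "F \<in> spinors T N"
  show "F \<in> homogeneous s (B \<times> T) w"
  proof (rule homogeneousI)
    fix x \<alpha> assume nz: "lookup (F x) \<alpha> \<noteq> 0"
    obtain b \<tau> where x: "x = (b, \<tau>)" by (cases x)
    have "\<tau> \<in> T"
    proof (rule ccontr)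
      assume "\<tau> \<notin> T"
      then show False using nz spinors_outside[OF F] x by simp
    qed
    then have "(\<lambda>b. F (b, \<tau>)) \<in> homogeneous s B w" using spinorsD[OF F] assms by blast
    then show "x \<in> B \<times> T \<and> \<alpha> \<in> monomials s w"
      using homogeneousD[of "\<lambda>b. F (b, \<tau>)" s B w b \<alpha>] nz x \<open>\<tau> \<in> T\<close> by simp
  qed
qed

lemma graded_submodule_spinors:
  assumes "graded_submodule s B N"
  shows "graded_submodule s (B \<times> T) (\<lambda>w. spinors T (N w))"
  unfolding graded_submodule_def
proof (intro conjI allI ballI impI)
  fix w
  show "fv.subspace (spinors T (N w))" by (rule subspace_spinors[OF graded_submoduleD(1)[OF assms]])
  show "spinors T (N w) \<subseteq> homogeneous s (B \<times> T) w"
    by (rule spinors_homogeneous[OF graded_submoduleD(2)[OF assms]])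
next
  fix w F a assume "F \<in> spinors T (N w)" "a < s"
  then show "(\<lambda>x. indet a * F x) \<in> spinors T (N (Suc w))"
    using graded_submoduleD(3)[OF assms] by (auto simp: spinors_def)
qed

lemma dim_spinors:
  assumes "finite T" "finite B" "fv.subspace N" "N \<subseteq> homogeneous s B w"
  shows "fv.dim (spinors T N) = card T * fv.dim N"
  using assms(1)
proof (induction T)
  case empty
  have "spinors {} N \<subseteq> {0}" by (auto simp: spinors_def fun_eq_iff)
  then have "fv.dim (spinors {} N) \<le> card ({} :: ('a \<times> bool list \<Rightarrow> 'b mpol) set)"
    by (intro fv.dim_le_card) auto
  then show ?case by (simp del: smul_apply)
next
  case (insert \<tau> T)
  define V where "V = spinors (insert \<tau> T) N"
  define f where "f F = (\<lambda>b. F (b, \<tau>))" for F :: "'a \<times> bool list \<Rightarrow> 'b mpol"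
  have N0: "0 \<in> N" using fv.subspace_0[OF assms(3)] .
  have "fv.dim V + fv.dim {0 :: 'a \<Rightarrow> 'b mpol}
      = fv.dim {v \<in> V. f v \<in> {0}} + fv.dim {f v + u |v u. v \<in> V \<and> u \<in> {0}}"
  proof (rule dim_preimage_plus_dim_sum_image_homogeneous)
    show "fv.subspace V" "V \<subseteq> homogeneous s (B \<times> insert \<tau> T) w"
      unfolding V_def using subspace_spinors[OF assms(3)] spinors_homogeneous[OF assms(4)] by blast+
    show "{0 :: 'a \<Rightarrow> 'b mpol} \<subseteq> homogeneous s B w" by (simp add: homogeneous_def)
  qed (use assms(2) insert.hyps in \<open>auto simp: f_def fun_eq_iff\<close>)
  moreover have "{v \<in> V. f v \<in> {0}} = spinors T N"
  proof (intro subset_antisym subsetI)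
    fix F assume F: "F \<in> {v \<in> V. f v \<in> {0}}"
    then have "f F b = 0" for b by simp
    then have z: "F (b, \<tau>) = 0" for b by (simp add: f_def)
    have FV: "F \<in> spinors (insert \<tau> T) N" using F by (simp add: V_def)
    show "F \<in> spinors T N"
    proof (rule spinorsI)
      show "F (b, \<tau>') = 0" if "\<tau>' \<notin> T" for b \<tau>'
        using that z spinors_outside[OF FV, of \<tau>' b] by (cases "\<tau>' = \<tau>") auto
    qed (use spinorsD[OF FV] in simp)
  next
    fix F assume F: "F \<in> spinors T N"
    have z: "F (b, \<tau>) = 0" for b by (rule spinors_outside[OF F insert.hyps(2)])
    then have "f F = 0" by (auto simp: f_def)
    moreover have "F \<in> V" unfolding V_def
    proof (rule spinorsI)
      show "(\<lambda>b. F (b, \<tau>')) \<in> N" if "\<tau>' \<in> insert \<tau> T" for \<tau>'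
        using that z N0 spinorsD[OF F] by (cases "\<tau>' = \<tau>") (auto simp: zero_fun_def)
    qed (use spinors_outside[OF F] in simp)
    ultimately show "F \<in> {v \<in> V. f v \<in> {0}}" by simp
  qed
  moreover have "{f v + u |v u. v \<in> V \<and> u \<in> {0}} = N"
  proof (intro subset_antisym subsetI)
    fix h assume "h \<in> {f v + u |v u. v \<in> V \<and> u \<in> {0}}"
    then obtain v where v: "v \<in> V" "h = f v" by auto
    then show "h \<in> N" unfolding V_def f_def by (simp add: spinors_def)
  next
    fix h assume h: "h \<in> N"
    define F where "F x = (if snd x = \<tau> then h (fst x) else 0)" for x
    have slice: "(\<lambda>b. F (b, \<tau>')) = (if \<tau>' = \<tau> then h else 0)" for \<tau>' by (auto simp: F_def)
    have "F \<in> V" unfolding V_def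
    proof (rule spinorsI)
      show "(\<lambda>b. F (b, \<tau>')) \<in> N" for \<tau>' using h N0 by (simp add: slice)
    qed (simp add: F_def)
    moreover have "h = f F + 0" by (auto simp: f_def F_def)
    ultimately show "h \<in> {f v + u |v u. v \<in> V \<and> u \<in> {0}}" by blast
  qed
  moreover have "fv.dim {0 :: 'a \<Rightarrow> 'b mpol} = 0"
    using fv.dim_le_card[of "{0 :: 'a \<Rightarrow> 'b mpol}" "{}"] by simp
  ultimately show ?case using insert by (simp add: V_def del: smul_apply)
qed

lemma hilbert_series_spinors:
  assumes "finite T" "finite B" "graded_submodule s B N"
  shows "hilbert_series (\<lambda>w. spinors T (N w)) = of_nat (card T) * hilbert_series N"
proof (rule fps_ext)
  fix w
  have "fv.dim (spinors T (N w)) = card T * fv.dim (N w)"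
    using dim_spinors[OF assms(1,2)] graded_submoduleD[OF assms(3)] by blast
  then show "fps_nth (hilbert_series (\<lambda>w. spinors T (N w))) w = fps_nth (of_nat (card T) * hilbert_series N) w"
    by (simp add: hilbert_series_def fps_mult_of_nat_nth)
qed

section \<open>Modules killed by the quadric\<close>

lemma fun_sum_apply: "(\<Sum>x\<in>A. g x) b = (\<Sum>x\<in>A. g x b)" for g :: "_ \<Rightarrow> _ \<Rightarrow> _::comm_monoid_add"
  by (induction A rule: infinite_finite_induct) auto

lemma cst_two: "cst 2 = 2"
  using cst_simps(3)[of 1 1] by simp

definition clifford_action :: "(nat \<Rightarrow> bool list \<Rightarrow> bool list \<Rightarrow> 'a::field) \<Rightarrow> bool list set \<Rightarrow> nat
    \<Rightarrow> ('b \<times> bool list \<Rightarrow> 'a mpol) \<Rightarrow> 'b \<times> bool list \<Rightarrow> 'a mpol" where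
  "clifford_action g T a F = (\<lambda>x. if snd x \<in> T then \<Sum>\<sigma>\<in>T. cst (g a (snd x) \<sigma>) * F (fst x, \<sigma>) else 0)"

definition dirac :: "nat \<Rightarrow> (nat \<Rightarrow> bool list \<Rightarrow> bool list \<Rightarrow> 'a::field) \<Rightarrow> bool list set
    \<Rightarrow> ('b \<times> bool list \<Rightarrow> 'a mpol) \<Rightarrow> 'b \<times> bool list \<Rightarrow> 'a mpol" where
  "dirac s g T F = (\<lambda>x. \<Sum>a<s. indet a * clifford_action g T a F x)"

definition quadric :: "nat \<Rightarrow> 'a::comm_ring_1 mpol" where
  "quadric s = (\<Sum>a<s. indet a * indet a)"

lemma clifford_action_sum: "clifford_action g T a (\<lambda>x. \<Sum>i\<in>I. p i * F i x) x = (\<Sum>i\<in>I. p i * clifford_action g T a (F i) x)"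
proof (cases "snd x \<in> T")
  case True
  have "(\<Sum>\<sigma>\<in>T. cst (g a (snd x) \<sigma>) * (\<Sum>i\<in>I. p i * F i (fst x, \<sigma>)))
      = (\<Sum>\<sigma>\<in>T. \<Sum>i\<in>I. p i * (cst (g a (snd x) \<sigma>) * F i (fst x, \<sigma>)))"
    by (simp add: sum_distrib_left mult.left_commute)
  also have "\<dots> = (\<Sum>i\<in>I. \<Sum>\<sigma>\<in>T. p i * (cst (g a (snd x) \<sigma>) * F i (fst x, \<sigma>)))" by (rule sum.swap)
  finally show ?thesis using True by (simp add: clifford_action_def sum_distrib_left)
qed (simp add: clifford_action_def)

lemma clifford_action_add: "clifford_action g T a (F + G) = clifford_action g T a F + clifford_action g T a G"
  by (auto simp: clifford_action_def fun_eq_iff distrib_left sum.distrib)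

lemma clifford_action_anticommute:
  assumes "clifford_family s p g" "a < s" "b < s" and out: "\<forall>x. snd x \<notin> words p \<longrightarrow> F x = 0"
  shows "clifford_action g (words p) a (clifford_action g (words p) b F) x + clifford_action g (words p) b (clifford_action g (words p) a F) x
    = (if a = b then 2 * F x else 0)"
proof (cases "snd x \<in> words p")
  case True
  obtain u \<tau> where x: "x = (u, \<tau>)" by (cases x)
  then have \<tau>: "\<tau> \<in> words p" using True by simp
  let ?T = "words p"
  have comp: "clifford_action g ?T a (clifford_action g ?T b F) x = (\<Sum>\<sigma>\<in>?T. cst (\<Sum>\<rho>\<in>?T. g a \<tau> \<rho> * g b \<rho> \<sigma>) * F (u, \<sigma>))" for a b
  proof -
    have "clifford_action g ?T a (clifford_action g ?T b F) x = (\<Sum>\<rho>\<in>?T. \<Sum>\<sigma>\<in>?T. cst (g a \<tau> \<rho>) * (cst (g b \<rho> \<sigma>) * F (u, \<sigma>)))"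
      using \<tau> by (simp add: clifford_action_def x sum_distrib_left)
    also have "\<dots> = (\<Sum>\<sigma>\<in>?T. \<Sum>\<rho>\<in>?T. cst (g a \<tau> \<rho>) * (cst (g b \<rho> \<sigma>) * F (u, \<sigma>)))" by (rule sum.swap)
    finally show ?thesis by (simp add: cst_sum sum_distrib_right mult.assoc)
  qed
  have "clifford_action g ?T a (clifford_action g ?T b F) x + clifford_action g ?T b (clifford_action g ?T a F) x
      = (\<Sum>\<sigma>\<in>?T. cst (\<Sum>\<rho>\<in>?T. g a \<tau> \<rho> * g b \<rho> \<sigma> + g b \<tau> \<rho> * g a \<rho> \<sigma>) * F (u, \<sigma>))"
    unfolding comp by (simp add: sum.distrib distrib_right)
  also have "\<dots> = (\<Sum>\<sigma>\<in>?T. if \<tau> = \<sigma> then if a = b then cst 2 * F (u, \<sigma>) else 0 else 0)"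
  proof (rule sum.cong)
    fix \<sigma> assume "\<sigma> \<in> ?T"
    then have "(\<Sum>\<rho>\<in>?T. g a \<tau> \<rho> * g b \<rho> \<sigma> + g b \<tau> \<rho> * g a \<rho> \<sigma>) = (if a = b \<and> \<tau> = \<sigma> then 2 else 0)"
      using assms(1-3) \<tau> unfolding clifford_family_def by blast
    then show "cst (\<Sum>\<rho>\<in>?T. g a \<tau> \<rho> * g b \<rho> \<sigma> + g b \<tau> \<rho> * g a \<rho> \<sigma>) * F (u, \<sigma>)
        = (if \<tau> = \<sigma> then if a = b then cst 2 * F (u, \<sigma>) else 0 else 0)" by simp
  qed simp
  also have "\<dots> = (if a = b then cst 2 * F x else 0)"
    using sum.delta'[OF finite_words[of p], of \<tau> "\<lambda>\<sigma>. if a = b then cst 2 * F (u, \<sigma>) else 0"] \<tau>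
    by (simp only: x if_True)
  also have "cst 2 = (2 :: 'a mpol)" by (rule cst_two)
  finally show ?thesis .
next
  case False
  then show ?thesis using out by (simp add: clifford_action_def del: split_paired_All)
qed

lemma dirac_sum: "dirac s g T (\<lambda>x. \<Sum>i\<in>I. p i * F i x) x = (\<Sum>i\<in>I. p i * dirac s g T (F i) x)"
proof -
  have "dirac s g T (\<lambda>x. \<Sum>i\<in>I. p i * F i x) x = (\<Sum>a<s. \<Sum>i\<in>I. p i * (indet a * clifford_action g T a (F i) x))"
    unfolding dirac_def clifford_action_sum by (simp add: sum_distrib_left mult.left_commute)
  also have "\<dots> = (\<Sum>i\<in>I. \<Sum>a<s. p i * (indet a * clifford_action g T a (F i) x))" by (rule sum.swap)
  finally show ?thesis by (simp add: dirac_def sum_distrib_left)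
qed

lemma dirac_mult: "dirac s g T (\<lambda>x. p * F x) = (\<lambda>x. p * dirac s g T F x)"
  using dirac_sum[of s g T "\<lambda>_. p" "\<lambda>_. F" "{0::nat}"] by auto

lemma dirac_add: "dirac s g T (F + G) = dirac s g T F + dirac s g T G"
  by (auto simp: dirac_def clifford_action_add fun_eq_iff distrib_left sum.distrib)

lemma dirac_smul: "dirac s g T (smul c F) = smul c (dirac s g T F)"
  unfolding smul_def by (rule dirac_mult)

text \<open>
  \<open>\<gamma>\<^sub>c\<close> is a homotopy that shows multiplication by \<open>2 y\<^sub>c\<close> to be zero on the homology of the Dirac
  operator.
\<close>

lemma dirac_clifford_action_anticommute:
  assumes "clifford_family s p g" "c < s" and out: "\<forall>x. snd x \<notin> words p \<longrightarrow> F x = 0"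
  shows "dirac s g (words p) (clifford_action g (words p) c F) x + clifford_action g (words p) c (dirac s g (words p) F) x
    = 2 * (indet c * F x)"
proof -
  let ?T = "words p"
  have "clifford_action g ?T c (dirac s g ?T F) x = (\<Sum>a<s. indet a * clifford_action g ?T c (clifford_action g ?T a F) x)"
    unfolding dirac_def by (rule clifford_action_sum)
  then have "dirac s g ?T (clifford_action g ?T c F) x + clifford_action g ?T c (dirac s g ?T F) x
     = (\<Sum>a<s. indet a * (clifford_action g ?T a (clifford_action g ?T c F) x + clifford_action g ?T c (clifford_action g ?T a F) x))"
    by (simp add: dirac_def sum.distrib distrib_left)
  also have "\<dots> = (\<Sum>a<s. if a = c then indet c * (2 * F x) else 0)"
    using clifford_action_anticommute[OF assms(1) _ assms(2) out] by (intro sum.cong refl) simp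
  also have "\<dots> = 2 * (indet c * F x)" using assms(2) by simp
  finally show ?thesis .
qed

lemma cst_half:
  assumes "(2 :: 'a::field) \<noteq> 0"
  shows "cst (1 / 2 :: 'a) * 2 = 1"
proof -
  have "cst (1 / 2) * cst (2 :: 'a) = cst (1 / 2 * 2)" by (rule cst_simps(4)[symmetric])
  also have "\<dots> = 1" using assms by simp
  also have "cst 2 = (2 :: 'a mpol)" by (rule cst_two)
  finally show ?thesis .
qed

lemma two_cancel:
  assumes "(2 :: 'a::field) \<noteq> 0" "2 * u = 2 * (v :: 'a mpol)"
  shows "u = v"
proof -
  have "u = cst (1 / 2) * 2 * u" unfolding cst_half[OF assms(1)] by simp
  also have "\<dots> = cst (1 / 2) * 2 * v" by (simp only: mult.assoc assms(2))
  also have "\<dots> = v" unfolding cst_half[OF assms(1)] by simp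
  finally show ?thesis .
qed

text \<open>
  Write \<open>D\<^sup>2\<close> both as \<open>\<Sum> y\<^sub>c \<gamma>\<^sub>c D\<close> and as \<open>\<Sum> y\<^sub>c D \<gamma>\<^sub>c\<close>, and add.
\<close>

lemma dirac_dirac:
  fixes F :: "'b \<times> bool list \<Rightarrow> 'a::field mpol"
  assumes "(2 :: 'a) \<noteq> 0" "clifford_family s p g" and out: "\<forall>x. snd x \<notin> words p \<longrightarrow> F x = 0"
  shows "dirac s g (words p) (dirac s g (words p) F) x = quadric s * F x"
proof (rule two_cancel[OF assms(1)])
  let ?T = "words p"
  let ?D = "dirac s g (words p) :: ('b \<times> bool list \<Rightarrow> 'a mpol) \<Rightarrow> _"
  have 1: "?D (?D F) x = (\<Sum>c<s. indet c * clifford_action g ?T c (?D F) x)" by (simp add: dirac_def)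
  have "?D (\<lambda>x. \<Sum>c<s. indet c * clifford_action g ?T c F x) x = (\<Sum>c<s. indet c * ?D (clifford_action g ?T c F) x)"
    by (rule dirac_sum)
  then have 2: "?D (?D F) x = (\<Sum>c<s. indet c * ?D (clifford_action g ?T c F) x)" by (simp flip: dirac_def)
  have "2 * ?D (?D F) x = ?D (?D F) x + ?D (?D F) x" by simp
  also have "\<dots> = (\<Sum>c<s. indet c * ?D (clifford_action g ?T c F) x) + (\<Sum>c<s. indet c * clifford_action g ?T c (?D F) x)"
    using 1 2 by simp
  also have "\<dots> = (\<Sum>c<s. indet c * (?D (clifford_action g ?T c F) x + clifford_action g ?T c (?D F) x))"
    by (simp add: sum.distrib distrib_left)
  also have "\<dots> = (\<Sum>c<s. indet c * (2 * (indet c * F x)))"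
    using dirac_clifford_action_anticommute[OF assms(2) _ out] by (intro sum.cong refl) simp
  also have "\<dots> = 2 * (quadric s * F x)"
    by (simp add: quadric_def sum_distrib_left sum_distrib_right mult_ac)
  finally show "2 * ?D (?D F) x = 2 * (quadric s * F x)" .
qed

lemma clifford_action_in_spinors:
  assumes "fv.subspace N" "F \<in> spinors T N"
  shows "clifford_action g T a F \<in> spinors T N"
proof (rule spinorsI)
  fix \<tau> assume \<tau>: "\<tau> \<in> T"
  have "(\<lambda>b. clifford_action g T a F (b, \<tau>)) = (\<Sum>\<sigma>\<in>T. smul (g a \<tau> \<sigma>) (\<lambda>b. F (b, \<sigma>)))"
    using \<tau> by (auto simp: clifford_action_def fun_eq_iff fun_sum_apply)
  also have "\<dots> \<in> N"
    using spinorsD[OF assms(2)] by (intro fv.subspace_sum[OF assms(1)] fv.subspace_scale[OF assms(1)]) auto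
  finally show "(\<lambda>b. clifford_action g T a F (b, \<tau>)) \<in> N" .
qed (simp add: clifford_action_def)

lemma dirac_in_spinors:
  assumes "graded_submodule s B N" "F \<in> spinors T (N w)"
  shows "dirac s g T F \<in> spinors T (N (Suc w))"
proof -
  note sp = graded_submodule_spinors[OF assms(1), of T]
  have "dirac s g T F = (\<Sum>a<s. (\<lambda>x. indet a * clifford_action g T a F x))"
    by (auto simp: dirac_def fun_eq_iff fun_sum_apply)
  also have "\<dots> \<in> spinors T (N (Suc w))"
  proof (rule fv.subspace_sum[OF graded_submoduleD(1)[OF sp]])
    fix a assume "a \<in> {..<s}"
    then show "(\<lambda>x. indet a * clifford_action g T a F x) \<in> spinors T (N (Suc w))"
      using graded_submoduleD(3)[OF sp] clifford_action_in_spinors[OF graded_submoduleD(1)[OF assms(1)] assms(2)] by auto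
  qed
  finally show ?thesis .
qed

text \<open>
  The module killed by the quadric is \<open>Z / M\<close>, and \<open>D\<close> is a differential on its tensor product with the
  spinors.  Below, \<open>Z'\<close> and \<open>M'\<close> are the preimages of the cycles and of the boundaries in the free
  module.
\<close>

theorem quadric_torsion_congruence:
  fixes M Z :: "nat \<Rightarrow> ('b \<Rightarrow> 'a::field mpol) set"
  assumes two: "(2 :: 'a) \<noteq> 0" and j: "j * j = (-1 :: 'a)" and B: "finite B"
    and Z: "graded_submodule s B Z" and M: "graded_submodule s B M"
    and sub: "\<And>w. M w \<subseteq> Z w"
    and q: "\<And>w f. f \<in> Z w \<Longrightarrow> (\<lambda>b. quadric s * f b) \<in> M (w + 2)"
    and kZ: "value_at_minus_one s (hilbert_series Z) kZ"
    and kM: "value_at_minus_one s (hilbert_series M) kM"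
  shows "2 ^ (s - s div 2) dvd kZ - kM"
proof -
  define p where "p = s div 2"
  define T where "T = words p"
  obtain g :: "nat \<Rightarrow> bool list \<Rightarrow> bool list \<Rightarrow> 'a" where g: "clifford_family s p g"
    using clifford_family_exists[OF j] unfolding p_def by blast
  have T: "finite T" "card T = 2 ^ p" by (simp_all add: T_def finite_words card_words)
  define D where "D = (dirac s g T :: ('b \<times> bool list \<Rightarrow> 'a mpol) \<Rightarrow> _)"
  define SZ where "SZ w = spinors T (Z w)" for w
  define SM where "SM w = spinors T (M w)" for w
  define Z' where "Z' w = {F \<in> SZ w. D F \<in> SM (Suc w)}" for w
  define M' where "M' w = (case w of 0 \<Rightarrow> SM 0 | Suc v \<Rightarrow> {D F + G |F G. F \<in> SZ v \<and> G \<in> SM (Suc v)})" for w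
  have BT: "finite (B \<times> T)" using B T by simp
  have gSZ: "graded_submodule s (B \<times> T) SZ" and gSM: "graded_submodule s (B \<times> T) SM"
    unfolding SZ_def SM_def using graded_submodule_spinors Z M by blast+
  have subS: "SM w \<subseteq> SZ w" for w using sub unfolding SM_def SZ_def spinors_def by blast
  have D_SZ: "D F \<in> SZ (Suc w)" if "F \<in> SZ w" for F w
    using that unfolding D_def SZ_def by (rule dirac_in_spinors[OF Z])
  have D_SM: "D F \<in> SM (Suc w)" if "F \<in> SM w" for F w
    using that unfolding D_def SM_def by (rule dirac_in_spinors[OF M])
  have DD: "D (D F) \<in> SM (w + 2)" if F: "F \<in> SZ w" for F w
  proof -
    have "\<forall>x. snd x \<notin> words p \<longrightarrow> F x = 0"
      using F spinors_outside[of F T "Z w"] unfolding SZ_def T_def by simp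
    then have "D (D F) = (\<lambda>x. quadric s * F x)"
      unfolding D_def T_def by (intro ext dirac_dirac[OF two g])
    also have "\<dots> \<in> SM (w + 2)" using F q unfolding SM_def SZ_def by (auto simp: spinors_def)
    finally show ?thesis .
  qed
  have D_add: "D (F + G) = D F + D G" and D_smul: "D (smul c F) = smul c (D F)"
    and D_indet: "D (\<lambda>x. indet a * F x) = (\<lambda>x. indet a * D F x)" for F G c a
    unfolding D_def by (rule dirac_add, rule dirac_smul, rule dirac_mult)
  have D_0: "D 0 = 0" using D_smul[of 0 0] by (simp add: fun_eq_iff)
  have "fv.subspace (Z' w)" for w
    unfolding Z'_def fv.subspace_def
    using graded_submoduleD(1)[OF gSZ, of w] graded_submoduleD(1)[OF gSM, of "Suc w"]
    by (auto simp: D_add D_smul D_0 fv.subspace_0 fv.subspace_add fv.subspace_scale simp del: smul_apply)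
  then have gZ': "graded_submodule s (B \<times> T) Z'"
    unfolding graded_submodule_def
    using graded_submoduleD(2)[OF gSZ] graded_submoduleD(3)[OF gSZ] graded_submoduleD(3)[OF gSM]
    by (auto simp: Z'_def D_indet)
  have M'_sub: "fv.subspace (M' w)" for w
  proof (cases w)
    case 0
    then show ?thesis using graded_submoduleD(1)[OF gSM] by (simp add: M'_def)
  next
    case (Suc v)
    have DS: "fv.subspace (D ` SZ v)"
      unfolding fv.subspace_def
    proof (intro conjI ballI allI)
      show "0 \<in> D ` SZ v" using D_0 fv.subspace_0[OF graded_submoduleD(1)[OF gSZ]] by (metis image_eqI)
    next
      fix x y assume "x \<in> D ` SZ v" "y \<in> D ` SZ v"
      then show "x + y \<in> D ` SZ v"
        using fv.subspace_add[OF graded_submoduleD(1)[OF gSZ]] by (auto simp: D_add[symmetric])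
    next
      fix c x assume "x \<in> D ` SZ v"
      then show "smul c x \<in> D ` SZ v"
        using fv.subspace_scale[OF graded_submoduleD(1)[OF gSZ]] by (auto simp: D_smul[symmetric] simp del: smul_apply)
    qed
    have "M' w = {x + y |x y. x \<in> D ` SZ v \<and> y \<in> SM (Suc v)}" unfolding M'_def Suc by auto
    then show ?thesis using fv.subspace_sums[OF DS graded_submoduleD(1)[OF gSM, of "Suc v"]] by (simp only:)
  qed
  have SM_M': "SM w \<subseteq> M' w" for w
  proof (cases w)
    case (Suc v)
    show ?thesis
    proof
      fix G assume "G \<in> SM w"
      moreover have "G = D 0 + G" "0 \<in> SZ v" using D_0 fv.subspace_0[OF graded_submoduleD(1)[OF gSZ]] by auto
      ultimately show "G \<in> M' w" unfolding M'_def Suc nat.case by blast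
    qed
  qed (simp add: M'_def)
  have M'_SZ: "M' w \<subseteq> SZ w" for w
  proof (cases w)
    case 0
    then show ?thesis using subS by (simp add: M'_def)
  next
    case (Suc v)
    have "D F + G \<in> SZ (Suc v)" if "F \<in> SZ v" "G \<in> SM (Suc v)" for F G
      using fv.subspace_add[OF graded_submoduleD(1)[OF gSZ] D_SZ[OF that(1)] subsetD[OF subS that(2)]] .
    then show ?thesis unfolding M'_def Suc nat.case by blast
  qed
  have "(\<lambda>x. indet a * F x) \<in> M' (Suc w)" if F: "F \<in> M' w" and a: "a < s" for F a w
  proof (cases w)
    case 0
    then show ?thesis
      using F a SM_M'[of "Suc w"] graded_submoduleD(3)[OF gSM, of F w a] by (auto simp: M'_def)
  next
    case (Suc v)
    then obtain E G where EG: "F = D E + G" "E \<in> SZ v" "G \<in> SM (Suc v)" using F by (auto simp: M'_def)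
    have "(\<lambda>x. indet a * F x) = D (\<lambda>x. indet a * E x) + (\<lambda>x. indet a * G x)"
      unfolding D_indet EG(1) by (auto simp: distrib_left)
    moreover have "(\<lambda>x. indet a * E x) \<in> SZ (Suc v)" "(\<lambda>x. indet a * G x) \<in> SM (Suc (Suc v))"
      using graded_submoduleD(3)[OF gSZ EG(2) a] graded_submoduleD(3)[OF gSM EG(3) a] .
    ultimately show ?thesis unfolding M'_def Suc nat.case by blast
  qed
  then have gM': "graded_submodule s (B \<times> T) M'"
    unfolding graded_submodule_def using M'_sub M'_SZ graded_submoduleD(2)[OF gSZ] by blast
  have M'_Z': "M' w \<subseteq> Z' w" for w
  proof
    fix F assume F: "F \<in> M' w"
    have "D F \<in> SM (Suc w)"
    proof (cases w)
      case 0
      then show ?thesis using F D_SM by (simp add: M'_def)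
    next
      case (Suc v)
      then obtain E G where EG: "F = D E + G" "E \<in> SZ v" "G \<in> SM (Suc v)" using F by (auto simp: M'_def)
      have "D F = D (D E) + D G" unfolding EG(1) by (rule D_add)
      moreover have "D (D E) \<in> SM (Suc (Suc v))" using DD[OF EG(2)] by simp
      moreover have "D G \<in> SM (Suc (Suc v))" using D_SM[OF EG(3)] .
      ultimately show ?thesis using fv.subspace_add[OF graded_submoduleD(1)[OF gSM]] Suc by simp
    qed
    then show "F \<in> Z' w" using F M'_SZ by (auto simp: Z'_def)
  qed
  \<comment> \<open>every variable maps cycles to boundaries, so the homology is finite-dimensional\<close>
  have indet_Z': "(\<lambda>x. indet a * F x) \<in> M' (Suc w)" if F: "F \<in> Z' w" and a: "a < s" for F a w
  proof -
    have FZ: "F \<in> SZ w" and DF: "D F \<in> SM (Suc w)" using F by (auto simp: Z'_def)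
    have h: "cst (1 / 2) * (2 :: 'a mpol) = 1" by (rule cst_half[OF two])
    have out: "\<forall>x. snd x \<notin> words p \<longrightarrow> F x = 0"
      using FZ spinors_outside[of F T "Z w"] unfolding SZ_def T_def by simp
    have "indet a * F x = (D (smul (1/2) (clifford_action g T a F)) + smul (1/2) (clifford_action g T a (D F))) x" for x
    proof -
      have "indet a * F x = (cst (1 / 2) * 2) * (indet a * F x)" using h by simp
      also have "\<dots> = cst (1 / 2) * (D (clifford_action g T a F) x + clifford_action g T a (D F) x)"
        using dirac_clifford_action_anticommute[OF g a out, of x] by (simp add: D_def T_def mult.assoc)
      finally show ?thesis by (simp add: D_smul distrib_left)
    qed
    then have "(\<lambda>x. indet a * F x) = D (smul (1/2) (clifford_action g T a F)) + smul (1/2) (clifford_action g T a (D F))" by auto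
    moreover have "smul (1/2) (clifford_action g T a F) \<in> SZ w"
      using FZ unfolding SZ_def
      by (intro fv.subspace_scale subspace_spinors clifford_action_in_spinors graded_submoduleD(1)[OF Z])
    moreover have "smul (1/2) (clifford_action g T a (D F)) \<in> SM (Suc w)"
      using DF unfolding SM_def
      by (intro fv.subspace_scale subspace_spinors clifford_action_in_spinors graded_submoduleD(1)[OF M])
    ultimately show ?thesis unfolding M'_def nat.case by blast
  qed
  obtain w0 where w0: "\<forall>w>w0. fv.dim (Z' w) = fv.dim (M' w)"
    using dim_eventually_eq[OF BT gZ' gM' M'_Z' indet_Z'] by auto
  have "\<exists>x. value_at_minus_one s (hilbert_series Z' - hilbert_series M') (2 ^ s * x)"
    by (rule value_at_minus_one_finite_support[of "Suc w0"]) (use w0 in \<open>auto simp: hilbert_series_def\<close>)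
  then obtain x where x: "value_at_minus_one s (hilbert_series Z' - hilbert_series M') (2 ^ s * x)" by blast
  have dims: "fv.dim (SZ w) + fv.dim (SM (Suc w)) = fv.dim (Z' w) + fv.dim (M' (Suc w))" for w
    unfolding Z'_def M'_def nat.case
    by (rule dim_preimage_plus_dim_sum_image_homogeneous[OF BT BT D_add D_smul])
      (rule graded_submoduleD[OF gSZ] graded_submoduleD[OF gSM])+
  \<comment> \<open>\<open>D\<close> induces an isomorphism of degree one from chains modulo cycles onto boundaries\<close>
  have shift: "hilbert_series M' - hilbert_series SM = fps_X * (hilbert_series SZ - hilbert_series Z')"
  proof (rule fps_ext)
    fix w show "fps_nth (hilbert_series M' - hilbert_series SM) w
        = fps_nth (fps_X * (hilbert_series SZ - hilbert_series Z')) w"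
      using dims[of "w - 1"] by (cases w) (auto simp: hilbert_series_def M'_def)
  qed
  obtain kSZ kZ' where k: "value_at_minus_one s (hilbert_series SZ) kSZ" "value_at_minus_one s (hilbert_series Z') kZ'"
    using hilbert_series_rational[OF BT gSZ] hilbert_series_rational[OF BT gZ'] by blast
  have diff: "value_at_minus_one s (hilbert_series SZ - hilbert_series Z') (kSZ - kZ')"
    using k by (rule value_at_minus_one_diff)
  have "value_at_minus_one s (hilbert_series SZ - hilbert_series SM) (2 ^ s * x)"
  proof -
    have eq: "hilbert_series SZ - hilbert_series SM = (hilbert_series SZ - hilbert_series Z')
        + ((hilbert_series Z' - hilbert_series M') + fps_X * (hilbert_series SZ - hilbert_series Z'))"
      unfolding shift[symmetric] by simp
    have "value_at_minus_one s (hilbert_series SZ - hilbert_series SM)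
        ((kSZ - kZ') + (2 ^ s * x + - (kSZ - kZ')))"
      unfolding eq by (intro value_at_minus_one_add diff x value_at_minus_one_shift)
    moreover have "(kSZ - kZ') + (2 ^ s * x + - (kSZ - kZ')) = 2 ^ s * x" by simp
    ultimately show ?thesis by (simp only:)
  qed
  moreover have "hilbert_series SZ - hilbert_series SM = of_nat (2 ^ p) * (hilbert_series Z - hilbert_series M)"
    using hilbert_series_spinors[OF T(1) B Z] hilbert_series_spinors[OF T(1) B M] T(2)
    unfolding SZ_def SM_def by (simp add: right_diff_distrib)
  moreover have "value_at_minus_one s (of_nat (2 ^ p) * (hilbert_series Z - hilbert_series M)) (of_nat (2 ^ p) * (kZ - kM))"
    by (intro value_at_minus_one_of_nat_mult value_at_minus_one_diff kZ kM)
  ultimately have "2 ^ s * x = of_nat (2 ^ p) * (kZ - kM)" using value_at_minus_one_unique by metis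
  moreover have "(2 :: int) ^ s = 2 ^ p * 2 ^ (s - p)" by (simp add: p_def flip: power_add)
  ultimately have "kZ - kM = 2 ^ (s - p) * x" by (simp add: mult.assoc)
  then show ?thesis by (simp add: p_def)
qed

section \<open>The exterior algebra\<close>

definition sgn_at :: "nat \<Rightarrow> nat set \<Rightarrow> 'r::comm_ring_1" where
  "sgn_at i S = (-1) ^ card {j \<in> S. j < i}"

text \<open>
  Functions on finite sets of naturals stand for elements of an exterior algebra: \<open>f S\<close> is the
  coefficient of the increasing wedge product of the basis vectors indexed by \<open>S\<close>.
\<close>

definition contract :: "nat \<Rightarrow> (nat set \<Rightarrow> 'r::comm_ring_1) \<Rightarrow> nat set \<Rightarrow> 'r" where
  "contract i f = (\<lambda>S. if i \<notin> S then sgn_at i S * f (insert i S) else 0)"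

definition wedge :: "nat \<Rightarrow> (nat set \<Rightarrow> 'r::comm_ring_1) \<Rightarrow> nat set \<Rightarrow> 'r" where
  "wedge i f = (\<lambda>S. if i \<in> S then sgn_at i S * f (S - {i}) else 0)"

lemma sgn_at_square: "sgn_at i S * sgn_at i S = (1 :: 'r::comm_ring_1)"
  by (simp add: sgn_at_def flip: power_mult_distrib)

lemma sgn_at_insert:
  assumes "j \<notin> S"
  shows "sgn_at i (insert j S) = (if j < i then - sgn_at i S else (sgn_at i S :: 'r::comm_ring_1))"
proof (cases "j < i")
  case True
  then have "{x \<in> insert j S. x < i} = insert j {x \<in> S. x < i}" by auto
  moreover have "finite {x \<in> S. x < i}" by simp
  ultimately show ?thesis using True assms by (simp add: sgn_at_def)
next
  case False
  then have "{x \<in> insert j S. x < i} = {x \<in> S. x < i}" by auto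
  then show ?thesis using False by (simp add: sgn_at_def)
qed

lemma sgn_at_remove:
  assumes "j \<in> S"
  shows "sgn_at i (S - {j}) = (if j < i then - sgn_at i S else (sgn_at i S :: 'r::comm_ring_1))"
  using sgn_at_insert[of j "S - {j}" i, where 'r = 'r] assms by (auto simp: insert_absorb)

lemma contract_contract: "contract i (contract j f) S = - contract j (contract i f) S"
proof (cases "i = j \<or> i \<in> S \<or> j \<in> S")
  case False
  then show ?thesis
    by (auto simp: contract_def sgn_at_insert insert_commute[of i j] mult_ac)
qed (auto simp: contract_def)

text \<open>
  The canonical anticommutation relation between interior and exterior multiplication.
\<close>

lemma contract_wedge: "contract i (wedge j f) S + wedge j (contract i f) S = (if i = j then f S else 0)"
proof (cases "i = j")
  case True
  then show ?thesis
    by (auto simp: contract_def wedge_def sgn_at_insert sgn_at_remove insert_absorb mult.assoc[symmetric] sgn_at_square)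
next
  case False
  show ?thesis
  proof (cases "i \<notin> S \<and> j \<in> S")
    case True
    have "insert i S - {j} = insert i (S - {j})" using False by auto
    then show ?thesis using True False
      by (auto simp: contract_def wedge_def sgn_at_insert sgn_at_remove mult_ac)
  qed (use False in \<open>auto simp: contract_def wedge_def\<close>)
qed

definition contract_vec :: "nat \<Rightarrow> (nat \<Rightarrow> 'r::comm_ring_1) \<Rightarrow> (nat set \<Rightarrow> 'r) \<Rightarrow> nat set \<Rightarrow> 'r" where
  "contract_vec n v f = (\<lambda>S. \<Sum>i<n. v i * contract i f S)"

definition wedge_vec :: "nat \<Rightarrow> (nat \<Rightarrow> 'r::comm_ring_1) \<Rightarrow> (nat set \<Rightarrow> 'r) \<Rightarrow> nat set \<Rightarrow> 'r" where
  "wedge_vec n v f = (\<lambda>S. \<Sum>i<n. v i * wedge i f S)"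

lemma contract_sum: "contract i (\<lambda>S. \<Sum>j\<in>J. p j * F j S) S = (\<Sum>j\<in>J. p j * contract i (F j) S)"
  by (simp add: contract_def sum_distrib_left mult_ac)

lemma wedge_sum: "wedge i (\<lambda>S. \<Sum>j\<in>J. p j * F j S) S = (\<Sum>j\<in>J. p j * wedge i (F j) S)"
  by (simp add: wedge_def sum_distrib_left mult_ac)

lemma contract_vec_anticommute:
  "contract_vec n u (contract_vec n v f) S = - contract_vec n v (contract_vec n u f) S"
proof -
  have dbl: "contract_vec n u (contract_vec n v f) S = (\<Sum>i<n. \<Sum>j<n. u i * (v j * contract i (contract j f) S))"
    for u v by (simp add: contract_vec_def contract_sum sum_distrib_left)
  have "contract_vec n u (contract_vec n v f) S = (\<Sum>j<n. \<Sum>i<n. u i * (v j * contract i (contract j f) S))"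
    unfolding dbl by (rule sum.swap)
  also have "\<dots> = (\<Sum>j<n. \<Sum>i<n. - (v j * (u i * contract j (contract i f) S)))"
  proof (intro sum.cong refl)
    fix i j
    show "u i * (v j * contract i (contract j f) S) = - (v j * (u i * contract j (contract i f) S))"
      by (subst contract_contract) (simp add: mult_ac)
  qed
  also have "\<dots> = - contract_vec n v (contract_vec n u f) S"
    unfolding dbl by (simp add: sum_negf)
  finally show ?thesis .
qed

lemma contract_wedge_vec:
  "contract_vec n u (wedge_vec n v f) S + wedge_vec n v (contract_vec n u f) S = (\<Sum>i<n. u i * v i) * f S"
proof -
  have 1: "contract_vec n u (wedge_vec n v f) S = (\<Sum>i<n. \<Sum>j<n. u i * v j * contract i (wedge j f) S)"
    by (simp add: contract_vec_def wedge_vec_def contract_sum sum_distrib_left mult.assoc)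
  have "wedge_vec n v (contract_vec n u f) S = (\<Sum>j<n. \<Sum>i<n. u i * v j * wedge j (contract i f) S)"
    by (simp add: contract_vec_def wedge_vec_def wedge_sum sum_distrib_left mult_ac)
  also have "\<dots> = (\<Sum>i<n. \<Sum>j<n. u i * v j * wedge j (contract i f) S)" by (rule sum.swap)
  finally have "contract_vec n u (wedge_vec n v f) S + wedge_vec n v (contract_vec n u f) S
      = (\<Sum>i<n. \<Sum>j<n. u i * v j * (contract i (wedge j f) S + wedge j (contract i f) S))"
    by (simp add: 1 sum.distrib distrib_left)
  also have "\<dots> = (\<Sum>i<n. \<Sum>j<n. if i = j then u i * v i * f S else 0)"
    unfolding contract_wedge by (intro sum.cong refl) simp
  also have "\<dots> = (\<Sum>i<n. u i * v i * f S)" by (intro sum.cong refl) simp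
  finally show ?thesis by (simp add: sum_distrib_right)
qed

lemma contract_vec_add: "contract_vec n v (f + g) = contract_vec n v f + contract_vec n v g"
  by (auto simp: contract_vec_def contract_def fun_eq_iff distrib_left sum.distrib[symmetric] intro!: sum.cong)

lemma contract_vec_mult: "contract_vec n v (\<lambda>S. p * f S) = (\<lambda>S. p * contract_vec n v f S)"
  by (auto simp: contract_vec_def contract_def fun_eq_iff sum_distrib_left mult_ac intro!: sum.cong)

lemma contract_vec_smul: "contract_vec n v (smul c f) = smul c (contract_vec n v f)"
  unfolding smul_def by (rule contract_vec_mult)

lemma contract_vec_0 [simp]: "contract_vec n v 0 = 0"
  by (auto simp: contract_vec_def contract_def fun_eq_iff cong: if_cong)

lemma wedge_vec_0 [simp]: "wedge_vec n v 0 = 0"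
  by (auto simp: wedge_vec_def wedge_def fun_eq_iff cong: if_cong)

definition subsets_of_card :: "nat \<Rightarrow> nat \<Rightarrow> nat set set" where
  "subsets_of_card n k = {S. S \<subseteq> {..<n} \<and> card S = k}"

lemma finite_subsets_of_card: "finite (subsets_of_card n k)"
  and card_subsets_of_card: "card (subsets_of_card n k) = n choose k"
  using n_subsets[of "{..<n}" k] by (simp_all add: subsets_of_card_def)

definition linear_form :: "nat \<Rightarrow> 'a::field mpol \<Rightarrow> bool" where
  "linear_form s l \<longleftrightarrow> (\<exists>c. l = (\<Sum>a<s. cst (c a) * indet a))"

lemma linear_form_mult_homogeneous:
  assumes "linear_form s l" "f \<in> homogeneous s B w"
  shows "(\<lambda>b. l * f b) \<in> homogeneous s B (Suc w)"
proof -
  obtain c where "l = (\<Sum>a<s. cst (c a) * indet a)" using assms(1) by (auto simp: linear_form_def)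
  then have "(\<lambda>b. l * f b) = (\<Sum>a<s. smul (c a) (\<lambda>b. indet a * f b))"
    by (auto simp: fun_eq_iff fun_sum_apply sum_distrib_right mult.assoc)
  also have "\<dots> \<in> homogeneous s B (Suc w)"
    using homogeneous_indet[OF assms(2)]
    by (intro fv.subspace_sum[OF subspace_homogeneous] fv.subspace_scale[OF subspace_homogeneous]) auto
  finally show ?thesis .
qed

text \<open>
  Contraction and exterior multiplication by a basis vector only permute coefficients up to sign.
\<close>

lemma homogeneous_reindex:
  assumes f: "f \<in> homogeneous s B w" and g: "\<And>x. g x \<noteq> 0 \<Longrightarrow> x \<in> B' \<and> (g x = f (h x) \<or> g x = - f (h x))"
  shows "g \<in> homogeneous s B' w"
proof (rule homogeneousI)
  fix x \<alpha> assume nz: "lookup (g x) \<alpha> \<noteq> 0"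
  then have "g x \<noteq> 0" by auto
  note gx = g[OF this]
  then have "lookup (f (h x)) \<alpha> \<noteq> 0" using nz by auto
  then show "x \<in> B' \<and> \<alpha> \<in> monomials s w" using homogeneousD[OF f] gx by blast
qed

lemma sgn_at_cases: "sgn_at i S = (1 :: 'r::comm_ring_1) \<or> sgn_at i S = (-1 :: 'r)"
  by (cases "even (card {j \<in> S. j < i})") (auto simp: sgn_at_def)

lemma contract_homogeneous:
  assumes "f \<in> homogeneous s (subsets_of_card n (Suc k)) w"
  shows "contract i f \<in> homogeneous s (subsets_of_card n k) w"
proof (rule homogeneous_reindex[OF assms, where h = "insert i"])
  fix S assume nz: "contract i f S \<noteq> 0"
  then have "i \<notin> S" "f (insert i S) \<noteq> 0" by (auto simp: contract_def split: if_splits)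
  then have "insert i S \<in> subsets_of_card n (Suc k)" using homogeneous_outside[OF assms] by metis
  then have "S \<in> subsets_of_card n k" using \<open>i \<notin> S\<close> finite_subset[of S "{..<n}"]
    by (auto simp: subsets_of_card_def)
  moreover have "contract i f S = f (insert i S) \<or> contract i f S = - f (insert i S)"
    using \<open>i \<notin> S\<close> sgn_at_cases[of i S] by (auto simp: contract_def)
  ultimately show "S \<in> subsets_of_card n k \<and> (contract i f S = f (insert i S) \<or> contract i f S = - f (insert i S))"
    by blast
qed

lemma wedge_homogeneous:
  assumes "f \<in> homogeneous s (subsets_of_card n k) w" "i < n"
  shows "wedge i f \<in> homogeneous s (subsets_of_card n (Suc k)) w"
proof (rule homogeneous_reindex[OF assms(1), where h = "\<lambda>S. S - {i}"])
  fix S assume nz: "wedge i f S \<noteq> 0"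
  then have "i \<in> S" "f (S - {i}) \<noteq> 0" by (auto simp: wedge_def split: if_splits)
  then have 1: "S - {i} \<in> subsets_of_card n k" using homogeneous_outside[OF assms(1)] by metis
  then have "finite S" using finite_subset[of "S - {i}" "{..<n}"] by (auto simp: subsets_of_card_def)
  then have "card S = Suc (card (S - {i}))" using \<open>i \<in> S\<close> card_Suc_Diff1 by metis
  then have "S \<in> subsets_of_card n (Suc k)" using 1 assms(2) by (auto simp: subsets_of_card_def)
  moreover have "wedge i f S = f (S - {i}) \<or> wedge i f S = - f (S - {i})"
    using \<open>i \<in> S\<close> sgn_at_cases[of i S] by (auto simp: wedge_def)
  ultimately show "S \<in> subsets_of_card n (Suc k) \<and> (wedge i f S = f (S - {i}) \<or> wedge i f S = - f (S - {i}))"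
    by blast
qed

lemma contract_vec_homogeneous:
  assumes "\<And>i. i < n \<Longrightarrow> linear_form s (v i)" "f \<in> homogeneous s (subsets_of_card n (Suc k)) w"
  shows "contract_vec n v f \<in> homogeneous s (subsets_of_card n k) (Suc w)"
proof -
  have "contract_vec n v f = (\<Sum>i<n. (\<lambda>S. v i * contract i f S))"
    by (auto simp: contract_vec_def fun_eq_iff fun_sum_apply)
  also have "\<dots> \<in> homogeneous s (subsets_of_card n k) (Suc w)"
    by (intro fv.subspace_sum[OF subspace_homogeneous] linear_form_mult_homogeneous assms(1)
        contract_homogeneous assms(2)) simp
  finally show ?thesis .
qed

lemma wedge_vec_homogeneous:
  assumes "\<And>i. i < n \<Longrightarrow> linear_form s (v i)" "f \<in> homogeneous s (subsets_of_card n k) w"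
  shows "wedge_vec n v f \<in> homogeneous s (subsets_of_card n (Suc k)) (Suc w)"
proof -
  have "wedge_vec n v f = (\<Sum>i<n. (\<lambda>S. v i * wedge i f S))"
    by (auto simp: wedge_vec_def fun_eq_iff fun_sum_apply)
  also have "\<dots> \<in> homogeneous s (subsets_of_card n (Suc k)) (Suc w)"
    by (intro fv.subspace_sum[OF subspace_homogeneous] linear_form_mult_homogeneous assms(1)
        wedge_homogeneous assms(2)) simp_all
  finally show ?thesis .
qed

lemma contract_vec_degree_zero:
  assumes "f \<in> homogeneous s (subsets_of_card n 0) w"
  shows "contract_vec n v f = 0"
proof -
  have "f (insert i S) = 0" for i S
  proof (rule homogeneous_outside[OF assms])
    show "insert i S \<notin> subsets_of_card n 0"
    proof
      assume "insert i S \<in> subsets_of_card n 0"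
      then have sub: "insert i S \<subseteq> {..<n}" and card: "card (insert i S) = 0"
        unfolding subsets_of_card_def by blast+
      have "finite (insert i S)" by (rule finite_subset[OF sub]) simp
      then show False using card by (simp only: card_eq_0_iff) blast
    qed
  qed
  then show ?thesis by (auto simp: contract_vec_def contract_def fun_eq_iff cong: if_cong)
qed

section \<open>Exterior powers of the orthogonal complement\<close>

lemma quadric_nonzero:
  assumes "s \<ge> 1"
  shows "quadric s \<noteq> (0 :: 'a::field mpol)"
proof
  assume 0: "quadric s = (0 :: 'a mpol)"
  let ?m = "Poly_Mapping.single (0::nat) (2::nat)"
  have "lookup (indet a * indet a :: 'a mpol) ?m = (if a = 0 then 1 else 0)" for a
  proof -
    have "(indet a * indet a :: 'a mpol) = Poly_Mapping.single (Poly_Mapping.single a 2) 1"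
      by (simp add: indet_def mult_single numeral_2_eq_2 flip: single_add)
    moreover have "Poly_Mapping.single a (2::nat) = ?m \<longleftrightarrow> a = 0"
      by (metis keys_single singleton_inject zero_neq_numeral)
    ultimately show ?thesis by (auto simp: lookup_single when_def)
  qed
  then have "lookup (quadric s :: 'a mpol) ?m = (\<Sum>a<s. if a = 0 then 1 else 0)"
    by (simp add: quadric_def lookup_sum)
  also have "\<dots> = 1" using assms by simp
  finally show False using 0 by simp
qed

lemma hilbert_series_homogeneous:
  fixes B :: "'b set"
  assumes "finite B"
  shows "value_at_minus_one s (hilbert_series (\<lambda>w. homogeneous s B w :: ('b \<Rightarrow> 'a::field mpol) set)) (int (card B))"
proof -
  define m where "m = card B"
  obtain e where e: "bij_betw e {..<m} B" unfolding m_def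
    using ex_bij_betw_nat_finite[OF assms(1)] by (auto simp: atLeast0LessThan)
  have "fv.dim (homogeneous s B w :: ('b \<Rightarrow> 'a mpol) set) = m * card (monomials s w)" for w
  proof -
    have "leading e m s w (homogeneous s B w :: ('b \<Rightarrow> 'a mpol) set) = {..<m} \<times> monomials s w"
    proof (intro subset_antisym subsetI)
      fix x assume x: "x \<in> {..<m} \<times> monomials s w"
      define f where "f = (unit_monomial (e (fst x), snd x) :: 'b \<Rightarrow> 'a mpol)"
      have "e (fst x) \<in> B" using x e by (auto simp: bij_betw_def)
      then have "f \<in> homogeneous s B w" using x unfolding f_def
        by (intro homogeneousI) (auto simp: unit_monomial_def lookup_single when_def split: if_splits)
      moreover have "lookup (f (e (fst x))) (snd x) \<noteq> 0" by (simp add: f_def unit_monomial_def)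
      moreover have "lookup (f (e (fst y))) (snd y) = 0" if "y \<in> {..<m} \<times> monomials s w" "x < y" for y
      proof -
        have "e (fst y) \<noteq> e (fst x) \<or> snd y \<noteq> snd x"
        proof (rule ccontr)
          assume "\<not> ?thesis"
          then have "e (fst y) = e (fst x)" "snd y = snd x" by auto
          then have "x = y" using x that(1) bij_betw_imp_inj_on[OF e] by (auto simp: inj_on_def prod_eq_iff)
          then show False using that(2) by simp
        qed
        then show ?thesis by (auto simp: f_def unit_monomial_def lookup_single when_def)
      qed
      ultimately show "x \<in> leading e m s w (homogeneous s B w :: ('b \<Rightarrow> 'a mpol) set)"
        unfolding leading_def mem_Collect_eq using x by blast
    qed (auto simp: leading_def)
    then show ?thesis
      using dim_eq_card_leading[OF e, where N = "homogeneous s B w :: ('b \<Rightarrow> 'a mpol) set" and s = s and w = w]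
      by (simp add: subspace_homogeneous card_cartesian_product)
  qed
  moreover have "{\<alpha>. keys \<alpha> \<subseteq> {..<s}} \<inter> monomials s w = monomials s w" for w by (auto simp: monomials_def)
  ultimately have "hilbert_series (\<lambda>w. homogeneous s B w :: ('b \<Rightarrow> 'a mpol) set)
      = of_nat m * count_fps s {\<alpha>. keys \<alpha> \<subseteq> {..<s}}"
    by (intro fps_ext) (simp add: hilbert_series_def count_fps_def fps_mult_of_nat_nth)
  then show ?thesis
    using value_at_minus_one_of_nat_mult[OF value_at_minus_one_all_monomials[of s], of m] by (simp add: m_def)
qed

text \<open>
  For orthogonal vectors of square length the quadric and after the quadric is inverted, this is the
  \<open>k\<close>-th exterior power of the orthogonal complement of the first \<open>c\<close> vectors.
\<close>

definition common_kernel ::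
    "nat \<Rightarrow> nat \<Rightarrow> (nat \<Rightarrow> nat \<Rightarrow> 'a::field mpol) \<Rightarrow> nat \<Rightarrow> nat \<Rightarrow> nat \<Rightarrow> (nat set \<Rightarrow> 'a mpol) set" where
  "common_kernel s n m c k w =
     {f \<in> homogeneous s (subsets_of_card n k) w. \<forall>d<c. contract_vec n (m d) f = 0}"

lemma graded_submodule_common_kernel:
  "graded_submodule s (subsets_of_card n k) (common_kernel s n m c k)"
proof -
  have "fv.subspace (common_kernel s n m c k w)" for w
  proof (rule fv.subspaceI)
    show "0 \<in> common_kernel s n m c k w"
      using fv.subspace_0[OF subspace_homogeneous] by (simp add: common_kernel_def)
  next
    fix f g assume "f \<in> common_kernel s n m c k w" "g \<in> common_kernel s n m c k w"
    then show "f + g \<in> common_kernel s n m c k w"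
      using fv.subspace_add[OF subspace_homogeneous, of f s "subsets_of_card n k" w g]
      by (auto simp: common_kernel_def contract_vec_add)
  next
    fix a f assume "f \<in> common_kernel s n m c k w"
    then show "smul a f \<in> common_kernel s n m c k w"
      using fv.subspace_scale[OF subspace_homogeneous, of f s "subsets_of_card n k" w a]
      by (auto simp: common_kernel_def contract_vec_smul fv.scale_zero_right simp del: smul_apply)
  qed
  moreover have "(\<lambda>S. indet a * f S) \<in> common_kernel s n m c k (Suc w)"
    if "f \<in> common_kernel s n m c k w" "a < s" for a f w
    using that homogeneous_indet[of f s "subsets_of_card n k" w a]
    by (auto simp: common_kernel_def contract_vec_mult zero_fun_def)
  ultimately show ?thesis unfolding graded_submodule_def by (auto simp: common_kernel_def)
qed

locale orthogonal_frame =
  fixes s n r :: nat and m :: "nat \<Rightarrow> nat \<Rightarrow> 'a::field mpol" and j :: 'a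
  assumes two: "(2 :: 'a) \<noteq> 0" and j: "j * j = -1" and s: "s \<ge> 1"
    and linear: "\<And>c i. c < r \<Longrightarrow> i < n \<Longrightarrow> linear_form s (m c i)"
    and orthogonal: "\<And>c d. c < r \<Longrightarrow> d < r \<Longrightarrow> (\<Sum>i<n. m c i * m d i) = (if c = d then quadric s else 0)"
begin

abbreviation K :: "nat \<Rightarrow> nat \<Rightarrow> nat \<Rightarrow> (nat set \<Rightarrow> 'a mpol) set" where
  "K \<equiv> common_kernel s n m"

text \<open>
  By orthogonality, exterior multiplication by \<open>m\<^sub>c\<close> anticommutes with the earlier contractions.
\<close>

lemma wedge_in_kernel:
  assumes "c < r" "f \<in> K c k w"
  shows "wedge_vec n (m c) f \<in> K c (Suc k) (Suc w)"
proof -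
  have f: "f \<in> homogeneous s (subsets_of_card n k) w" "\<And>d. d < c \<Longrightarrow> contract_vec n (m d) f = 0"
    using assms(2) by (auto simp: common_kernel_def)
  have "contract_vec n (m d) (wedge_vec n (m c) f) = 0" if "d < c" for d
  proof (rule ext)
    fix S
    have "contract_vec n (m d) (wedge_vec n (m c) f) S + wedge_vec n (m c) (contract_vec n (m d) f) S = 0"
      unfolding contract_wedge_vec using orthogonal[of d c] that assms(1) by simp
    then show "contract_vec n (m d) (wedge_vec n (m c) f) S = 0 S" using f(2)[OF that] by simp
  qed
  then show ?thesis
    using wedge_vec_homogeneous[OF linear[OF assms(1)] f(1)] by (simp add: common_kernel_def)
qed

lemma contract_wedge_kernel:
  assumes "c < r" "f \<in> K (Suc c) k w"
  shows "contract_vec n (m c) (wedge_vec n (m c) f) = (\<lambda>S. quadric s * f S)"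
proof (rule ext)
  fix S
  have "contract_vec n (m c) f = 0" using assms(2) by (simp add: common_kernel_def)
  then show "contract_vec n (m c) (wedge_vec n (m c) f) S = quadric s * f S"
    using contract_wedge_vec[of n "m c" "m c" f S] orthogonal[of c c] assms(1) by simp
qed

lemma K_Suc_subset: "K (Suc c) k w \<subseteq> K c k w"
  by (auto simp: common_kernel_def)

text \<open>
  Exterior multiplication by \<open>m\<^sub>c\<close> is injective on the kernel of the contraction with \<open>m\<^sub>c\<close>, since
  contracting again multiplies by the nonzero quadric.  So a kernel for \<open>c\<close> vectors in degree \<open>k\<close>
  embeds in the exterior power of degree \<open>k + c\<close>.
\<close>

lemma K_trivial:
  assumes "c \<le> r" "n < k + c" "f \<in> K c k w"
  shows "f = 0"
  using assms
proof (induction c arbitrary: f k w)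
  case 0
  have "subsets_of_card n k = {}"
  proof -
    have "card (subsets_of_card n k) = 0" unfolding card_subsets_of_card using 0 by simp
    then show ?thesis using finite_subsets_of_card[of n k] by (simp only: card_0_eq)
  qed
  then have f: "f \<in> homogeneous s {} w" using 0(3) by (simp add: common_kernel_def)
  show ?case by (rule ext) (simp add: homogeneous_outside[OF f])
next
  case (Suc c)
  have c: "c < r" using Suc.prems by simp
  have wk: "wedge_vec n (m c) f \<in> K c (Suc k) (Suc w)"
    by (rule wedge_in_kernel[OF c subsetD[OF K_Suc_subset Suc.prems(3)]])
  have "wedge_vec n (m c) f = 0" by (rule Suc.IH[OF _ _ wk]) (use Suc.prems in auto)
  then have z: "(\<lambda>S. quadric s * f S) = 0" using contract_wedge_kernel[OF c Suc.prems(3)] by simp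
  show ?case
  proof (rule ext)
    fix S
    have "quadric s * f S = 0" using fun_cong[OF z, of S] by simp
    then show "f S = 0 S" using quadric_nonzero[OF s, where 'a = 'a] by simp
  qed
qed

text \<open>
  The class of the common kernel; only its residue modulo \<open>2 ^ (s - s div 2)\<close> matters.
\<close>

definition \<kappa> :: "nat \<Rightarrow> nat \<Rightarrow> int" where
  "\<kappa> c k = (SOME x. value_at_minus_one s (hilbert_series (K c k)) x)"

lemma \<kappa>: "value_at_minus_one s (hilbert_series (K c k)) (\<kappa> c k)"
  unfolding \<kappa>_def
  using hilbert_series_rational[OF finite_subsets_of_card graded_submodule_common_kernel] by (rule someI_ex)

lemma \<kappa>_0: "\<kappa> 0 k = int (n choose k)"
proof -
  have "K 0 k = homogeneous s (subsets_of_card n k)" by (auto simp: common_kernel_def fun_eq_iff)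
  then have "value_at_minus_one s (hilbert_series (K 0 k)) (int (n choose k))"
    using hilbert_series_homogeneous[OF finite_subsets_of_card[of n k], of s, where 'a = 'a]
    by (simp add: card_subsets_of_card)
  then show ?thesis using value_at_minus_one_unique \<kappa> by blast
qed

lemma \<kappa>_trivial:
  assumes "c \<le> r" "n < k + c"
  shows "\<kappa> c k = 0"
proof -
  have "fv.dim (K c k w) = 0" for w
  proof -
    have "K c k w \<subseteq> {0}" using K_trivial[OF assms] by blast
    then have "fv.dim (K c k w) \<le> card ({} :: (nat set \<Rightarrow> 'a mpol) set)" by (intro fv.dim_le_card) auto
    then show ?thesis by simp
  qed
  then have "hilbert_series (K c k) = 0" by (intro fps_ext) (simp add: hilbert_series_def)
  moreover have "value_at_minus_one s 0 0" unfolding value_at_minus_one_def by (intro exI[of _ 0]) simp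
  ultimately show ?thesis using value_at_minus_one_unique \<kappa> by metis
qed

lemma \<kappa>_degree_zero: "\<kappa> (Suc c) 0 = \<kappa> c 0"
proof -
  have "f \<in> K (Suc c) 0 w \<longleftrightarrow> f \<in> K c 0 w" for f w
    using contract_vec_degree_zero[of f s n w "m c"] by (auto simp: common_kernel_def less_Suc_eq)
  then have "K (Suc c) 0 = K c 0" by (intro ext Set.set_eqI)
  then show ?thesis by (simp add: \<kappa>_def)
qed

text \<open>
  Contraction with \<open>m\<^sub>c\<close> maps \<open>K c (k + 1)\<close> into \<open>K (c + 1) k\<close> and has kernel \<open>K (c + 1) (k + 1)\<close>.  Its
  image \<open>I\<close> contains all multiples of the quadric, because contraction undoes exterior multiplication
  up to the quadric.  The sign comes from the shift of degree by one.
\<close>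

lemma \<kappa>_recurrence:
  assumes c: "c < r"
  shows "2 ^ (s - s div 2) dvd \<kappa> c (Suc k) - \<kappa> (Suc c) (Suc k) + \<kappa> (Suc c) k"
proof -
  let ?d = "contract_vec n (m c)"
  define I where "I w = (case w of 0 \<Rightarrow> {0} | Suc v \<Rightarrow> ?d ` K c (Suc k) v)" for w
  note gK = graded_submodule_common_kernel[of s n _ m]
  have sub: "I w \<subseteq> K (Suc c) k w" for w
  proof (cases w)
    case 0
    then show ?thesis using fv.subspace_0[OF graded_submoduleD(1)[OF gK]] by (simp add: I_def)
  next
    case (Suc v)
    have "?d f \<in> K (Suc c) k (Suc v)" if f: "f \<in> K c (Suc k) v" for f
    proof -
      have h: "f \<in> homogeneous s (subsets_of_card n (Suc k)) v" using f by (simp add: common_kernel_def)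
      have "contract_vec n (m d) (?d f) = 0" if d: "d < Suc c" for d
      proof (cases "d = c")
        case True
        \<comment> \<open>anticommuting with itself makes twice the square vanish\<close>
        have "?d (?d f) S = 0" for S
        proof (rule two_cancel[OF two])
          have "?d (?d f) S + ?d (?d f) S = 0"
            using contract_vec_anticommute[of n "m c" "m c" f S] unfolding eq_neg_iff_add_eq_0 .
          then show "2 * ?d (?d f) S = 2 * 0" by (simp only: mult_2 mult_zero_right)
        qed
        then show ?thesis using True by auto
      next
        case False
        then have "contract_vec n (m d) f = 0" using f d by (simp add: common_kernel_def)
        then show ?thesis using contract_vec_anticommute[of n "m d" "m c" f] by (intro ext) simp
      qed
      then show ?thesis using contract_vec_homogeneous[OF linear[OF c] h] by (simp add: common_kernel_def)
    qed
    then show ?thesis by (auto simp: I_def Suc)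
  qed
  have I_sub: "fv.subspace (I w)" for w
  proof (cases w)
    case 0
    then show ?thesis by (simp add: I_def)
  next
    case (Suc v)
    note S = graded_submoduleD(1)[OF gK, of c "Suc k" v]
    show ?thesis unfolding I_def Suc nat.case
    proof (rule fv.subspaceI)
      have "0 = ?d 0" by simp
      then show "0 \<in> ?d ` K c (Suc k) v" using fv.subspace_0[OF S] by (rule image_eqI)
    next
      fix x y assume "x \<in> ?d ` K c (Suc k) v" "y \<in> ?d ` K c (Suc k) v"
      then show "x + y \<in> ?d ` K c (Suc k) v"
        using fv.subspace_add[OF S] by (auto simp: contract_vec_add[symmetric])
    next
      fix a x assume "x \<in> ?d ` K c (Suc k) v"
      then show "smul a x \<in> ?d ` K c (Suc k) v"
        using fv.subspace_scale[OF S] by (auto simp: contract_vec_smul[symmetric] simp del: smul_apply)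
    qed
  qed
  have "(\<lambda>S. indet a * f S) \<in> I (Suc w)" if f: "f \<in> I w" and a: "a < s" for f a w
  proof (cases w)
    case 0
    then have "(\<lambda>S. indet a * f S) = ?d 0" using f by (auto simp: I_def fun_eq_iff)
    moreover have "0 \<in> K c (Suc k) w" using fv.subspace_0[OF graded_submoduleD(1)[OF gK]] .
    ultimately show ?thesis unfolding I_def nat.case by (rule image_eqI)
  next
    case (Suc v)
    then obtain h where h: "f = ?d h" "h \<in> K c (Suc k) v" using f by (auto simp: I_def)
    have "(\<lambda>S. indet a * f S) = ?d (\<lambda>S. indet a * h S)" unfolding h(1) contract_vec_mult ..
    moreover have "(\<lambda>S. indet a * h S) \<in> K c (Suc k) w" unfolding Suc by (rule graded_submoduleD(3)[OF gK h(2) a])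
    ultimately show ?thesis unfolding I_def nat.case by (rule image_eqI)
  qed
  then have gI: "graded_submodule s (subsets_of_card n k) I"
    unfolding graded_submodule_def using I_sub sub graded_submoduleD(2)[OF gK] by blast
  have q: "(\<lambda>S. quadric s * f S) \<in> I (w + 2)" if f: "f \<in> K (Suc c) k w" for f w
  proof -
    have "wedge_vec n (m c) f \<in> K c (Suc k) (Suc w)"
      by (rule wedge_in_kernel[OF c subsetD[OF K_Suc_subset f]])
    then show ?thesis using contract_wedge_kernel[OF c f, symmetric] by (simp add: I_def)
  qed
  obtain kI where kI: "value_at_minus_one s (hilbert_series I) kI"
    using hilbert_series_rational[OF finite_subsets_of_card gI] by blast
  have dvd: "2 ^ (s - s div 2) dvd \<kappa> (Suc c) k - kI"
    by (rule quadric_torsion_congruence[OF two j finite_subsets_of_card gK gI sub q \<kappa> kI])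
  have dim0: "fv.dim {0 :: nat set \<Rightarrow> 'a mpol} = 0"
    using fv.dim_le_card[of "{0 :: nat set \<Rightarrow> 'a mpol}" "{}"] by simp
  have dims: "fv.dim (K c (Suc k) w) = fv.dim (K (Suc c) (Suc k) w) + fv.dim (I (Suc w))" for w
  proof -
    have "fv.dim (K c (Suc k) w) + fv.dim {0 :: nat set \<Rightarrow> 'a mpol}
      = fv.dim {v \<in> K c (Suc k) w. ?d v \<in> {0}} + fv.dim {?d v + u |v u. v \<in> K c (Suc k) w \<and> u \<in> {0}}"
    proof (rule dim_preimage_plus_dim_sum_image_homogeneous[OF finite_subsets_of_card finite_subsets_of_card])
      show "{0} \<subseteq> (homogeneous s (subsets_of_card n k) w :: (nat set \<Rightarrow> 'a mpol) set)"
        by (simp add: homogeneous_def)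
    qed (use graded_submoduleD(1,2)[OF gK] in \<open>simp_all add: contract_vec_add contract_vec_smul del: smul_apply\<close>)
    moreover have "{v \<in> K c (Suc k) w. ?d v \<in> {0}} = K (Suc c) (Suc k) w"
      by (auto simp: common_kernel_def less_Suc_eq)
    moreover have "{?d v + u |v u. v \<in> K c (Suc k) w \<and> u \<in> {0}} = I (Suc w)"
      by (auto simp: I_def)
    ultimately show ?thesis using dim0 by simp
  qed
  have "fps_X * hilbert_series (K c (Suc k)) = fps_X * hilbert_series (K (Suc c) (Suc k)) + hilbert_series I"
  proof (rule fps_ext)
    fix w show "fps_nth (fps_X * hilbert_series (K c (Suc k))) w
        = fps_nth (fps_X * hilbert_series (K (Suc c) (Suc k)) + hilbert_series I) w"
    proof (cases w)
      case 0
      then show ?thesis using dim0 by (simp add: hilbert_series_def I_def)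
    next
      case (Suc v)
      then show ?thesis using dims[of v] by (simp add: hilbert_series_def)
    qed
  qed
  moreover have "value_at_minus_one s (fps_X * hilbert_series (K (Suc c) (Suc k)) + hilbert_series I)
      (- \<kappa> (Suc c) (Suc k) + kI)"
    by (intro value_at_minus_one_add value_at_minus_one_shift \<kappa> kI)
  ultimately have "- \<kappa> c (Suc k) = - \<kappa> (Suc c) (Suc k) + kI"
    using value_at_minus_one_unique[OF value_at_minus_one_shift[OF \<kappa>[of c "Suc k"]]] by metis
  then have "\<kappa> c (Suc k) - \<kappa> (Suc c) (Suc k) + \<kappa> (Suc c) k = \<kappa> (Suc c) k - kI" by simp
  then show ?thesis using dvd by simp
qed

end

section \<open>From the recurrence to binomial coefficients\<close>

text \<open>
  For \<open>r = 0\<close> truncated subtraction gives \<open>(i - 1) choose i = 1\<close> at \<open>i = 0\<close> and \<open>0\<close> elsewhere, as the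
  expansion of \<open>(1 - 2 t) ^ 0\<close> requires.
\<close>

lemma negative_binomial_series:
  "(1 - 2 * fps_X) ^ r * Abs_fps (\<lambda>i. 2 ^ i * int ((r + i - 1) choose i)) = 1"
proof (induction r)
  case 0
  have "int ((i - 1) choose i) = (if i = 0 then 1 else 0)" for i by (cases i) (auto simp: binomial_eq_0)
  then show ?case by (intro fps_ext) simp
next
  case (Suc r)
  let ?W = "\<lambda>r. Abs_fps (\<lambda>i. 2 ^ i * int ((r + i - 1) choose i))"
  have W: "(1 - 2 * fps_X) * ?W (Suc r) = ?W r"
  proof (rule fps_ext)
    fix i
    show "fps_nth ((1 - 2 * fps_X) * ?W (Suc r)) i = fps_nth (?W r) i"
    proof (cases i)
      case 0
      then show ?thesis by (simp add: left_diff_distrib mult.assoc)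
    next
      case (Suc k)
      have "(r + Suc k) choose (Suc k) = ((r + k) choose k) + ((r + k) choose (Suc k))" by simp
      then show ?thesis using Suc
        by (simp add: left_diff_distrib mult.assoc numeral_fps_const algebra_simps)
    qed
  qed
  have "(1 - 2 * fps_X) ^ Suc r * ?W (Suc r) = (1 - 2 * fps_X) ^ r * ((1 - 2 * fps_X) * ?W (Suc r))"
    by (simp only: power_Suc mult_ac)
  then show ?case unfolding W Suc.IH .
qed

lemma const_poly_dvd_const_poly: "[:a:] dvd [:b:] \<longleftrightarrow> a dvd (b :: int)"
proof
  assume "[:a:] dvd [:b:]"
  then have "a dvd Polynomial.coeff [:b:] 0" unfolding const_poly_dvd_iff by blast
  then show "a dvd b" by simp
next
  assume "a dvd b"
  then show "[:a:] dvd [:b:]" unfolding const_poly_dvd_iff by (simp add: coeff_pCons split: nat.split)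
qed

text \<open>
  With \<open>\<kappa> c\<close> as coefficient sequence of a polynomial in \<open>t\<close>, the recurrence says that modulo \<open>M\<close> this
  polynomial is \<open>1 - t\<close> times the next one.  The substitution \<open>t = x / (1 - x)\<close>, homogenized to clear
  denominators, turns it into the polynomial \<open>Q c\<close> of degree at most \<open>n - c\<close>.  Then \<open>Q 0 = 1\<close> by the
  binomial theorem and \<open>Q c = (1 - 2 x) Q (c + 1)\<close> modulo \<open>M\<close>, so the power series of
  \<open>(1 - 2 x) ^ (- r)\<close> agrees modulo \<open>M\<close> with a polynomial of degree at most \<open>n - r\<close>.
\<close>

lemma binomial_divisibility_from_recurrence:
  fixes \<kappa> :: "nat \<Rightarrow> nat \<Rightarrow> int" and M :: int
  assumes start: "\<And>k. \<kappa> 0 k = int (n choose k)"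
    and step: "\<And>c k. c < r \<Longrightarrow> M dvd \<kappa> c (Suc k) - \<kappa> (Suc c) (Suc k) + \<kappa> (Suc c) k"
    and step0: "\<And>c. \<kappa> (Suc c) 0 = \<kappa> c 0"
    and zero: "\<And>c k. c \<le> r \<Longrightarrow> n < k + c \<Longrightarrow> \<kappa> c k = 0"
    and M: "\<not> M dvd 1"
  shows "r \<le> n \<and> (\<forall>i>n - r. M dvd 2 ^ i * int ((r + i - 1) choose i))"
proof -
  define x :: "int poly" where "x = [:0, 1:]"
  define Q where "Q c = (\<Sum>k\<le>n - c. [:\<kappa> c k:] * (x ^ k * (1 - x) ^ (n - c - k)))" for c
  have Q0: "Q 0 = 1"
  proof -
    have "Q 0 = (\<Sum>k\<le>n. of_nat (n choose k) * x ^ k * (1 - x) ^ (n - k))"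
      unfolding Q_def start by (simp add: of_nat_poly mult.assoc)
    also have "\<dots> = (x + (1 - x)) ^ n" by (rule binomial_ring[symmetric])
    finally show ?thesis by simp
  qed
  have Qstep: "[:M:] dvd Q c - (1 - 2 * x) * Q (Suc c)" if c: "c < r" "c < n" for c
  proof -
    define N where "N = n - Suc c"
    have nc: "n - c = Suc N" using c by (simp add: N_def)
    let ?a = "\<lambda>k. \<kappa> (Suc c) k"
    let ?p = "\<lambda>k. x ^ k * (1 - x) ^ (Suc N - k)"
    have aN: "?a (Suc N) = 0" using zero[of "Suc c" "Suc N"] c by (simp add: N_def)
    have ring: "(1 - 2 * x) * (A * (u * v)) = A * (u * ((1 - x) * v)) - A * (x * u * v)" for A u v :: "int poly"
      by (simp add: algebra_simps)
    have "(1 - 2 * x) * Q (Suc c) = (\<Sum>k\<le>N. [:?a k:] * ?p k - [:?a k:] * ?p (Suc k))"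
      unfolding Q_def N_def[symmetric] sum_distrib_left
    proof (rule sum.cong)
      fix k assume "k \<in> {..N}"
      then have "Suc N - k = Suc (N - k)" by simp
      then show "(1 - 2 * x) * ([:?a k:] * (x ^ k * (1 - x) ^ (N - k))) = [:?a k:] * ?p k - [:?a k:] * ?p (Suc k)"
        by (simp only: power_Suc diff_Suc_Suc ring)
    qed simp
    also have "\<dots> = (\<Sum>k\<le>N. [:?a k:] * ?p k) - (\<Sum>k\<le>N. [:?a k:] * ?p (Suc k))" by (rule sum_subtractf)
    also have "(\<Sum>k\<le>N. [:?a k:] * ?p k) = (\<Sum>k\<le>Suc N. [:?a k:] * ?p k)" using aN by simp
    also have "(\<Sum>k\<le>N. [:?a k:] * ?p (Suc k)) = (\<Sum>k\<le>Suc N. (if k = 0 then 0 else [:?a (k - 1):]) * ?p k)"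
      by (subst sum.atMost_Suc_shift) simp
    finally have eq: "Q c - (1 - 2 * x) * Q (Suc c)
        = (\<Sum>k\<le>Suc N. [:\<kappa> c k:] * ?p k) - ((\<Sum>k\<le>Suc N. [:?a k:] * ?p k)
           - (\<Sum>k\<le>Suc N. (if k = 0 then 0 else [:?a (k - 1):]) * ?p k))"
      unfolding Q_def[of c] nc by simp
    have "[:\<kappa> c k:] * ?p k - ([:?a k:] * ?p k - (if k = 0 then 0 else [:?a (k - 1):]) * ?p k)
        = [:\<kappa> c k - ?a k + (if k = 0 then 0 else ?a (k - 1)):] * ?p k" for k
    proof -
      have "[:\<kappa> c k - ?a k + (if k = 0 then 0 else ?a (k - 1)):]
          = [:\<kappa> c k:] - [:?a k:] + (if k = 0 then 0 else [:?a (k - 1):])" by simp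
      then show ?thesis by (simp only: left_diff_distrib distrib_right)
    qed
    then have eq': "Q c - (1 - 2 * x) * Q (Suc c)
        = (\<Sum>k\<le>Suc N. [:\<kappa> c k - ?a k + (if k = 0 then 0 else ?a (k - 1)):] * ?p k)"
      unfolding eq sum_subtractf[symmetric] by (intro sum.cong refl) (simp only:)
    have "M dvd \<kappa> c k - ?a k + (if k = 0 then 0 else ?a (k - 1))" for k
      using step[OF c(1)] step0[of c] by (cases k) simp_all
    then have "[:M:] dvd [:\<kappa> c k - ?a k + (if k = 0 then 0 else ?a (k - 1)):]" for k
      by (simp only: const_poly_dvd_const_poly)
    then show ?thesis unfolding eq' by (intro dvd_sum dvd_mult2)
  qed
  have main: "[:M:] dvd 1 - (1 - 2 * x) ^ c * Q c" if "c \<le> r" "c \<le> n" for c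
    using that
  proof (induction c)
    case 0
    then show ?case by (simp add: Q0)
  next
    case (Suc c)
    have ring: "1 - d * w * q' = (1 - w * q) + w * (q - d * q')" for d w q q' :: "int poly"
      by (simp add: algebra_simps)
    have "1 - (1 - 2 * x) ^ Suc c * Q (Suc c)
        = (1 - (1 - 2 * x) ^ c * Q c) + (1 - 2 * x) ^ c * (Q c - (1 - 2 * x) * Q (Suc c))"
      unfolding power_Suc by (rule ring)
    moreover have "[:M:] dvd 1 - (1 - 2 * x) ^ c * Q c" using Suc by simp
    moreover have "[:M:] dvd (1 - 2 * x) ^ c * (Q c - (1 - 2 * x) * Q (Suc c))"
      using Suc.prems by (intro dvd_mult Qstep) simp_all
    ultimately show ?case by (simp only: dvd_add)
  qed
  \<comment> \<open>otherwise \<open>Q n\<close> would be zero modulo \<open>M\<close>, and \<open>1\<close> with it\<close>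
  have rn: "r \<le> n"
  proof (rule ccontr)
    assume "\<not> r \<le> n"
    then have n: "n < r" by simp
    have "M dvd \<kappa> n 0"
      using zero[of "Suc n" 0] step0[of n] n by simp
    then have "[:M:] dvd Q n" unfolding Q_def by (simp add: const_poly_dvd_const_poly dvd_mult2)
    then have "[:M:] dvd (1 - 2 * x) ^ n * Q n" by (rule dvd_mult)
    moreover have "[:M:] dvd 1 - (1 - 2 * x) ^ n * Q n" using main[of n] n by simp
    ultimately have "[:M:] dvd (1 - (1 - 2 * x) ^ n * Q n) + (1 - 2 * x) ^ n * Q n" by (rule dvd_add[rotated])
    then have "[:M:] dvd 1" by (simp only: diff_add_cancel)
    then show False using M by (simp only: one_pCons const_poly_dvd_const_poly not_False_eq_True)
  qed
  moreover have "M dvd 2 ^ i * int ((r + i - 1) choose i)" if i: "i > n - r" for i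
  proof -
    obtain P where P: "1 - (1 - 2 * x) ^ r * Q r = [:M:] * P" using main[OF order.refl rn] by (auto elim: dvdE)
    define W where "W = Abs_fps (\<lambda>i. 2 ^ i * int ((r + i - 1) choose i))"
    have fx: "fps_of_poly x = fps_X" by (simp add: x_def fps_of_poly_pCons)
    have ring: "(1 - d * q) * w = w - q * (d * w)" for d q w :: "int fps"
      by (simp add: algebra_simps)
    have "fps_of_poly (1 - (1 - 2 * x) ^ r * Q r) = fps_of_poly ([:M:] * P)" using P by simp
    then have "1 - (1 - 2 * fps_X) ^ r * fps_of_poly (Q r) = fps_const M * fps_of_poly P"
      by (simp only: fps_of_poly_diff fps_of_poly_mult fps_of_poly_power fps_of_poly_1 fps_of_poly_const
          fps_of_poly_numeral fx)
    then have "(1 - (1 - 2 * fps_X) ^ r * fps_of_poly (Q r)) * W = fps_const M * fps_of_poly P * W" by simp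
    moreover have "(1 - (1 - 2 * fps_X) ^ r * fps_of_poly (Q r)) * W
        = W - fps_of_poly (Q r) * ((1 - 2 * fps_X) ^ r * W)"
      by (rule ring)
    moreover have "(1 - 2 * fps_X) ^ r * W = 1" unfolding W_def by (rule negative_binomial_series)
    ultimately have WQ: "W - fps_of_poly (Q r) = fps_const M * (fps_of_poly P * W)" by (simp add: mult.assoc)
    have "Polynomial.degree (Q r) \<le> n - r"
      unfolding Q_def
    proof (rule degree_sum_le)
      fix k assume k: "k \<in> {..n - r}"
      have dx: "Polynomial.degree (x ^ k) \<le> k" "Polynomial.degree ((1 - x) ^ j) \<le> j" for j
      proof -
        have "1 - x = [:1, -1:]" by (simp add: x_def one_pCons)
        then have "Polynomial.degree (1 - x) \<le> 1" "Polynomial.degree x \<le> 1" by (simp_all add: x_def)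
        moreover have "Polynomial.degree (p ^ l) \<le> l" if "Polynomial.degree p \<le> 1" for p :: "int poly" and l
          using order_trans[OF degree_power_le mult_right_mono[OF that, of l]] by simp
        ultimately show "Polynomial.degree (x ^ k) \<le> k" "Polynomial.degree ((1 - x) ^ j) \<le> j" by simp_all
      qed
      have "Polynomial.degree ([:\<kappa> r k:] * (x ^ k * (1 - x) ^ (n - r - k)))
          \<le> Polynomial.degree [:\<kappa> r k:] + Polynomial.degree (x ^ k * (1 - x) ^ (n - r - k))"
        by (rule degree_mult_le)
      also have "\<dots> \<le> 0 + (Polynomial.degree (x ^ k) + Polynomial.degree ((1 - x) ^ (n - r - k)))"
        using degree_mult_le by (intro add_mono) simp_all
      also have "\<dots> \<le> 0 + (k + (n - r - k))" using dx by (intro add_mono) auto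
      also have "\<dots> = n - r" using k by simp
      finally show "Polynomial.degree ([:\<kappa> r k:] * (x ^ k * (1 - x) ^ (n - r - k))) \<le> n - r" .
    qed simp
    then have "Polynomial.coeff (Q r) i = 0" using i by (intro coeff_eq_0) simp
    then have "fps_nth W i = fps_nth (W - fps_of_poly (Q r)) i" by simp
    also have "\<dots> = M * fps_nth (fps_of_poly P * W) i" unfolding WQ by (rule fps_mult_left_const_nth)
    finally show ?thesis by (simp add: W_def)
  qed
  ultimately show ?thesis by blast
qed

section \<open>Coefficients of a sums-of-squares formula\<close>

definition xy_monomial :: "nat \<Rightarrow> nat \<Rightarrow> nat \<Rightarrow> nat \<Rightarrow> (nat + nat) \<Rightarrow>\<^sub>0 nat" where
  "xy_monomial a b a' b' = Poly_Mapping.single (Inl a) 1 + Poly_Mapping.single (Inr b) 1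
     + (Poly_Mapping.single (Inl a') 1 + Poly_Mapping.single (Inr b') 1)"

lemma unordered_pair_eqI:
  assumes "\<And>x. (if x = a then 1 else 0) + (if x = a' then 1 else 0)
      = (if x = p then 1 else 0) + (if x = q then 1 else (0 :: nat))"
  shows "(a = p \<and> a' = q) \<or> (a = q \<and> a' = p)"
proof (cases "a = p")
  case True
  have "a' = q"
  proof (rule ccontr)
    assume "a' \<noteq> q"
    then show False using assms[of a'] True by (cases "a' = p") auto
  qed
  then show ?thesis using True by blast
next
  case False
  have aq: "a = q"
  proof (rule ccontr)
    assume "a \<noteq> q"
    then show False using assms[of a] False by auto
  qed
  have "a' = p"
  proof (rule ccontr)
    assume "a' \<noteq> p"
    then show False using assms[of p] False by auto
  qed
  then show ?thesis using aq by blast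
qed

lemma xy_monomial_eq_iff:
  "xy_monomial a b a' b' = xy_monomial p u q v
    \<longleftrightarrow> ((a = p \<and> a' = q) \<or> (a = q \<and> a' = p)) \<and> ((b = u \<and> b' = v) \<or> (b = v \<and> b' = u))"
proof
  assume eq: "xy_monomial a b a' b' = xy_monomial p u q v"
  have L: "lookup (xy_monomial a b a' b') (Inl x) = (if x = a then 1 else 0) + (if x = a' then 1 else 0)"
    "lookup (xy_monomial a b a' b') (Inr x) = (if x = b then 1 else 0) + (if x = b' then 1 else 0)"
    for a b a' b' x
    by (simp_all add: xy_monomial_def lookup_add lookup_single when_def)
  show "((a = p \<and> a' = q) \<or> (a = q \<and> a' = p)) \<and> ((b = u \<and> b' = v) \<or> (b = v \<and> b' = u))"
  proof (intro conjI unordered_pair_eqI)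
    fix x
    show "(if x = a then 1 else 0) + (if x = a' then 1 else 0) = (if x = p then 1 else 0) + (if x = q then 1 else (0 :: nat))"
      using arg_cong[OF eq, of "\<lambda>f. lookup f (Inl x)"] by (simp only: L)
    show "(if x = b then 1 else 0) + (if x = b' then 1 else 0) = (if x = u then 1 else 0) + (if x = v then 1 else (0 :: nat))"
      using arg_cong[OF eq, of "\<lambda>f. lookup f (Inr x)"] by (simp only: L)
  qed
next
  assume "((a = p \<and> a' = q) \<or> (a = q \<and> a' = p)) \<and> ((b = u \<and> b' = v) \<or> (b = v \<and> b' = u))"
  then show "xy_monomial a b a' b' = xy_monomial p u q v"
    by (elim conjE disjE) (simp_all only: xy_monomial_def add_ac)
qed

text \<open>
  A monomial \<open>x\<^sub>p x\<^sub>q\<close> arises from two ordered pairs of indices, or from one if \<open>p = q\<close>.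
\<close>

lemma sum_over_orderings:
  fixes g :: "nat \<Rightarrow> nat \<Rightarrow> 'c::comm_monoid_add"
  assumes "p \<in> A" "q \<in> A" "finite A"
  shows "(\<Sum>a\<in>A. \<Sum>a'\<in>A. if (a = p \<and> a' = q) \<or> (a = q \<and> a' = p) then g a a' else 0)
    = (if p = q then g p p else g p q + g q p)"
proof (cases "p = q")
  case True
  have "(\<Sum>a\<in>A. \<Sum>a'\<in>A. if (a = p \<and> a' = q) \<or> (a = q \<and> a' = p) then g a a' else 0)
      = (\<Sum>a\<in>A. if a = p then \<Sum>a'\<in>A. if a' = p then g p p else 0 else 0)"
    using True by (intro sum.cong refl) (auto intro!: sum.cong)
  then show ?thesis using assms True by simp
next
  case False
  have "(\<Sum>a\<in>A. \<Sum>a'\<in>A. if (a = p \<and> a' = q) \<or> (a = q \<and> a' = p) then g a a' else 0)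
      = (\<Sum>a\<in>A. (if a = p then \<Sum>a'\<in>A. if a' = q then g p q else 0 else 0)
          + (if a = q then \<Sum>a'\<in>A. if a' = p then g q p else 0 else 0))"
    using False by (intro sum.cong refl) (auto intro!: sum.cong)
  then show ?thesis using assms False by (simp add: sum.distrib)
qed

text \<open>
  Comparison of the coefficients of \<open>x\<^sub>p x\<^sub>q y\<^sub>u y\<^sub>v\<close>.  The sum symmetrized in \<open>u\<close> and \<open>v\<close> is the one that
  is determined uniformly; dividing by two covers the cases with \<open>p \<noteq> q\<close>.
\<close>

lemma sums_of_squares_formula_coefficients:
  fixes z :: "nat \<Rightarrow> 'a::field xy_poly"
  assumes two: "(2 :: 'a) \<noteq> 0" and F: "sums_of_squares_formula r s n z"
  obtains c :: "nat \<Rightarrow> nat \<Rightarrow> nat \<Rightarrow> 'a" where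
    "\<And>p q u v. p \<in> {1..r} \<Longrightarrow> q \<in> {1..r} \<Longrightarrow> u \<in> {1..s} \<Longrightarrow> v \<in> {1..s} \<Longrightarrow>
      (\<Sum>j=1..n. c j p u * c j q v + c j p v * c j q u) = (if p = q \<and> u = v then 2 else 0)"
proof -
  have "\<forall>j. \<exists>c. j \<in> {1..n} \<longrightarrow> z j = (\<Sum>a=1..r. \<Sum>b=1..s. const_poly (c a b) * x_var a * y_var b)"
    using F unfolding sums_of_squares_formula_def is_bilinear_def by blast
  from choice[OF this] obtain c where
    c: "\<forall>j. j \<in> {1..n} \<longrightarrow> z j = (\<Sum>a=1..r. \<Sum>b=1..s. const_poly (c j a b) * x_var a * y_var b)" by blast
  have zz: "lookup ((z j)\<^sup>2) \<mu> = (\<Sum>a=1..r. \<Sum>a'=1..r. \<Sum>b=1..s. \<Sum>b'=1..s.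
      if xy_monomial a b a' b' = \<mu> then c j a b * c j a' b' else 0)" if j: "j \<in> {1..n}" for j \<mu>
  proof -
    have "z j = (\<Sum>a=1..r. \<Sum>b=1..s. Poly_Mapping.single (Poly_Mapping.single (Inl a) 1 + Poly_Mapping.single (Inr b) 1) (c j a b))"
      using c j by (simp add: const_poly_def x_var_def y_var_def mult_single)
    then have "(z j)\<^sup>2 = (\<Sum>a=1..r. \<Sum>a'=1..r. \<Sum>b=1..s. \<Sum>b'=1..s.
        Poly_Mapping.single (xy_monomial a b a' b') (c j a b * c j a' b'))"
      by (simp add: power2_eq_square sum_product mult_single xy_monomial_def)
    then show ?thesis by (simp add: lookup_sum lookup_single when_def)
  qed
  have lhs: "lookup ((\<Sum>a=1..r. (x_var a)\<^sup>2) * (\<Sum>b=1..s. (y_var b)\<^sup>2) :: 'a xy_poly) \<mu>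
      = (\<Sum>a=1..r. \<Sum>b=1..s. if xy_monomial a b a b = \<mu> then 1 else 0)" for \<mu>
  proof -
    have "(x_var a)\<^sup>2 * (y_var b)\<^sup>2 = (Poly_Mapping.single (xy_monomial a b a b) 1 :: 'a xy_poly)" for a b
      by (simp add: x_var_def y_var_def power2_eq_square mult_single xy_monomial_def ac_simps)
    then show ?thesis by (simp add: sum_product lookup_sum lookup_single when_def)
  qed
  show ?thesis
  proof
    fix p q u v assume i: "p \<in> {1..r}" "q \<in> {1..r}" "u \<in> {1..s}" "v \<in> {1..s}"
    define E where "E p u q v = (\<Sum>j=1..n. c j p u * c j q v)" for p u q v
    have sym: "E p u q v = E q v p u" for p u q v by (simp add: E_def mult.commute)
    let ?\<mu> = "xy_monomial p u q v"
    let ?P = "\<lambda>a a'. (a = p \<and> a' = q) \<or> (a = q \<and> a' = p)"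
    let ?R = "\<lambda>b b'. (b = u \<and> b' = v) \<or> (b = v \<and> b' = u)"
    have "lookup (\<Sum>j=1..n. (z j)\<^sup>2) ?\<mu> = (\<Sum>j=1..n. \<Sum>a=1..r. \<Sum>a'=1..r. if ?P a a' then
        \<Sum>b=1..s. \<Sum>b'=1..s. if ?R b b' then c j a b * c j a' b' else 0 else 0)"
      unfolding lookup_sum using zz
      by (intro sum.cong refl) (auto simp: xy_monomial_eq_iff intro!: sum.cong)
    also have "\<dots> = (if p = q then (if u = v then E p u p u else E p u p v + E p v p u)
        else (if u = v then E p u q u else E p u q v + E p v q u) + (if u = v then E q u p u else E q u p v + E q v p u))"
      unfolding sum_over_orderings[OF i(1,2) finite_atLeastAtMost] sum_over_orderings[OF i(3,4) finite_atLeastAtMost]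
      by (cases "p = q"; cases "u = v") (simp_all only: if_True if_False simp_thms E_def sum.distrib)
    finally have rhs: "lookup (\<Sum>j=1..n. (z j)\<^sup>2) ?\<mu> = \<dots>" .
    have "lookup ((\<Sum>a=1..r. (x_var a)\<^sup>2) * (\<Sum>b=1..s. (y_var b)\<^sup>2) :: 'a xy_poly) ?\<mu>
        = (\<Sum>a=1..r. \<Sum>b=1..s. if p = q \<and> u = v \<and> a = p \<and> b = u then 1 else 0)"
      unfolding lhs by (intro sum.cong refl) (auto simp: xy_monomial_eq_iff)
    also have "\<dots> = (\<Sum>a=1..r. if a = p then \<Sum>b=1..s. if b = u then if p = q \<and> u = v then 1 else 0 else 0 else 0)"
    proof (rule sum.cong)
      fix a
      show "(\<Sum>b=1..s. if p = q \<and> u = v \<and> a = p \<and> b = u then 1 else 0)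
          = (if a = p then \<Sum>b=1..s. if b = u then if p = q \<and> u = v then 1 else 0 else 0 else (0 :: 'a))"
      proof (cases "a = p")
        case True
        show ?thesis unfolding if_P[OF True] by (rule sum.cong) (use True in auto)
      qed simp
    qed simp
    also have "\<dots> = (if p = q \<and> u = v then 1 else 0)"
      using i by (simp only: sum.delta finite_atLeastAtMost if_True)
    finally have "(if p = q \<and> u = v then 1 else 0) = (if p = q then (if u = v then E p u p u else E p u p v + E p v p u)
        else (if u = v then E p u q u else E p u q v + E p v q u) + (if u = v then E q u p u else E q u p v + E q v p u))"
      using F rhs unfolding sums_of_squares_formula_def by simp
    note coeff = this
    have half: "x + x = 0 \<Longrightarrow> x = 0" for x :: 'a using two by (simp flip: mult_2)
    have "E p u q v + E p v q u = (if p = q \<and> u = v then 2 else 0)"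
    proof -
      consider "p = q" "u = v" | "p = q" "u \<noteq> v" | "p \<noteq> q" "u = v" | "p \<noteq> q" "u \<noteq> v" by blast
      then show ?thesis
      proof cases
        case 1
        then show ?thesis using coeff by simp
      next
        case 2
        then show ?thesis using coeff by simp
      next
        case 3
        then have "E p u q u + E p u q u = 0" using coeff sym[of q u p u] by simp
        then show ?thesis using 3 by simp
      next
        case 4
        then have "(E p u q v + E p v q u) + (E q u p v + E q v p u) = 0" using coeff by simp
        then have "(E p u q v + E p v q u) + (E p u q v + E p v q u) = 0"
          unfolding sym[of q u p v] sym[of q v p u] by (simp only: add.commute)
        from half[OF this] show ?thesis using 4 by simp
      qed
    qed
    then show "(\<Sum>j=1..n. c j p u * c j q v + c j p v * c j q u) = (if p = q \<and> u = v then 2 else 0)"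
      by (simp add: E_def sum.distrib)
  qed
qed

text \<open>
  The vector \<open>m p\<close> is the coefficient of \<open>x\<^sub>p\<close> in the formula.  The algebraic closure provides the
  square root of \<open>-1\<close> for the Clifford matrices.
\<close>

lemma orthogonal_frame_of_formula:
  fixes z :: "nat \<Rightarrow> 'a::field xy_poly"
  assumes two: "(2 :: 'a) \<noteq> 0" and s: "s \<ge> 1" and F: "sums_of_squares_formula r s n z"
  shows "\<exists>(m :: nat \<Rightarrow> nat \<Rightarrow> 'a alg_closure mpol) j. orthogonal_frame s n r m j"
proof -
  obtain c :: "nat \<Rightarrow> nat \<Rightarrow> nat \<Rightarrow> 'a" where c:
    "\<And>p q u v. p \<in> {1..r} \<Longrightarrow> q \<in> {1..r} \<Longrightarrow> u \<in> {1..s} \<Longrightarrow> v \<in> {1..s} \<Longrightarrow>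
      (\<Sum>j=1..n. c j p u * c j q v + c j p v * c j q u) = (if p = q \<and> u = v then 2 else 0)"
    using sums_of_squares_formula_coefficients[OF two F] by blast
  have two': "(2 :: 'a alg_closure) \<noteq> 0" using two by (metis to_ac_eq_0_iff to_ac_numeral)
  define d where "d p i u = to_ac (c (Suc i) (Suc p) (Suc u))" for p i u
  have d: "(\<Sum>i<n. d p i u * d q i v + d p i v * d q i u) = (if p = q \<and> u = v then 2 else 0)"
    if "p < r" "q < r" "u < s" "v < s" for p q u v
  proof -
    have "(\<Sum>i<n. d p i u * d q i v + d p i v * d q i u)
      = to_ac (\<Sum>i<n. c (Suc i) (Suc p) (Suc u) * c (Suc i) (Suc q) (Suc v) + c (Suc i) (Suc p) (Suc v) * c (Suc i) (Suc q) (Suc u))"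
      by (simp add: d_def to_ac_sum)
    also have "(\<Sum>i<n. c (Suc i) (Suc p) (Suc u) * c (Suc i) (Suc q) (Suc v) + c (Suc i) (Suc p) (Suc v) * c (Suc i) (Suc q) (Suc u))
      = (\<Sum>j=1..n. c j (Suc p) (Suc u) * c j (Suc q) (Suc v) + c j (Suc p) (Suc v) * c j (Suc q) (Suc u))"
      by (rule sum.reindex_bij_witness[where i = "\<lambda>j. j - 1" and j = Suc]) auto
    also have "\<dots> = (if p = q \<and> u = v then 2 else 0)" using c[of "Suc p" "Suc q" "Suc u" "Suc v"] that by simp
    finally show ?thesis by auto
  qed
  define m where "m p i = (\<Sum>u<s. cst (d p i u) * indet u)" for p i
  obtain j :: "'a alg_closure" where j: "j ^ 2 = -1"
    using nth_root_exists[of 2 "-1 :: 'a alg_closure"] by auto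
  have "orthogonal_frame s n r m j"
  proof
    show "j * j = -1" using j by (simp add: power2_eq_square)
    show "linear_form s (m p i)" for p i unfolding linear_form_def m_def by blast
    fix p q assume pq: "p < r" "q < r"
    show "(\<Sum>i<n. m p i * m q i) = (if p = q then quadric s else 0)"
    proof (rule two_cancel[OF two'])
      have prod: "(\<Sum>i<n. m p i * m q i) = (\<Sum>u<s. \<Sum>v<s. \<Sum>i<n. cst (d p i u * d q i v) * (indet u * indet v))"
      proof -
        have "(\<Sum>i<n. m p i * m q i) = (\<Sum>i<n. \<Sum>u<s. \<Sum>v<s. cst (d p i u * d q i v) * (indet u * indet v))"
          by (simp add: m_def sum_product mult_ac)
        also have "\<dots> = (\<Sum>u<s. \<Sum>i<n. \<Sum>v<s. cst (d p i u * d q i v) * (indet u * indet v))" by (rule sum.swap)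
        also have "\<dots> = (\<Sum>u<s. \<Sum>v<s. \<Sum>i<n. cst (d p i u * d q i v) * (indet u * indet v))"
          by (intro sum.cong refl sum.swap)
        finally show ?thesis .
      qed
      have prod': "(\<Sum>i<n. m p i * m q i) = (\<Sum>u<s. \<Sum>v<s. \<Sum>i<n. cst (d p i v * d q i u) * (indet u * indet v))"
      proof -
        have "(\<Sum>i<n. m p i * m q i) = (\<Sum>u<s. \<Sum>v<s. \<Sum>i<n. cst (d p i v * d q i u) * (indet v * indet u))"
          unfolding prod by (rule sum.swap)
        also have "\<dots> = (\<Sum>u<s. \<Sum>v<s. \<Sum>i<n. cst (d p i v * d q i u) * (indet u * indet v))"
          by (intro sum.cong refl arg_cong2[where f = "(*)"] mult.commute)
        finally show ?thesis .
      qed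
      have "2 * (\<Sum>i<n. m p i * m q i) = (\<Sum>i<n. m p i * m q i) + (\<Sum>i<n. m p i * m q i)" by simp
      also have "\<dots> = (\<Sum>u<s. \<Sum>v<s. \<Sum>i<n. cst (d p i u * d q i v) * (indet u * indet v))
          + (\<Sum>u<s. \<Sum>v<s. \<Sum>i<n. cst (d p i v * d q i u) * (indet u * indet v))" by (rule arg_cong2[where f = "(+)", OF prod prod'])
      also have "\<dots> = (\<Sum>u<s. \<Sum>v<s. cst (\<Sum>i<n. d p i u * d q i v + d p i v * d q i u) * (indet u * indet v))"
        unfolding sum.distrib[symmetric]
        by (intro sum.cong refl) (simp only: cst_sum cst_simps(3) sum_distrib_right distrib_right)
      also have "\<dots> = (\<Sum>u<s. \<Sum>v<s. if u = v then (if p = q then 2 else 0) * (indet u * indet u) else 0)"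
      proof (intro sum.cong refl)
        fix u v assume "u \<in> {..<s}" "v \<in> {..<s}"
        then have "(\<Sum>i<n. d p i u * d q i v + d p i v * d q i u) = (if p = q \<and> u = v then 2 else 0)"
          using d pq by simp
        then show "cst (\<Sum>i<n. d p i u * d q i v + d p i v * d q i u) * (indet u * indet v)
            = (if u = v then (if p = q then 2 else 0) * (indet u * indet u) else 0)"
          by (simp add: cst_two)
      qed
      also have "\<dots> = 2 * (if p = q then quadric s else 0)"
        by (simp add: quadric_def sum_distrib_left)
      finally show "2 * (\<Sum>i<n. m p i * m q i) = 2 * (if p = q then quadric s else 0)" .
    qed
  qed (use two' s in auto)
  then show ?thesis by blast
qed

section \<open>The divisibility theorem\<close>

theorem theorem1p3:
  fixes r s n :: nat
  assumes "CHAR('a::field) \<noteq> 2"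
    and "r \<ge> 1" and "s \<ge> 1" and "n \<ge> 1"
    and "\<exists>z :: nat \<Rightarrow> 'a xy_poly. sums_of_squares_formula r s n z"
  shows "\<forall>i::int. int n - int r < i \<and> i \<le> \<lfloor>(real s - 1) / 2\<rfloor> \<longrightarrow>
    2 ^ nat (\<lfloor>(real s - 1) / 2\<rfloor> - i + 1) dvd binom_int (int r + i - 1) i"
proof (intro allI impI)
  fix i :: int
  assume i: "int n - int r < i \<and> i \<le> \<lfloor>(real s - 1) / 2\<rfloor>"
  have two: "(2 :: 'a) \<noteq> 0"
  proof
    assume "(2 :: 'a) = 0"
    then have "of_nat 2 = (0 :: 'a)" by simp
    then have "CHAR('a) dvd 2" by (simp only: of_nat_eq_0_iff_char_dvd)
    moreover have "CHAR('a) \<noteq> 1" by simp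
    ultimately show False using assms(1) two_is_prime_nat by (auto simp: prime_nat_iff)
  qed
  obtain z :: "nat \<Rightarrow> 'a xy_poly" where "sums_of_squares_formula r s n z" using assms(5) by blast
  then obtain m :: "nat \<Rightarrow> nat \<Rightarrow> 'a alg_closure mpol" and j where "orthogonal_frame s n r m j"
    using orthogonal_frame_of_formula[OF two assms(3)] by blast
  then interpret orthogonal_frame s n r m j .
  define e where "e = s - s div 2"
  have e: "e \<ge> 1" using assms(3) by (simp add: e_def)
  have "\<not> (2 ^ e :: int) dvd 1" using e by (simp add: zdvd1_eq)
  then have key: "r \<le> n \<and> (\<forall>i>n - r. 2 ^ e dvd 2 ^ i * int ((r + i - 1) choose i))"
    using binomial_divisibility_from_recurrence[of \<kappa> n r "2 ^ e"] \<kappa>_0 \<kappa>_recurrence \<kappa>_degree_zero \<kappa>_trivial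
    unfolding e_def by blast
  define k where "k = nat i"
  have k: "i = int k" "k > n - r" using i key by (auto simp: k_def)
  have fl: "\<lfloor>(real s - 1) / 2\<rfloor> = int ((s - 1) div 2)"
  proof -
    have "(real s - 1) / 2 = real (s - 1) / real 2" using assms(3) by simp
    then show ?thesis by (simp only: floor_divide_of_nat_eq)
  qed
  have "(s - 1) div 2 = e - 1" using assms(3) by (simp add: e_def)
  then have fl: "\<lfloor>(real s - 1) / 2\<rfloor> = int (e - 1)" using fl by simp
  have ke: "k < e" using i k e unfolding fl by simp
  have ex: "nat (\<lfloor>(real s - 1) / 2\<rfloor> - i + 1) = e - k" using k ke unfolding fl by simp
  have "binom_int (int r + i - 1) i = int ((r + k - 1) choose k)"
  proof -
    have eq: "int r + i - 1 = int (r + k - 1)" using k assms(2) by simp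
    have "k \<le> r + k - 1" using assms(2) by simp
    then show ?thesis unfolding eq unfolding k(1)
      by (simp only: binom_int_def nat_int of_nat_0_le_iff of_nat_le_iff simp_thms if_True)
  qed
  moreover have "(2 :: int) ^ (e - k) dvd int ((r + k - 1) choose k)"
  proof -
    have "(2 :: int) ^ e = 2 ^ k * 2 ^ (e - k)" using ke by (simp flip: power_add)
    then have "(2 :: int) ^ k * 2 ^ (e - k) dvd 2 ^ k * int ((r + k - 1) choose k)" using key k by metis
    then show ?thesis by simp
  qed
  ultimately show "2 ^ nat (\<lfloor>(real s - 1) / 2\<rfloor> - i + 1) dvd binom_int (int r + i - 1) i"
    unfolding ex by simp
qed

end
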